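(* Let $\alpha\in(\frac12,1)$, $u_0\in\mathcal{B}_b(\mathbb{R}^N)$, $B_0\in C_b^{0,3}([0,T]\times\mathbb{R}^N;\mathbb{R}^N)$, $f\in C([0,T];\mathbb{R}^N)$, $B(t,x)=B_0(t,x)-f(t)$, and $0<t\le T$. Then the series $\sum_{n=0}^\infty v_s^n(t,x)$ converges uniformly in $(s,x)\in[0,t]\times\mathbb{R}^N$, and the series $\sum_{n=0}^\infty\nabla^\top v_s^n(t,x)$ converges uniformly in $(s,x)\in[0,t_0]\times\mathbb{R}^N$, for every $t_0\in(0,t)$. In particular, $$\sum_{n=0}^\infty v_s^n(t,x)=u_s^{u_0}(t,x),\qquad s\in[0,t],\ x\in\mathbb{R}^N,$$ where $u_s^{u_0}(t,x)$ is the unique solution of $$u_s(t,x)=R_{s,t}u_0(x)+\int_s^tR_{s,r}\big(\langle B(r,\cdot),\nabla^\top u_r(t,\cdot)\rangle\big)(x)\,dr,\qquad s\in[0,t],\ x\in\mathbb{R}^N,$$ such that $(s,x)\mapsto u_{t-s}(t,x)$ belongs to $\Lambda_1^\gamma(0,t]$, $\gamma=1/(2\alpha)$.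
   Context: Fix $N\in\mathbb{N}$, $T>0$ and a complete probability space $(\Omega,\mathcal{F},\mathbb{P})$. $W=(\beta^1,\dots,\beta^N)^\top$ is a standard $N$-dimensional Brownian motion and $L=(L_t)_{t\ge0}$ is a strictly $\alpha$-stable subordinator (increasing Lévy process) independent of $W$, with $\mathbb{E}[e^{iuL_1}]=\exp\{-\bar\gamma^\alpha|u|^\alpha(1-i\tan\frac{\pi\alpha}{2}\,\mathrm{sign}\,u)\}$, $u\in\mathbb{R}$, for some $\bar\gamma>0$. $W_L=(W_{L_t})_{t\ge0}$. $A=-\mathrm{diag}[\lambda_1,\dots,\lambda_N]$ with $0<\lambda_1\le\dots\le\lambda_N$, $Q=\mathrm{diag}[\sigma_1^2,\dots,\sigma_N^2]$ with $\sigma_n^2>0$. $\mathcal{B}_b(\mathbb{R}^N)$ denotes the real-valued bounded Borel functions; $C_b^1(\mathbb{R}^N)$ the bounded $C^1$ functions with bounded first derivatives; $C_b^{0,n}([0,T]\times\mathbb{R}^N;\mathbb{R}^N)$ the bounded continuous maps whose partial derivatives in the space variable up to order $n$ exist, are continuous and bounded. $Z^{s,x}=(Z^{s,x}_t)_{t\in[s,T]}$ is the unique solution of $dZ_t^{s,x}=(AZ_t^{s,x}+f(t))dt+\sqrt{Q}\,dW_{L_t}$, $Z_s^{s,x}=x$, and $R_{s,t}\phi(x)=\mathbb{E}[\phi(Z_t^{s,x})]$ for $0\le s\le t\le T$, $\phi\in\mathcal{B}_b(\mathbb{R}^N)$. The functions $v^n_s(t,x)$ are defined recursively, for $s\in[0,t]$,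 $u\in[0,t)$, $x\in\mathbb{R}^N$, $n\in\mathbb{N}\cup\{0\}$, by $$v^0_s(t,x)=R_{s,t}u_0(x),\qquad k^n_{u,t}(x)=\langle B(u,x),\nabla^\top v^n_u(t,x)\rangle,\qquad v^{n+1}_s(t,x)=\int_s^tR_{s,u}k^n_{u,t}(x)\,du,$$ where $\nabla^\top$ is the (column) gradient in $x$; these are well defined. $\Lambda_1^\gamma(0,t]$ is the set of measurable $V\colon(0,t]\times\mathbb{R}^N\to\mathbb{R}$ such that $V(\cdot,x)$ is continuous on $(0,t]$ for every $x$, $V(s,\cdot)\in C_b^1(\mathbb{R}^N)$ for every $s\in(0,t]$, and $\sup_{s\in(0,t]}s^\gamma\big(\|V(s,\cdot)\|_\infty+\sup_{i}\|\partial_{x_i}V(s,\cdot)\|_\infty\big)<\infty$. *)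

theory Defs
  imports "HOL-Probability.Probability"
begin

text \<open>Stochastic processes are functions \<open>X :: real \<Rightarrow> 'w \<Rightarrow> 'b\<close>; only the times \<open>t \<ge> 0\<close> matter.
  Path properties are required almost surely.\<close>

definition process_path :: "(real \<Rightarrow> 'w \<Rightarrow> 'b) \<Rightarrow> 'w \<Rightarrow> real \<Rightarrow> 'b" where
  "process_path X \<omega> = (\<lambda>t\<in>{0..}. X t \<omega>)"

definition cadlag_on :: "real set \<Rightarrow> (real \<Rightarrow> 'b::topological_space) \<Rightarrow> bool" where
  "cadlag_on I p \<longleftrightarrow>
     (\<forall>t\<in>I. (p \<longlongrightarrow> p t) (at t within (I \<inter> {t<..})) \<and>
            (\<exists>l. (p \<longlongrightarrow> l) (at t within (I \<inter> {..<t}))))"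

definition independent_increments :: "'w measure \<Rightarrow> (real \<Rightarrow> 'w \<Rightarrow> real) \<Rightarrow> bool" where
  "independent_increments M X \<longleftrightarrow>
     (\<forall>(\<tau> :: nat \<Rightarrow> real) n. 0 \<le> \<tau> 0 \<and> mono \<tau> \<longrightarrow>
        prob_space.indep_vars M (\<lambda>_. borel) (\<lambda>k \<omega>. X (\<tau> (Suc k)) \<omega> - X (\<tau> k) \<omega>) {..<n})"

definition standard_brownian_motion1 :: "'w measure \<Rightarrow> (real \<Rightarrow> 'w \<Rightarrow> real) \<Rightarrow> bool" where
  "standard_brownian_motion1 M \<beta> \<longleftrightarrow>
     (\<forall>t\<ge>0. \<beta> t \<in> borel_measurable M) \<and>
     (AE \<omega> in M. \<beta> 0 \<omega> = 0) \<and>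
     independent_increments M \<beta> \<and>
     (\<forall>s t. 0 \<le> s \<and> s < t \<longrightarrow>
        distributed M lborel (\<lambda>\<omega>. \<beta> t \<omega> - \<beta> s \<omega>) (normal_density 0 (sqrt (t - s)))) \<and>
     (AE \<omega> in M. continuous_on {0..} (\<lambda>t. \<beta> t \<omega>))"

definition standard_brownian_motion :: "'w measure \<Rightarrow> (real \<Rightarrow> 'w \<Rightarrow> real^'n) \<Rightarrow> bool" where
  "standard_brownian_motion M W \<longleftrightarrow>
     (\<forall>i. standard_brownian_motion1 M (\<lambda>t \<omega>. W t \<omega> $ i)) \<and>
     prob_space.indep_vars M (\<lambda>_. PiM {0..} (\<lambda>_. borel))
       (\<lambda>i. process_path (\<lambda>t \<omega>. W t \<omega> $ i)) UNIV"

definition levy_process :: "'w measure \<Rightarrow> (real \<Rightarrow> 'w \<Rightarrow> real) \<Rightarrow> bool" where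
  "levy_process M X \<longleftrightarrow>
     (\<forall>t\<ge>0. X t \<in> borel_measurable M) \<and>
     (AE \<omega> in M. X 0 \<omega> = 0) \<and>
     independent_increments M X \<and>
     (\<forall>s\<ge>0. \<forall>t\<ge>0. distr M borel (\<lambda>\<omega>. X (s + t) \<omega> - X s \<omega>) = distr M borel (X t)) \<and>
     (AE \<omega> in M. cadlag_on {0..} (\<lambda>t. X t \<omega>))"

definition subordinator :: "'w measure \<Rightarrow> (real \<Rightarrow> 'w \<Rightarrow> real) \<Rightarrow> bool" where
  "subordinator M L \<longleftrightarrow> levy_process M L \<and> (AE \<omega> in M. mono_on {0..} (\<lambda>t. L t \<omega>))"

text \<open>Strict stability of index \<open>\<alpha>\<close>: the processes \<open>(X\<^bsub>a t\<^esub>)\<^sub>t\<close> and \<open>(a\<^bsup>1/\<alpha>\<^esup> X\<^sub>t)\<^sub>t\<close> have the same law.\<close>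

definition strictly_stable_process :: "'w measure \<Rightarrow> real \<Rightarrow> (real \<Rightarrow> 'w \<Rightarrow> real) \<Rightarrow> bool" where
  "strictly_stable_process M \<alpha> X \<longleftrightarrow>
     (\<forall>a>0. distr M (PiM {0..} (\<lambda>_. borel)) (process_path (\<lambda>t. X (a * t)))
          = distr M (PiM {0..} (\<lambda>_. borel)) (process_path (\<lambda>t \<omega>. a powr (1 / \<alpha>) * X t \<omega>)))"

definition stable_subordinator :: "'w measure \<Rightarrow> real \<Rightarrow> real \<Rightarrow> (real \<Rightarrow> 'w \<Rightarrow> real) \<Rightarrow> bool" where
  "stable_subordinator M \<alpha> \<gamma> L \<longleftrightarrow>
     subordinator M L \<and> strictly_stable_process M \<alpha> L \<and>
     (\<forall>u::real. char (distr M borel (L 1)) u =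
        exp (- complex_of_real (\<gamma> powr \<alpha> * \<bar>u\<bar> powr \<alpha>) *
               (1 - \<i> * complex_of_real (tan (pi * \<alpha> / 2) * sgn u))))"

definition independent_processes ::
    "'w measure \<Rightarrow> (real \<Rightarrow> 'w \<Rightarrow> 'a::topological_space) \<Rightarrow> (real \<Rightarrow> 'w \<Rightarrow> 'b::topological_space) \<Rightarrow> bool"
  where
  "independent_processes M X Y \<longleftrightarrow>
     prob_space.indep_set M
       (sets (vimage_algebra (space M) (process_path X) (PiM {0..} (\<lambda>_. borel))))
       (sets (vimage_algebra (space M) (process_path Y) (PiM {0..} (\<lambda>_. borel))))"

definition subordinated :: "(real \<Rightarrow> 'w \<Rightarrow> 'b) \<Rightarrow> (real \<Rightarrow> 'w \<Rightarrow> real) \<Rightarrow> real \<Rightarrow> 'w \<Rightarrow> 'b" where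
  "subordinated W L t \<omega> = W (L t \<omega>) \<omega>"

definition diag_matrix :: "('n \<Rightarrow> real) \<Rightarrow> real^'n^'n" where
  "diag_matrix d = (\<chi> i j. if i = j then d i else 0)"

text \<open>Solution \<open>Z\<close> on \<open>[s,T]\<close> of \<open>dZ\<^sub>t = (A Z\<^sub>t + f(t)) dt + S dY\<^sub>t\<close>, \<open>Z\<^sub>s = x\<close>. The noise is additive with
  the constant matrix \<open>S\<close>, so its stochastic integral over \<open>(s,t]\<close> is \<open>S (Y\<^sub>t - Y\<^sub>s)\<close>.\<close>

definition linear_SDE_solution ::
    "'w measure \<Rightarrow> real^'n^'n \<Rightarrow> (real \<Rightarrow> real^'n) \<Rightarrow> real^'n^'n \<Rightarrow> (real \<Rightarrow> 'w \<Rightarrow> real^'n) \<Rightarrow>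
     real \<Rightarrow> real \<Rightarrow> real^'n \<Rightarrow> (real \<Rightarrow> 'w \<Rightarrow> real^'n) \<Rightarrow> bool" where
  "linear_SDE_solution M A f S Y T s x Z \<longleftrightarrow>
     (\<forall>t\<in>{s..T}. Z t \<in> borel_measurable M) \<and>
     (AE \<omega> in M. cadlag_on {s..T} (\<lambda>t. Z t \<omega>) \<and>
        (\<forall>t\<in>{s..T}.
           set_integrable lborel {s..t} (\<lambda>r. A *v Z r \<omega> + f r) \<and>
           Z t \<omega> = x + (LINT r:{s..t}|lborel. A *v Z r \<omega> + f r) + S *v (Y t \<omega> - Y s \<omega>)))"

definition transition_op ::
    "'w measure \<Rightarrow> (real \<Rightarrow> 'a \<Rightarrow> real \<Rightarrow> 'w \<Rightarrow> 'a) \<Rightarrow> real \<Rightarrow> real \<Rightarrow> ('a \<Rightarrow> real) \<Rightarrow> 'a \<Rightarrow> real" where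
  "transition_op M Z s t \<phi> x = (LINT \<omega>|M. \<phi> (Z s x t \<omega>))"

definition has_partial :: "'n \<Rightarrow> (real^'n \<Rightarrow> 'b::real_normed_vector) \<Rightarrow> real^'n \<Rightarrow> bool" where
  "has_partial i g x \<longleftrightarrow> (\<lambda>h. g (x + h *\<^sub>R axis i 1)) differentiable (at (0::real))"

definition partial :: "'n \<Rightarrow> (real^'n \<Rightarrow> 'b::real_normed_vector) \<Rightarrow> real^'n \<Rightarrow> 'b" where
  "partial i g x = vector_derivative (\<lambda>h. g (x + h *\<^sub>R axis i 1)) (at (0::real))"

definition gradient :: "(real^'n \<Rightarrow> real) \<Rightarrow> real^'n \<Rightarrow> real^'n" where
  "gradient g x = (\<chi> i. partial i g x)"

definition bounded_borel :: "('a::topological_space \<Rightarrow> real) \<Rightarrow> bool" where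
  "bounded_borel g \<longleftrightarrow> g \<in> borel_measurable borel \<and> bounded (range g)"

definition Cb1 :: "(real^'n \<Rightarrow> real) \<Rightarrow> bool" where
  "Cb1 g \<longleftrightarrow> continuous_on UNIV g \<and> bounded (range g) \<and>
     (\<forall>i. (\<forall>x. has_partial i g x) \<and> continuous_on UNIV (partial i g) \<and> bounded (range (partial i g)))"

primrec Cb0n :: "real \<Rightarrow> nat \<Rightarrow> (real \<Rightarrow> real^'n \<Rightarrow> 'b::real_normed_vector) \<Rightarrow> bool" where
  "Cb0n T 0 G \<longleftrightarrow>
     continuous_on ({0..T} \<times> UNIV) (\<lambda>(t, x). G t x) \<and>
     bounded ((\<lambda>(t, x). G t x) ` ({0..T} \<times> UNIV))"
| "Cb0n T (Suc n) G \<longleftrightarrow>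
     continuous_on ({0..T} \<times> UNIV) (\<lambda>(t, x). G t x) \<and>
     bounded ((\<lambda>(t, x). G t x) ` ({0..T} \<times> UNIV)) \<and>
     (\<forall>i. (\<forall>t\<in>{0..T}. \<forall>x. has_partial i (G t) x) \<and> Cb0n T n (\<lambda>t. partial i (G t)))"

text \<open>In the next two definitions \<open>R\<close> is the family of transition operators. The integrals are over
  \<open>[s,t)\<close> because the gradient need not exist at the terminal time \<open>t\<close>.\<close>

primrec v_iter ::
    "(real \<Rightarrow> real \<Rightarrow> (real^'n \<Rightarrow> real) \<Rightarrow> real^'n \<Rightarrow> real) \<Rightarrow> (real \<Rightarrow> real^'n \<Rightarrow> real^'n) \<Rightarrow>
     (real^'n \<Rightarrow> real) \<Rightarrow> real \<Rightarrow> nat \<Rightarrow> real \<Rightarrow> real^'n \<Rightarrow> real" where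
  "v_iter R B u0 t 0 = (\<lambda>s x. R s t u0 x)"
| "v_iter R B u0 t (Suc n) =
     (\<lambda>s x. LINT r:{s..<t}|lborel. R s r (\<lambda>y. B r y \<bullet> gradient (v_iter R B u0 t n r) y) x)"

definition mild_solution ::
    "(real \<Rightarrow> real \<Rightarrow> (real^'n \<Rightarrow> real) \<Rightarrow> real^'n \<Rightarrow> real) \<Rightarrow> (real \<Rightarrow> real^'n \<Rightarrow> real^'n) \<Rightarrow>
     (real^'n \<Rightarrow> real) \<Rightarrow> real \<Rightarrow> (real \<Rightarrow> real^'n \<Rightarrow> real) \<Rightarrow> bool" where
  "mild_solution R B u0 t u \<longleftrightarrow>
     (\<forall>s\<in>{0..t}. \<forall>x.
        set_integrable lborel {s..<t} (\<lambda>r. R s r (\<lambda>y. B r y \<bullet> gradient (u r) y) x) \<and>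
        u s x = R s t u0 x + (LINT r:{s..<t}|lborel. R s r (\<lambda>y. B r y \<bullet> gradient (u r) y) x))"

definition Lambda1 :: "real \<Rightarrow> real \<Rightarrow> (real \<Rightarrow> real^'n \<Rightarrow> real) set" where
  "Lambda1 \<gamma> t =
     {V. (\<lambda>(s, x). V s x) \<in> borel_measurable (restrict_space borel ({0<..t} \<times> UNIV)) \<and>
         (\<forall>x. continuous_on {0<..t} (\<lambda>s. V s x)) \<and>
         (\<forall>s\<in>{0<..t}. Cb1 (V s)) \<and>
         bdd_above ((\<lambda>s. s powr \<gamma> * ((SUP x. \<bar>V s x\<bar>) + (SUP i. SUP x. \<bar>partial i (V s) x\<bar>)))
                    ` {0<..t})}"

end

(*
  The equation is solved by Picard iteration, so everything rests on the gradient estimate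
  |grad R_{s,t} phi| <= C (t-s)^(-gamma) |phi|.  Conditionally on the subordinator L, the noise in
  Z_t is a centred Gaussian vector with independent coordinates of variances
  V_i = sig_i^2 int_s^t exp(-2 lam_i (t-r)) dL_r >= c (L_t - L_s), so R_{s,t} phi is a mixture of
  Gaussian kernels.  Differentiating the Gaussian density costs V_i^(-1/2), and by stability
  E (L_t - L_s)^(-1/2) = (t-s)^(-1/(2 alpha)) E L_1^(-1/2), which is finite because the characteristic
  function of L_1 is integrable.  Since gamma = 1/(2 alpha) < 1, the Volterra operator
  v |-> int_s^t R_{s,r} <B, grad v_r> dr is a contraction for the gradient norm with weight
  exp(-rho (t-s)) (t-s)^gamma once rho is large: the terms of the series decay geometrically in this
  norm, and two solutions coincide.
*)

theory Submission
  imports Defs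
begin

section \<open>Differentiation under the integral\<close>

text \<open>The datum \<open>u0\<close> is only bounded and Borel, so regularity must come from the
  kernel alone: derivatives always fall on the Gaussian density, and continuity in mean and variance
  comes from L1 convergence of densities, never from continuity of the test function.

  Conditioning on \<open>L\<close> meets a measurability obstacle. In the product sigma-algebra of
  path space a function sees only countably many coordinates of a path, so evaluating the path of
  \<open>W\<close> at the random time \<open>L r\<close> is not a measurable operation. The random
  times are therefore rounded up to a countable grid. To survive the limit, the noise integral is
  rewritten by parts as \<open>exp_conv\<close>, a Lebesgue integral of the path itself, which is a
  limit of Riemann sums of finitely many increments. The limit is taken under continuous test
  functions; equality of the two laws then extends the formula to Borel ones.

  The source term sees a function only through its gradient, so the iteration is run on gradient
  bounds; sup bounds follow because the singularity is integrable.\<close>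

lemma has_partial_iff_has_derivative:
  fixes g :: "real^'n \<Rightarrow> real"
  shows "has_partial i g x \<longleftrightarrow>
    ((\<lambda>h. g (x + h *\<^sub>R axis i 1)) has_real_derivative partial i g x) (at 0)"
  unfolding has_partial_def partial_def
  by (simp add: vector_derivative_works has_real_derivative_iff_has_vector_derivative)

lemma has_partialI:
  fixes g :: "real^'n \<Rightarrow> real"
  assumes "((\<lambda>h. g (x + h *\<^sub>R axis i 1)) has_real_derivative D) (at 0)"
  shows "has_partial i g x" "partial i g x = D"
  using assms unfolding has_partial_def partial_def
  by (auto simp: has_real_derivative_iff_has_vector_derivative vector_derivative_at
      intro: differentiableI_vector)

text \<open>The definition differentiates at \<open>h = 0\<close> only; moving the base point gives
  the derivative at every point of the axis line, as the mean value theorem requires.\<close>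

lemma has_derivative_partial_line:
  fixes g :: "real^'n \<Rightarrow> real"
  assumes "has_partial i g (x + h *\<^sub>R axis i 1)"
  shows "((\<lambda>h. g (x + h *\<^sub>R axis i 1)) has_real_derivative partial i g (x + h *\<^sub>R axis i 1)) (at h)"
proof -
  have "((\<lambda>k. g (x + h *\<^sub>R axis i 1 + k *\<^sub>R axis i 1)) has_real_derivative
      partial i g (x + h *\<^sub>R axis i 1)) (at (h - h))"
    using assms by (simp add: has_partial_iff_has_derivative)
  then have "((\<lambda>h'. g (x + h *\<^sub>R axis i 1 + (h' - h) *\<^sub>R axis i 1)) has_real_derivative
      partial i g (x + h *\<^sub>R axis i 1)) (at h)"
    by (rule DERIV_chain2[where Db=1, simplified]) (auto intro!: derivative_eq_intros)
  then show ?thesis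
    by (simp add: algebra_simps)
qed

lemma partial_bound_imp_axis_lipschitz:
  fixes g :: "real^'n \<Rightarrow> real"
  assumes "\<And>x. has_partial i g x" "\<And>x. \<bar>partial i g x\<bar> \<le> c"
  shows "\<bar>g (x + h *\<^sub>R axis i 1) - g x\<bar> \<le> c * \<bar>h\<bar>"
proof -
  have "norm (g (x + h *\<^sub>R axis i 1) - g (x + 0 *\<^sub>R axis i 1)) \<le> c * norm (h - 0)"
    by (rule field_differentiable_bound[of UNIV _ "\<lambda>h. partial i g (x + h *\<^sub>R axis i 1)"])
      (use assms(2) has_derivative_partial_line[OF assms(1)] in \<open>auto intro: has_field_derivative_at_within\<close>)
  then show ?thesis by simp
qed

text \<open>Coordinates are changed one at a time, \<open>S\<close> being those already moved, so
  partial derivatives suffice; the price is the l1 distance on the right.\<close>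

lemma partial_bound_imp_lipschitz:
  fixes g :: "real^'n::finite \<Rightarrow> real"
  assumes "\<And>i x. has_partial i g x" "\<And>i x. \<bar>partial i g x\<bar> \<le> c"
  shows "\<bar>g y - g x\<bar> \<le> c * (\<Sum>i\<in>UNIV. \<bar>y $ i - x $ i\<bar>)"
proof -
  have *: "\<bar>g (x + (\<Sum>i\<in>S. (y $ i - x $ i) *\<^sub>R axis i 1)) - g x\<bar> \<le> c * (\<Sum>i\<in>S. \<bar>y $ i - x $ i\<bar>)"
    if "finite S" for S
    using that
  proof (induction S)
    case (insert j S)
    let ?z = "x + (\<Sum>i\<in>S. (y $ i - x $ i) *\<^sub>R axis i 1)"
    have "\<bar>g (?z + (y $ j - x $ j) *\<^sub>R axis j 1) - g ?z\<bar> \<le> c * \<bar>y $ j - x $ j\<bar>"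
      by (rule partial_bound_imp_axis_lipschitz) (use assms in auto)
    with insert show ?case
      by (simp add: algebra_simps)
  qed simp
  have "x + (\<Sum>i\<in>UNIV. (y $ i - x $ i) *\<^sub>R axis i 1) = y"
    by (simp add: vec_eq_iff axis_def if_distrib [where f="\<lambda>z. _ * z"] sum.delta cong: if_cong)
  with *[of UNIV] show ?thesis by simp
qed

text \<open>The mean value theorem turns the bound on \<open>D h\<close> into a bound of the
  difference quotients by \<open>g\<close>, and dominated convergence along null sequences finishes.
  The exceptional null set is the same for all \<open>h\<close>.\<close>

lemma has_real_derivative_integral:
  fixes F D :: "real \<Rightarrow> 'a \<Rightarrow> real"
  assumes int: "\<And>h. \<bar>h\<bar> < 1 \<Longrightarrow> integrable M (F h)"
    and D: "D 0 \<in> borel_measurable M" and g: "integrable M g"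
    and der: "AE a in M. \<forall>h. \<bar>h\<bar> < 1 \<longrightarrow>
      ((\<lambda>h. F h a) has_real_derivative D h a) (at h) \<and> \<bar>D h a\<bar> \<le> g a"
  shows "((\<lambda>h. LINT a|M. F h a) has_real_derivative (LINT a|M. D 0 a)) (at 0)"
proof -
  \<comment> \<open>Restricting the limit to the window keeps all sequences where \<open>g\<close>
    dominates; as the window is open, the restriction disappears at the end.\<close>
  have "((\<lambda>h. ((LINT a|M. F h a) - (LINT a|M. F 0 a)) / h) \<longlongrightarrow> (LINT a|M. D 0 a)) (at 0 within {-1<..<1})"
    unfolding tendsto_at_iff_sequentially
  proof (intro allI impI)
    fix X :: "nat \<Rightarrow> real"
    assume X: "\<forall>i. X i \<in> {-1<..<1} - {0}" "X \<longlonglongrightarrow> 0"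
    have X1: "\<bar>X n\<bar> < 1" "X n \<noteq> 0" for n
      using X(1) by (auto simp: abs_less_iff)
    have lim: "(\<lambda>n. LINT a|M. (F (X n) a - F 0 a) / X n) \<longlonglongrightarrow> (LINT a|M. D 0 a)"
    proof (rule integral_dominated_convergence[where w=g])
      show "(\<lambda>a. (F (X n) a - F 0 a) / X n) \<in> borel_measurable M" for n
        using int[OF X1(1)] int[of 0] by (auto dest!: borel_measurable_integrable)
      show "AE a in M. (\<lambda>n. (F (X n) a - F 0 a) / X n) \<longlonglongrightarrow> D 0 a"
        using der
      proof eventually_elim
        case (elim a)
        then have "((\<lambda>h. F h a) has_real_derivative D 0 a) (at 0)" by simp
        then have "((\<lambda>h. (F h a - F 0 a) / h) \<longlongrightarrow> D 0 a) (at 0)"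
          by (simp add: DERIV_def)
        then show ?case
          using X(2) X1(2) by (auto simp: tendsto_at_iff_sequentially o_def)
      qed
      show "AE a in M. norm ((F (X n) a - F 0 a) / X n) \<le> g a" for n
        using der
      proof eventually_elim
        case (elim a)
        have "norm (F (X n) a - F 0 a) \<le> g a * norm (X n - 0)"
          by (rule field_differentiable_bound[of "{-1<..<1}" _ "\<lambda>h. D h a"])
            (use elim X1[of n] in \<open>auto intro: has_field_derivative_at_within simp: abs_less_iff\<close>)
        then show ?case
          using X1[of n] by (simp add: divide_simps)
      qed
    qed (use D g in auto)
    have eq: "(\<lambda>n. LINT a|M. (F (X n) a - F 0 a) / X n) =
        (\<lambda>h. ((LINT a|M. F h a) - (LINT a|M. F 0 a)) / h) \<circ> X"
    proof
      fix n
      have "(LINT a|M. F (X n) a - F 0 a) = (LINT a|M. F (X n) a) - (LINT a|M. F 0 a)"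
        by (rule Bochner_Integration.integral_diff[OF int int]) (use X1(1) in simp_all)
      then show "(LINT a|M. (F (X n) a - F 0 a) / X n) =
          ((\<lambda>h. ((LINT a|M. F h a) - (LINT a|M. F 0 a)) / h) \<circ> X) n"
        by (simp only: o_def integral_divide_zero)
    qed
    show "((\<lambda>h. ((LINT a|M. F h a) - (LINT a|M. F 0 a)) / h) \<circ> X) \<longlonglongrightarrow> (LINT a|M. D 0 a)"
      using lim unfolding eq .
  qed
  then show ?thesis
    by (simp add: DERIV_def at_within_open[of 0 "{-1<..<1::real}"])
qed

text \<open>Scheffe's lemma upgrades pointwise convergence plus convergence of L1 norms to L1
  convergence, after which any bounded measurable factor is harmless. This spares a dominating
  function for Gaussian kernels with moving variance, and it covers the signed derivative
  kernel.\<close>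

lemma tendsto_integral_bounded_mult_Scheffe:
  fixes F :: "nat \<Rightarrow> 'a \<Rightarrow> real"
  assumes int: "\<And>n. integrable M (F n)" "integrable M f"
    and lim: "AE x in M. (\<lambda>n. F n x) \<longlonglongrightarrow> f x"
    and norm: "(\<lambda>n. LINT x|M. \<bar>F n x\<bar>) \<longlonglongrightarrow> (LINT x|M. \<bar>f x\<bar>)"
    and phi: "\<phi> \<in> borel_measurable M" "\<And>x. \<bar>\<phi> x\<bar> \<le> c"
  shows "(\<lambda>n. LINT x|M. \<phi> x * F n x) \<longlonglongrightarrow> (LINT x|M. \<phi> x * f x)"
proof -
  have c0: "0 \<le> c" using phi(2)[of undefined] by linarith
  have mint: "integrable M (\<lambda>x. \<phi> x * g x)" if "integrable M g" for g :: "'a \<Rightarrow> real"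
    by (rule Bochner_Integration.integrable_bound[of M "\<lambda>x. c * g x"])
      (use that phi c0 in \<open>auto simp: abs_mult intro!: mult_right_mono\<close>)
  have "(\<lambda>n. \<integral>\<^sup>+ x. norm (F n x) \<partial>M) \<longlonglongrightarrow> (\<integral>\<^sup>+ x. norm (f x) \<partial>M)"
    using int norm by (simp add: nn_integral_eq_integral)
  then have "limsup (\<lambda>n. \<integral>\<^sup>+ x. norm (F n x) \<partial>M) \<le> (\<integral>\<^sup>+ x. norm (f x) \<partial>M)"
    by (simp add: lim_imp_Limsup)
  from Scheffe_lemma1[OF int lim this]
  have "(\<lambda>n. ennreal (LINT x|M. \<bar>F n x - f x\<bar>)) \<longlonglongrightarrow> ennreal 0"
    using int by (simp add: nn_integral_eq_integral)
  then have "(\<lambda>n. LINT x|M. \<bar>F n x - f x\<bar>) \<longlonglongrightarrow> 0"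
    by (subst (asm) tendsto_ennreal_iff) auto
  then have lim0: "(\<lambda>n. c * (LINT x|M. \<bar>F n x - f x\<bar>)) \<longlonglongrightarrow> 0"
    by (simp add: tendsto_mult_right_zero)
  have "(\<lambda>n. (LINT x|M. \<phi> x * F n x) - (LINT x|M. \<phi> x * f x)) \<longlonglongrightarrow> 0"
  proof (rule Lim_null_comparison[OF _ lim0], intro always_eventually allI)
    fix n
    have "norm ((LINT x|M. \<phi> x * F n x) - (LINT x|M. \<phi> x * f x)) = norm (LINT x|M. \<phi> x * (F n x - f x))"
      using mint[OF int(1)] mint[OF int(2)] by (simp add: right_diff_distrib)
    also have "\<dots> \<le> (LINT x|M. norm (\<phi> x * (F n x - f x)))"
      by (rule integral_norm_bound)
    also have "\<dots> \<le> (LINT x|M. c * \<bar>F n x - f x\<bar>)"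
      by (rule integral_mono)
        (use int phi mint[of "\<lambda>x. F n x - f x"] in
          \<open>auto simp: abs_mult intro!: mult_right_mono dest!: integrable_abs[of M "\<lambda>x. \<phi> x * (F n x - f x)"]\<close>)
    finally show "norm ((LINT x|M. \<phi> x * F n x) - (LINT x|M. \<phi> x * f x)) \<le> c * (LINT x|M. \<bar>F n x - f x\<bar>)"
      by simp
  qed
  then show ?thesis by (simp add: LIM_zero_iff)
qed

section \<open>Gaussian kernels\<close>

text \<open>\<open>m\<close> holds means and \<open>s\<close> standard deviations. The integration
  variable is a function on the index type instead of a vector, which makes Lebesgue measure a
  \<open>PiM\<close> product.\<close>

definition gauss_density :: "('n \<Rightarrow> real) \<Rightarrow> real^'n \<Rightarrow> ('n \<Rightarrow> real) \<Rightarrow> real" where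
  "gauss_density s m y = (\<Prod>i\<in>UNIV. normal_density (m $ i) (s i) (y i))"

definition gauss_density_deriv :: "'n \<Rightarrow> ('n \<Rightarrow> real) \<Rightarrow> real^'n \<Rightarrow> ('n \<Rightarrow> real) \<Rightarrow> real" where
  "gauss_density_deriv i s m y = (y i - m $ i) / (s i)\<^sup>2 * gauss_density s m y"

abbreviation coord_lborel :: "('n \<Rightarrow> real) measure" where
  "coord_lborel \<equiv> PiM UNIV (\<lambda>_. lborel)"

definition gauss_op :: "(real^'n \<Rightarrow> real) \<Rightarrow> ('n \<Rightarrow> real) \<Rightarrow> real^'n \<Rightarrow> real" where
  "gauss_op \<phi> s m = (LINT y|coord_lborel. \<phi> (vec_lambda y) * gauss_density s m y)"

definition gauss_op_deriv :: "'n \<Rightarrow> (real^'n \<Rightarrow> real) \<Rightarrow> ('n \<Rightarrow> real) \<Rightarrow> real^'n \<Rightarrow> real" where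
  "gauss_op_deriv i \<phi> s m = (LINT y|coord_lborel. \<phi> (vec_lambda y) * gauss_density_deriv i s m y)"

interpretation coord_lborel: product_sigma_finite "\<lambda>_. lborel :: real measure"
  by standard

lemma measurable_vec_lambda [measurable]:
  "vec_lambda \<in> (PiM UNIV (\<lambda>_::'n::finite. borel :: real measure)) \<rightarrow>\<^sub>M borel"
proof (rule borel_measurable_euclidean_space[THEN iffD2], intro ballI)
  fix b :: "real^'n" assume "b \<in> Basis"
  then obtain i where "b = axis i 1" by (auto simp: Basis_vec_def)
  then show "(\<lambda>y. (vec_lambda y :: real^'n) \<bullet> b) \<in> borel_measurable (PiM UNIV (\<lambda>_::'n. borel))"
    by (simp add: inner_axis)
qed

lemma measurable_affine_coord [measurable]:
  fixes m :: "real^'n::finite"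
  shows "(\<lambda>g i. m $ i + s i * g i) \<in> PiM UNIV (\<lambda>_::'n. borel) \<rightarrow>\<^sub>M PiM UNIV (\<lambda>_. borel)"
  by (rule measurable_PiM_single') auto

lemma sets_coord_lborel [measurable_cong, simp]:
  "sets (coord_lborel :: ('n \<Rightarrow> real) measure) = sets (PiM UNIV (\<lambda>_. borel))"
  by (rule sets_PiM_cong) auto

lemma measurable_vec_lambda_coord [measurable]:
  "vec_lambda \<in> (coord_lborel :: ('n::finite \<Rightarrow> real) measure) \<rightarrow>\<^sub>M borel"
  using measurable_vec_lambda by (simp cong: measurable_cong_sets)

lemma measurable_gauss_density [measurable]:
  fixes s :: "'a \<Rightarrow> 'n::finite \<Rightarrow> real"
  assumes [measurable]: "\<And>i. (\<lambda>a. s a i) \<in> borel_measurable M"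
    "m \<in> borel_measurable M" "\<And>i. (\<lambda>a. y a i) \<in> borel_measurable M"
  shows "(\<lambda>a. gauss_density (s a) (m a) (y a)) \<in> borel_measurable M"
proof -
  have [measurable]: "(\<lambda>a. m a $ i) \<in> borel_measurable M" for i
    using borel_measurable_inner[OF assms(2) borel_measurable_const, of "axis i 1"] by (simp add: inner_axis)
  have [measurable]: "(\<lambda>a. s a i) \<in> borel_measurable M" "(\<lambda>a. y a i) \<in> borel_measurable M" for i
    by (fact assms)+
  show ?thesis
    unfolding gauss_density_def normal_density_def
    by (intro borel_measurable_prod) measurable
qed

lemma gauss_density_measurable [measurable]:
  fixes s :: "'n::finite \<Rightarrow> real"
  shows "gauss_density s m \<in> borel_measurable coord_lborel"
  by (rule measurable_gauss_density) measurable

lemma gauss_density_deriv_measurable [measurable]: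
  fixes s :: "'n::finite \<Rightarrow> real"
  shows "gauss_density_deriv i s m \<in> borel_measurable coord_lborel"
  unfolding gauss_density_deriv_def by measurable

lemma gauss_density_nonneg [simp]: "0 \<le> gauss_density s m y"
  unfolding gauss_density_def by (intro prod_nonneg) auto

lemma has_bochner_integral_coord_prod:
  fixes f :: "'n::finite \<Rightarrow> real \<Rightarrow> real"
  assumes "\<And>i. has_bochner_integral lborel (f i) (c i)"
  shows "has_bochner_integral coord_lborel (\<lambda>y. \<Prod>i\<in>UNIV. f i (y i)) (\<Prod>i\<in>UNIV. c i)"
  using coord_lborel.product_integrable_prod[of UNIV f] coord_lborel.product_integral_prod[of UNIV f] assms
  by (simp add: has_bochner_integral_iff)

lemma has_bochner_integral_normal_density:
  "0 < s \<Longrightarrow> has_bochner_integral lborel (normal_density \<mu> s) 1"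
  by (simp add: has_bochner_integral_iff)

lemma has_bochner_integral_gauss_density:
  fixes s :: "'n::finite \<Rightarrow> real"
  assumes "\<And>i. 0 < s i"
  shows "has_bochner_integral coord_lborel (gauss_density s m) 1"
  using has_bochner_integral_coord_prod[of "\<lambda>i. normal_density (m $ i) (s i)" "\<lambda>_. 1"] assms
  by (simp add: gauss_density_def[abs_def] has_bochner_integral_normal_density)

text \<open>The first absolute central moment of a normal variable is its standard deviation times
  \<open>sqrt (2 / pi)\<close>; dividing by the variance leaves \<open>1 / s i\<close>. This is
  where a derivative costs the inverse square root of the variance.\<close>

lemma has_bochner_integral_gauss_density_deriv:
  fixes s :: "'n::finite \<Rightarrow> real"
  assumes s: "\<And>i. 0 < s i"
  shows "has_bochner_integral coord_lborel (\<lambda>y. \<bar>gauss_density_deriv i s m y\<bar>) (sqrt (2 / pi) / s i)"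
proof -
  let ?f = "\<lambda>j z. normal_density (m $ j) (s j) z * (if j = i then \<bar>z - m $ i\<bar> / (s i)\<^sup>2 else 1)"
  have 1: "has_bochner_integral lborel (\<lambda>z. normal_density (m $ i) (s i) z * \<bar>z - m $ i\<bar>) (s i * sqrt (2 / pi))"
    using normal_moment_abs_odd[where \<mu>="m $ i" and \<sigma>="s i" and k=0] s by simp
  have "has_bochner_integral lborel (?f j) (if j = i then sqrt (2 / pi) / s i else 1)" for j
  proof (cases "j = i")
    case True
    have "s i * sqrt (2 / pi) * (1 / (s i)\<^sup>2) = sqrt (2 / pi) / s i"
      using s[of i] by (simp add: power2_eq_square)
    then show ?thesis
      using has_bochner_integral_mult_left[OF 1, of "1 / (s i)\<^sup>2"] True by simp
  qed (simp add: has_bochner_integral_normal_density s)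
  from has_bochner_integral_coord_prod[where f="?f", OF this]
  have "has_bochner_integral coord_lborel (\<lambda>y. \<Prod>j\<in>UNIV. ?f j (y j)) (sqrt (2 / pi) / s i)"
    by (simp add: prod.delta)
  moreover have "(\<Prod>j\<in>UNIV. ?f j (y j)) = \<bar>gauss_density_deriv i s m y\<bar>" for y
    by (simp add: gauss_density_deriv_def abs_mult prod.distrib gauss_density_def[symmetric] prod.delta cong: if_cong)
  ultimately show ?thesis by simp
qed

lemma integrable_gauss_density:
  fixes s :: "'n::finite \<Rightarrow> real"
  assumes "\<And>i. 0 < s i"
  shows "integrable coord_lborel (gauss_density s m)" "integrable coord_lborel (gauss_density_deriv i s m)"
proof -
  show "integrable coord_lborel (gauss_density s m)"
    using has_bochner_integral_gauss_density[of s m] assms by (simp add: has_bochner_integral_iff)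
  show "integrable coord_lborel (gauss_density_deriv i s m)"
    using integrable.intros[OF has_bochner_integral_gauss_density_deriv[of s i m]] assms
    by (subst (asm) integrable_abs_iff) auto
qed

lemma bounded_borelE:
  assumes "bounded_borel \<phi>"
  obtains c where "0 \<le> c" "\<And>x. \<bar>\<phi> x\<bar> \<le> c" "\<phi> \<in> borel_measurable borel"
proof -
  obtain c where "\<And>x. \<bar>\<phi> x\<bar> \<le> c"
    using assms by (auto simp: bounded_borel_def bounded_iff)
  moreover from this[of undefined] have "0 \<le> c" by linarith
  ultimately show thesis
    using assms that by (auto simp: bounded_borel_def)
qed

lemma integrable_bounded_mult:
  fixes f g :: "'a \<Rightarrow> real"
  assumes "integrable M g" "f \<in> borel_measurable M" "\<And>x. \<bar>f x\<bar> \<le> c"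
  shows "integrable M (\<lambda>x. f x * g x)"
proof -
  have "0 \<le> c" using assms(3)[of undefined] by linarith
  then have "norm (f x * g x) \<le> norm (c * g x)" for x
    unfolding real_norm_def abs_mult by (intro mult_right_mono) (use assms(3)[of x] in linarith)+
  moreover have "(\<lambda>x. f x * g x) \<in> borel_measurable M"
    by (intro borel_measurable_times assms(2) borel_measurable_integrable assms(1))
  ultimately show ?thesis
    by (intro Bochner_Integration.integrable_bound[OF integrable_mult_right[OF assms(1), of c]] always_eventually allI)
qed

lemma abs_integral_mult_le:
  fixes f g :: "'a \<Rightarrow> real"
  assumes "integrable M g" "f \<in> borel_measurable M" "\<And>x. \<bar>f x\<bar> \<le> c"
  shows "\<bar>LINT x|M. f x * g x\<bar> \<le> c * (LINT x|M. \<bar>g x\<bar>)"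
proof -
  have "\<bar>LINT x|M. f x * g x\<bar> \<le> (LINT x|M. \<bar>f x * g x\<bar>)"
    by (rule integral_abs_bound)
  also have "\<dots> \<le> (LINT x|M. c * \<bar>g x\<bar>)"
    using assms(1) integrable_bounded_mult[OF assms] mult_right_mono[OF assms(3), OF abs_ge_zero]
    by (intro integral_mono integrable_abs integrable_mult_right) (simp_all add: abs_mult)
  finally show ?thesis by simp
qed

lemma gauss_op_bound:
  fixes s :: "'n::finite \<Rightarrow> real"
  assumes "\<And>i. 0 < s i" "\<phi> \<in> borel_measurable borel" "\<And>x. \<bar>\<phi> x\<bar> \<le> c"
  shows "\<bar>gauss_op \<phi> s m\<bar> \<le> c"
proof -
  have "\<bar>gauss_op \<phi> s m\<bar> \<le> c * (LINT y|coord_lborel. \<bar>gauss_density s m y\<bar>)"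
    unfolding gauss_op_def
    by (rule abs_integral_mult_le[OF integrable_gauss_density(1)[where s=s, OF assms(1)]])
      (use assms in auto)
  then show ?thesis
    using has_bochner_integral_gauss_density[where s=s and m=m, OF assms(1)] by (simp add: has_bochner_integral_iff)
qed

lemma gauss_op_deriv_bound:
  fixes s :: "'n::finite \<Rightarrow> real"
  assumes "\<And>i. 0 < s i" "\<phi> \<in> borel_measurable borel" "\<And>x. \<bar>\<phi> x\<bar> \<le> c"
  shows "\<bar>gauss_op_deriv i \<phi> s m\<bar> \<le> c * (sqrt (2 / pi) / s i)"
proof -
  have "\<bar>gauss_op_deriv i \<phi> s m\<bar> \<le> c * (LINT y|coord_lborel. \<bar>gauss_density_deriv i s m y\<bar>)"
    unfolding gauss_op_deriv_def
    by (rule abs_integral_mult_le[OF integrable_gauss_density(2)[where s=s, OF assms(1)]])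
      (use assms in auto)
  then show ?thesis
    using has_bochner_integral_gauss_density_deriv[where s=s and i=i and m=m, OF assms(1)] by (simp add: has_bochner_integral_iff)
qed

lemma tendsto_gauss_density:
  fixes s :: "nat \<Rightarrow> 'n::finite \<Rightarrow> real"
  assumes "\<And>i. 0 < s0 i" "\<And>i. (\<lambda>n. s n i) \<longlonglongrightarrow> s0 i" "m \<longlonglongrightarrow> m0"
  shows "(\<lambda>n. gauss_density (s n) (m n) y) \<longlonglongrightarrow> gauss_density s0 m0 y"
    "(\<lambda>n. gauss_density_deriv i (s n) (m n) y) \<longlonglongrightarrow> gauss_density_deriv i s0 m0 y"
proof -
  have nz: "s0 i \<noteq> 0" for i using assms(1)[of i] by simp
  show 1: "(\<lambda>n. gauss_density (s n) (m n) y) \<longlonglongrightarrow> gauss_density s0 m0 y"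
    unfolding gauss_density_def normal_density_def
    by (intro tendsto_intros assms) (use nz in auto)
  show "(\<lambda>n. gauss_density_deriv i (s n) (m n) y) \<longlonglongrightarrow> gauss_density_deriv i s0 m0 y"
    unfolding gauss_density_deriv_def
    by (intro tendsto_intros assms 1) (use nz in auto)
qed

text \<open>Both kernels have explicit L1 norms, 1 and \<open>sqrt (2 / pi) / s i\<close>, which
  converge with \<open>s\<close>; this is the hypothesis on norms in the Scheffe argument, and
  \<open>\<phi>\<close> may remain discontinuous.\<close>

lemma tendsto_gauss_op:
  fixes s :: "nat \<Rightarrow> 'n::finite \<Rightarrow> real"
  assumes s: "\<And>n i. 0 < s n i" "\<And>i. 0 < s0 i"
    and lim: "\<And>i. (\<lambda>n. s n i) \<longlonglongrightarrow> s0 i" "m \<longlonglongrightarrow> m0"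
    and phi: "bounded_borel \<phi>"
  shows "(\<lambda>n. gauss_op \<phi> (s n) (m n)) \<longlonglongrightarrow> gauss_op \<phi> s0 m0"
    "(\<lambda>n. gauss_op_deriv i \<phi> (s n) (m n)) \<longlonglongrightarrow> gauss_op_deriv i \<phi> s0 m0"
proof -
  obtain c where c: "\<And>x. \<bar>\<phi> x\<bar> \<le> c" and [measurable]: "\<phi> \<in> borel_measurable borel"
    using phi by (rule bounded_borelE) blast
  have i1: "(LINT y|coord_lborel. \<bar>gauss_density s m y\<bar>) = 1" if "\<And>i. 0 < s i" for s :: "'n \<Rightarrow> real" and m
    using has_bochner_integral_gauss_density[where s=s and m=m, OF that] by (simp add: has_bochner_integral_iff)
  have i2: "(LINT y|coord_lborel. \<bar>gauss_density_deriv i s m y\<bar>) = sqrt (2 / pi) / s i"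
    if "\<And>i. 0 < s i" for s :: "'n \<Rightarrow> real" and m
    using has_bochner_integral_gauss_density_deriv[where s=s and i=i and m=m, OF that] by (simp add: has_bochner_integral_iff)
  show "(\<lambda>n. gauss_op \<phi> (s n) (m n)) \<longlonglongrightarrow> gauss_op \<phi> s0 m0"
    unfolding gauss_op_def
  proof (rule tendsto_integral_bounded_mult_Scheffe[where c=c])
    show "(\<lambda>n. LINT y|coord_lborel. \<bar>gauss_density (s n) (m n) y\<bar>) \<longlonglongrightarrow>
        (LINT y|coord_lborel. \<bar>gauss_density s0 m0 y\<bar>)"
      by (simp only: i1[where s="s _", OF s(1)] i1[where s=s0, OF s(2)] tendsto_const)
  qed (use s integrable_gauss_density[where s="s _", OF s(1)] integrable_gauss_density[where s=s0, OF s(2)] tendsto_gauss_density[where s=s and ?s0.0=s0, OF s(2) lim] c in auto)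
  show "(\<lambda>n. gauss_op_deriv i \<phi> (s n) (m n)) \<longlonglongrightarrow> gauss_op_deriv i \<phi> s0 m0"
    unfolding gauss_op_deriv_def
  proof (rule tendsto_integral_bounded_mult_Scheffe[where c=c])
    have "(\<lambda>n. sqrt (2 / pi) / s n i) \<longlonglongrightarrow> sqrt (2 / pi) / s0 i"
      by (intro tendsto_intros lim) (use s(2)[of i] in auto)
    then show "(\<lambda>n. LINT y|coord_lborel. \<bar>gauss_density_deriv i (s n) (m n) y\<bar>) \<longlonglongrightarrow>
        (LINT y|coord_lborel. \<bar>gauss_density_deriv i s0 m0 y\<bar>)"
      by (simp only: i2[where s="s _", OF s(1)] i2[where s=s0, OF s(2)])
  qed (use s integrable_gauss_density[where s="s _", OF s(1)] integrable_gauss_density[where s=s0, OF s(2)] tendsto_gauss_density[where s=s and ?s0.0=s0, OF s(2) lim] c in auto)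
qed

section \<open>Differentiating Gaussian kernels in the mean\<close>

lemma normal_density_has_derivative_mean:
  assumes "0 < s"
  shows "((\<lambda>h. normal_density (\<mu> + h) s z) has_real_derivative
    (z - (\<mu> + h)) / s\<^sup>2 * normal_density (\<mu> + h) s z) (at h)"
proof -
  have "((\<lambda>h. - ((z - (\<mu> + h))\<^sup>2) / (2 * s\<^sup>2)) has_real_derivative (z - (\<mu> + h)) / s\<^sup>2) (at h)"
    using assms by (auto intro!: derivative_eq_intros simp: divide_simps)
      (simp add: algebra_simps eval_nat_numeral)
  from DERIV_cmult[OF DERIV_fun_exp[OF this], of "1 / sqrt (2 * pi * s\<^sup>2)"]
  show ?thesis
    unfolding normal_density_def by (simp add: mult_ac)
qed

lemma gauss_density_has_derivative:
  fixes s :: "'n::finite \<Rightarrow> real"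
  assumes "\<And>i. 0 < s i"
  shows "((\<lambda>h. gauss_density s (m + h *\<^sub>R axis i 1) y) has_real_derivative
    gauss_density_deriv i s (m + h *\<^sub>R axis i 1) y) (at h)"
proof -
  have split: "gauss_density s (m + h *\<^sub>R axis i 1) y =
      normal_density (m $ i + h) (s i) (y i) * (\<Prod>j\<in>UNIV - {i}. normal_density (m $ j) (s j) (y j))" for h
  proof -
    have "(\<Prod>j\<in>UNIV - {i}. normal_density ((m + h *\<^sub>R axis i 1) $ j) (s j) (y j)) =
        (\<Prod>j\<in>UNIV - {i}. normal_density (m $ j) (s j) (y j))"
      by (rule prod.cong) (auto simp: axis_def)
    then show ?thesis
      unfolding gauss_density_def by (subst prod.remove[of UNIV i]) (auto simp: axis_def)
  qed
  have "((\<lambda>h. gauss_density s (m + h *\<^sub>R axis i 1) y) has_real_derivative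
      (y i - (m $ i + h)) / (s i)\<^sup>2 * normal_density (m $ i + h) (s i) (y i) *
      (\<Prod>j\<in>UNIV - {i}. normal_density (m $ j) (s j) (y j))) (at h)"
    unfolding split by (intro DERIV_cmult_right normal_density_has_derivative_mean assms)
  then show ?thesis
    unfolding gauss_density_deriv_def split by (simp add: axis_def mult.assoc)
qed

text \<open>All means within distance 1 are dominated by one Gaussian of doubled variance, so the
  derivative kernels get an integrable majorant uniform in the shift.\<close>

lemma normal_density_shift_bound:
  assumes s: "0 < s" and h: "\<bar>h\<bar> \<le> 1"
  shows "normal_density (\<mu> + h) s z \<le> sqrt 2 * exp (1 / (2 * s\<^sup>2)) * normal_density \<mu> (sqrt 2 * s) z"
proof -
  have "0 \<le> (z - \<mu> - 2 * h)\<^sup>2" by simp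
  moreover have "h\<^sup>2 \<le> 1" using h by (simp add: abs_square_le_1)
  \<comment> \<open>Completing the square in this form discards a nonnegative term and costs only
    \<open>2 * h\<^sup>2\<close>, at most 2; this is the source of the factor
    \<open>exp (1 / (2 * s\<^sup>2))\<close>.\<close>
  moreover have "2 * (z - (\<mu> + h))\<^sup>2 = (z - \<mu>)\<^sup>2 + (z - \<mu> - 2 * h)\<^sup>2 - 2 * h\<^sup>2"
    by (simp add: power2_eq_square algebra_simps)
  ultimately have "(z - \<mu>)\<^sup>2 / 2 - 1 \<le> (z - (\<mu> + h))\<^sup>2"
    by linarith
  then have "((z - \<mu>)\<^sup>2 / 2 - 1) / (2 * s\<^sup>2) \<le> (z - (\<mu> + h))\<^sup>2 / (2 * s\<^sup>2)"
    by (intro divide_right_mono) auto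
  then have "- ((z - (\<mu> + h))\<^sup>2) / (2 * s\<^sup>2) \<le> 1 / (2 * s\<^sup>2) + - ((z - \<mu>)\<^sup>2) / (2 * (sqrt 2 * s)\<^sup>2)"
    using s by (simp add: power_mult_distrib diff_divide_distrib)
  then have "exp (- ((z - (\<mu> + h))\<^sup>2) / (2 * s\<^sup>2)) \<le> exp (1 / (2 * s\<^sup>2)) * exp (- ((z - \<mu>)\<^sup>2) / (2 * (sqrt 2 * s)\<^sup>2))"
    by (simp add: exp_add[symmetric])
  then have "1 / sqrt (2 * pi * s\<^sup>2) * exp (- ((z - (\<mu> + h))\<^sup>2) / (2 * s\<^sup>2)) \<le>
      1 / sqrt (2 * pi * s\<^sup>2) * (exp (1 / (2 * s\<^sup>2)) * exp (- ((z - \<mu>)\<^sup>2) / (2 * (sqrt 2 * s)\<^sup>2)))"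
    by (intro mult_left_mono) auto
  moreover have "sqrt (2 * pi * (sqrt 2 * s)\<^sup>2) = sqrt 2 * sqrt (2 * pi * s\<^sup>2)"
    by (simp add: power_mult_distrib real_sqrt_mult)
  ultimately show ?thesis
    by (simp add: normal_density_def)
qed

lemma gauss_op_has_derivative:
  fixes s :: "'n::finite \<Rightarrow> real"
  assumes s: "\<And>i. 0 < s i" and phi: "bounded_borel \<phi>"
  shows "((\<lambda>h. gauss_op \<phi> s (m + h *\<^sub>R axis i 1)) has_real_derivative gauss_op_deriv i \<phi> s m) (at 0)"
proof -
  obtain c where c0: "0 \<le> c" and c: "\<And>x. \<bar>\<phi> x\<bar> \<le> c" and [measurable]: "\<phi> \<in> borel_measurable borel"
    using phi by (rule bounded_borelE) blast
  \<comment> \<open>\<open>?K\<close> is the constant of \<open>normal_density_shift_bound\<close>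
    divided by the variance; in \<open>?f\<close> the summand 1 next to
    \<open>\<bar>z - m $ i\<bar>\<close> absorbs the shift \<open>h\<close>.\<close>
  let ?K = "sqrt 2 * exp (1 / (2 * (s i)\<^sup>2)) / (s i)\<^sup>2"
  let ?f = "\<lambda>j z. if j = i then (\<bar>z - m $ i\<bar> + 1) * (?K * normal_density (m $ i) (sqrt 2 * s i) z)
    else normal_density (m $ j) (s j) z"
  let ?g = "\<lambda>y. c * (\<Prod>j\<in>UNIV. ?f j (y j))"
  have s2: "0 < sqrt 2 * s i" using s[of i] by simp
  have "integrable lborel (\<lambda>z. normal_density (m $ i) (sqrt 2 * s i) z * \<bar>z - m $ i\<bar>)"
    using normal_moment_abs_odd[where \<mu>="m $ i" and \<sigma>="sqrt 2 * s i" and k=0] s2 by (simp add: has_bochner_integral_iff)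
  moreover have "integrable lborel (normal_density (m $ i) (sqrt 2 * s i))"
    using has_bochner_integral_normal_density[OF s2] by (simp add: has_bochner_integral_iff)
  ultimately have "integrable lborel (\<lambda>z. ?K * (normal_density (m $ i) (sqrt 2 * s i) z * \<bar>z - m $ i\<bar>
      + normal_density (m $ i) (sqrt 2 * s i) z))"
    by (intro integrable_mult_right Bochner_Integration.integrable_add)
  then have i1: "integrable lborel (\<lambda>z. (\<bar>z - m $ i\<bar> + 1) * (?K * normal_density (m $ i) (sqrt 2 * s i) z))"
    by (simp add: algebra_simps add_divide_distrib)
  have "integrable lborel (?f j)" for j
    using i1 has_bochner_integral_normal_density[OF s[of j], of "m $ j"]
    by (cases "j = i") (auto simp: has_bochner_integral_iff)
  then have g: "integrable coord_lborel ?g"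
    by (intro integrable_mult_right coord_lborel.product_integrable_prod) auto
  have bound: "\<bar>gauss_density_deriv i s (m + h *\<^sub>R axis i 1) y\<bar> \<le> (\<Prod>j\<in>UNIV. ?f j (y j))" if "\<bar>h\<bar> < 1" for h y
  proof -
    let ?P = "\<Prod>j\<in>UNIV - {i}. normal_density (m $ j) (s j) (y j)"
    have rest: "(\<Prod>j\<in>UNIV - {i}. normal_density ((m + h *\<^sub>R axis i 1) $ j) (s j) (y j)) = ?P"
      by (rule prod.cong) (auto simp: axis_def)
    have "\<bar>gauss_density_deriv i s (m + h *\<^sub>R axis i 1) y\<bar> =
        \<bar>y i - (m $ i + h)\<bar> / (s i)\<^sup>2 * normal_density (m $ i + h) (s i) (y i) * ?P"
      unfolding gauss_density_deriv_def gauss_density_def prod.remove[of UNIV i, OF finite UNIV_I] rest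
      by (simp add: abs_mult axis_def prod_nonneg)
    also have "\<dots> \<le> (\<bar>y i - m $ i\<bar> + 1) / (s i)\<^sup>2 *
        (sqrt 2 * exp (1 / (2 * (s i)\<^sup>2)) * normal_density (m $ i) (sqrt 2 * s i) (y i)) * ?P"
      using normal_density_shift_bound[OF s[of i], of h "m $ i" "y i"] that
      by (intro mult_right_mono mult_mono divide_right_mono prod_nonneg) auto
    also have "\<dots> = (\<Prod>j\<in>UNIV. ?f j (y j))"
      by (subst prod.remove[of UNIV i]) (auto intro!: prod.cong)
    finally show ?thesis .
  qed
  have "((\<lambda>h. LINT y|coord_lborel. \<phi> (vec_lambda y) * gauss_density s (m + h *\<^sub>R axis i 1) y) has_real_derivative
      (LINT y|coord_lborel. \<phi> (vec_lambda y) * gauss_density_deriv i s (m + 0 *\<^sub>R axis i 1) y)) (at 0)"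
  proof (rule has_real_derivative_integral[OF _ _ g])
    show "integrable coord_lborel (\<lambda>y. \<phi> (vec_lambda y) * gauss_density s (m + h *\<^sub>R axis i 1) y)" for h
      by (rule integrable_bounded_mult[OF integrable_gauss_density(1)[where s=s, OF s]]) (use c in auto)
    show "AE y in coord_lborel. \<forall>h. \<bar>h\<bar> < 1 \<longrightarrow>
      ((\<lambda>h. \<phi> (vec_lambda y) * gauss_density s (m + h *\<^sub>R axis i 1) y) has_real_derivative
        \<phi> (vec_lambda y) * gauss_density_deriv i s (m + h *\<^sub>R axis i 1) y) (at h) \<and>
      \<bar>\<phi> (vec_lambda y) * gauss_density_deriv i s (m + h *\<^sub>R axis i 1) y\<bar> \<le> ?g y"
      using bound c c0
      by (intro always_eventually allI impI conjI DERIV_cmult gauss_density_has_derivative s)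
        (auto simp: abs_mult intro!: mult_mono)
  qed measurable
  then show ?thesis by (simp add: gauss_op_def gauss_op_deriv_def)
qed

section \<open>Gaussian kernels as affine images of the standard Gaussian\<close>

abbreviation std_gauss :: "('n \<Rightarrow> real) measure" where
  "std_gauss \<equiv> PiM UNIV (\<lambda>_. density lborel (\<lambda>x. ennreal (std_normal_density x)))"

lemma prob_space_std_gauss: "prob_space std_gauss"
  by (intro prob_space_PiM prob_space_normal_density) simp

lemma sets_std_gauss [measurable_cong, simp]:
  "sets (std_gauss :: ('n \<Rightarrow> real) measure) = sets (PiM UNIV (\<lambda>_. borel))"
  by (rule sets_PiM_cong) auto

text \<open>Values \<open>s i = 0\<close> are included on purpose: a rounded Riemann sum of the
  subordinator can have conditional variance 0, where the law is a point mass and has no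
  density.\<close>

lemma distr_std_gauss_affine:
  fixes m :: "real^'n::finite"
  shows "distr std_gauss (PiM UNIV (\<lambda>_. borel)) (\<lambda>g i. m $ i + s i * g i) =
    PiM UNIV (\<lambda>i. distr (density lborel (\<lambda>x. ennreal (std_normal_density x))) borel (\<lambda>g. m $ i + s i * g))"
proof -
  let ?N = "density lborel (\<lambda>x. ennreal (std_normal_density x))"
  let ?M = "\<lambda>i. distr ?N borel (\<lambda>g. m $ i + s i * g)"
  interpret N: prob_space ?N by (rule prob_space_normal_density) simp
  have "prob_space (?M i)" for i by (rule N.prob_space_distr) simp
  then interpret M: product_prob_space ?M UNIV
    by (intro product_prob_spaceI) auto
  interpret P: product_prob_space "\<lambda>_. ?N" UNIV
    by (intro product_prob_spaceI N.prob_space_axioms)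
  show ?thesis
  proof (rule M.PiM_eqI)
    show "sets (distr std_gauss (PiM UNIV (\<lambda>_. borel)) (\<lambda>g i. m $ i + s i * g i)) = sets (PiM UNIV ?M)"
      by (simp, rule sets_PiM_cong) auto
    fix A assume A: "\<And>i. i \<in> UNIV \<Longrightarrow> A i \<in> sets (?M i)"
    then have A': "A i \<in> sets borel" for i by simp
    have pre: "(\<lambda>g. m $ i + s i * g) -` A i \<in> sets borel" for i
      by (rule measurable_sets_borel[OF _ A']) measurable
    have "Pi\<^sub>E UNIV A \<in> sets (PiM UNIV (\<lambda>_::'n. borel :: real measure))"
      using A' by (intro sets_PiM_I_finite) auto
    then have "emeasure (distr std_gauss (PiM UNIV (\<lambda>_. borel)) (\<lambda>g i. m $ i + s i * g i)) (Pi\<^sub>E UNIV A) =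
      emeasure std_gauss ((\<lambda>g i. m $ i + s i * g i) -` Pi\<^sub>E UNIV A \<inter> space std_gauss)"
      by (rule emeasure_distr[rotated]) measurable
    also have "(\<lambda>g i. m $ i + s i * g i) -` Pi\<^sub>E UNIV A \<inter> space std_gauss =
      Pi\<^sub>E UNIV (\<lambda>i. (\<lambda>g. m $ i + s i * g) -` A i)"
      by (auto simp: space_PiM PiE_def Pi_def)
    also have "emeasure std_gauss \<dots> = (\<Prod>i\<in>UNIV. emeasure ?N ((\<lambda>g. m $ i + s i * g) -` A i))"
      using A' by (intro P.emeasure_PiM) (use pre in auto)
    also have "\<dots> = (\<Prod>i\<in>UNIV. emeasure (?M i) (A i))"
      using A' by (simp add: emeasure_distr)
    finally show "emeasure (distr std_gauss (PiM UNIV (\<lambda>_. borel)) (\<lambda>g i. m $ i + s i * g i)) (Pi\<^sub>E UNIV A) =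
      (\<Prod>i\<in>UNIV. emeasure (?M i) (A i))" .
  qed simp
qed

lemma (in prob_space) distr_normal_eq_distr_std_normal:
  assumes X: "distributed M lborel X (normal_density \<mu> \<sigma>)" and \<sigma>: "0 < \<sigma>"
  shows "distr M borel X = distr (density lborel (\<lambda>x. ennreal (std_normal_density x))) borel (\<lambda>g. \<mu> + \<sigma> * g)"
proof -
  let ?N = "density lborel (\<lambda>x. ennreal (std_normal_density x))"
  interpret N: prob_space ?N by (rule prob_space_normal_density) simp
  have "distributed ?N lborel (\<lambda>x. x) std_normal_density"
    by (auto simp: distributed_def distr_id2)
  from N.normal_density_affine[OF this, of \<sigma> \<mu>] \<sigma>
  have "distr ?N lborel (\<lambda>g. \<mu> + \<sigma> * g) = density lborel (normal_density \<mu> \<sigma>)"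
    by (simp add: distributed_distr_eq_density)
  moreover have "distr M lborel X = density lborel (normal_density \<mu> \<sigma>)"
    by (rule distributed_distr_eq_density[OF X])
  moreover have "distr M lborel X = distr M borel X" "distr ?N lborel (\<lambda>g. \<mu> + \<sigma> * g) = distr ?N borel (\<lambda>g. \<mu> + \<sigma> * g)"
    by (rule distr_cong; simp)+
  ultimately show ?thesis by simp
qed

lemma distr_std_gauss_eq:
  fixes s :: "'n::finite \<Rightarrow> real"
  assumes s: "\<And>i. 0 < s i"
  shows "distr std_gauss (PiM UNIV (\<lambda>_. borel)) (\<lambda>g i. m $ i + s i * g i) =
    density coord_lborel (\<lambda>y. ennreal (gauss_density s m y))"
proof -
  let ?N = "density lborel (\<lambda>x. ennreal (std_normal_density x))"
  let ?M = "\<lambda>i. density lborel (\<lambda>x. ennreal (normal_density (m $ i) (s i) x))"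
  have "prob_space (?M i)" for i by (rule prob_space_normal_density[OF s])
  then interpret M: product_prob_space ?M UNIV
    by (intro product_prob_spaceI) auto
  have "distr ?N borel (\<lambda>g. m $ i + s i * g) = distr (?M i) borel (\<lambda>x. x)" for i
    using prob_space.distr_normal_eq_distr_std_normal[of "?M i" "\<lambda>x. x" "m $ i" "s i"] s[of i]
    by (simp add: M.M.prob_space_axioms distributed_def distr_id2)
  also have "distr (?M i) borel (\<lambda>x. x) = ?M i" for i
    by (rule distr_id2) simp
  finally have "distr std_gauss (PiM UNIV (\<lambda>_. borel)) (\<lambda>g i. m $ i + s i * g i) = PiM UNIV ?M"
    unfolding distr_std_gauss_affine by simp
  also have "\<dots> = density coord_lborel (\<lambda>y. ennreal (gauss_density s m y))"
  proof (rule M.PiM_eqI[symmetric])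
    show "sets (density coord_lborel (\<lambda>y. ennreal (gauss_density s m y))) = sets (PiM UNIV ?M)"
      by (simp, rule sets_PiM_cong) auto
    fix A assume A: "\<And>i. i \<in> UNIV \<Longrightarrow> A i \<in> sets (?M i)"
    then have A': "A i \<in> sets borel" for i by simp
    have "Pi\<^sub>E UNIV A \<in> sets (PiM UNIV (\<lambda>_::'n. borel :: real measure))"
      using A' by (intro sets_PiM_I_finite) auto
    then have "emeasure (density coord_lborel (\<lambda>y. ennreal (gauss_density s m y))) (Pi\<^sub>E UNIV A) =
       (\<integral>\<^sup>+y. ennreal (gauss_density s m y) * indicator (Pi\<^sub>E UNIV A) y \<partial>coord_lborel)"
      by (subst emeasure_density) auto
    also have "\<dots> = (\<integral>\<^sup>+y. (\<Prod>i\<in>UNIV. ennreal (normal_density (m $ i) (s i) (y i)) * indicator (A i) (y i)) \<partial>coord_lborel)"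
    proof (intro nn_integral_cong)
      fix y :: "'n \<Rightarrow> real"
      have "(indicator (Pi\<^sub>E UNIV A) y :: ennreal) = (\<Prod>i\<in>UNIV. indicator (A i) (y i))"
        by (auto simp: indicator_def PiE_def Pi_def intro!: prod_zero[symmetric])
      then show "ennreal (gauss_density s m y) * indicator (Pi\<^sub>E UNIV A) y =
         (\<Prod>i\<in>UNIV. ennreal (normal_density (m $ i) (s i) (y i)) * indicator (A i) (y i))"
        by (simp add: gauss_density_def prod.distrib prod_ennreal)
    qed
    also have "\<dots> = (\<Prod>i\<in>UNIV. \<integral>\<^sup>+z. ennreal (normal_density (m $ i) (s i) z) * indicator (A i) z \<partial>lborel)"
      using A' by (intro coord_lborel.product_nn_integral_prod) auto
    also have "\<dots> = (\<Prod>i\<in>UNIV. emeasure (?M i) (A i))"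
      using A' by (simp add: emeasure_density)
    finally show "emeasure (density coord_lborel (\<lambda>y. ennreal (gauss_density s m y))) (Pi\<^sub>E UNIV A) =
      (\<Prod>i\<in>UNIV. emeasure (?M i) (A i))" .
  qed simp
  finally show ?thesis .
qed

text \<open>Link between two forms of the same kernel: the density form can be differentiated in the
  mean for Borel \<open>\<phi>\<close>, while the standard Gaussian form passes to the limit in the
  variances even where they vanish.\<close>

lemma gauss_op_eq_std_gauss:
  fixes s :: "'n::finite \<Rightarrow> real"
  assumes s: "\<And>i. 0 < s i" and [measurable]: "\<phi> \<in> borel_measurable borel"
  shows "gauss_op \<phi> s m = (LINT g|std_gauss. \<phi> (\<chi> i. m $ i + s i * g i))"
proof -
  have "(LINT g|std_gauss. \<phi> (\<chi> i. m $ i + s i * g i)) =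
    (LINT y|distr std_gauss (PiM UNIV (\<lambda>_. borel)) (\<lambda>g i. m $ i + s i * g i). \<phi> (vec_lambda y))"
    by (subst integral_distr; (rule refl | measurable))
  also have "\<dots> = gauss_op \<phi> s m"
    unfolding distr_std_gauss_eq[where s=s, OF s] gauss_op_def
    by (subst integral_density) (auto simp: mult.commute)
  finally show ?thesis by simp
qed

section \<open>Riemann sums of exponentially weighted paths\<close>

text \<open>The Stieltjes integral of \<open>exp (- l * (t - r))\<close> against \<open>p\<close>
  over \<open>(s, t]\<close>, integrated by parts. In this form it makes sense for paths of
  unbounded variation such as those of the subordinated Brownian motion.\<close>

definition exp_conv :: "real \<Rightarrow> real \<Rightarrow> real \<Rightarrow> (real \<Rightarrow> real) \<Rightarrow> real" where
  "exp_conv l s t p = p t - exp (- l * (t - s)) * p s - l * (LINT r:{s<..<t}|lborel. exp (- l * (t - r)) * p r)"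

text \<open>Rounding has countable range, which restores measurability, and goes upwards, so that
  right-continuous paths converge along it. \<open>nat\<close> sends negative arguments to 0; the
  mesh is \<open>1 / (n + 1)\<close> to admit \<open>n = 0\<close>.\<close>

definition round_up :: "nat \<Rightarrow> real \<Rightarrow> real" where
  "round_up n x = real (nat \<lceil>real (Suc n) * x\<rceil>) / real (Suc n)"

lemma round_up_bounds:
  assumes "0 \<le> x"
  shows "x \<le> round_up n x" "round_up n x \<le> x + 1 / real (Suc n)"
proof -
  have "0 \<le> real (Suc n) * x" using assms by simp
  then have *: "real (nat \<lceil>real (Suc n) * x\<rceil>) = of_int \<lceil>real (Suc n) * x\<rceil>"
    by (simp add: ceiling_mono order.trans[of 0 "\<lceil>0::real\<rceil>"])
  have "real (Suc n) * x \<le> of_int \<lceil>real (Suc n) * x\<rceil>"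
    by (rule le_of_int_ceiling)
  then show "x \<le> round_up n x"
    unfolding round_up_def * by (subst pos_le_divide_eq) (auto simp: mult.commute)
  have "of_int \<lceil>real (Suc n) * x\<rceil> \<le> real (Suc n) * x + 1"
    by (rule of_int_ceiling_le_add_one)
  then have "round_up n x \<le> (real (Suc n) * x + 1) / real (Suc n)"
    unfolding round_up_def * by (intro divide_right_mono) auto
  then show "round_up n x \<le> x + 1 / real (Suc n)"
    by (simp add: add_divide_distrib)
qed

lemma round_up_nonneg [simp]: "0 \<le> round_up n x"
  unfolding round_up_def by simp

lemma round_up_mono: "x \<le> y \<Longrightarrow> round_up n x \<le> round_up n y"
  unfolding round_up_def
  by (intro divide_right_mono of_nat_mono nat_mono ceiling_mono mult_left_mono) (auto simp del: of_nat_Suc)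

lemma round_up_0 [simp]: "round_up n 0 = 0"
  unfolding round_up_def by simp

lemma round_up_1 [simp]: "round_up n 1 = 1"
  unfolding round_up_def by (simp del: of_nat_Suc)

lemma tendsto_round_up:
  assumes "x \<longlonglongrightarrow> l" "\<And>n. 0 \<le> x n"
  shows "(\<lambda>n. round_up n (x n)) \<longlonglongrightarrow> l"
proof (rule tendsto_sandwich[OF _ _ assms(1)])
  show "(\<lambda>n. x n + 1 / real (Suc n)) \<longlonglongrightarrow> l"
    using tendsto_add[OF assms(1) LIMSEQ_Suc[OF lim_1_over_n]] by simp
qed (use round_up_bounds[OF assms(2)] in \<open>auto intro!: always_eventually\<close>)

lemma round_up_eq:
  assumes "real k / real (Suc n) < x" "x \<le> real (Suc k) / real (Suc n)"
  shows "round_up n x = real (Suc k) / real (Suc n)"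
proof -
  have "real k < real (Suc n) * x" "real (Suc n) * x \<le> real (Suc k)"
    using assms by (auto simp: field_simps)
  then have "\<lceil>real (Suc n) * x\<rceil> = int (Suc k)"
    by (intro ceiling_unique) auto
  then show ?thesis unfolding round_up_def by simp
qed

lemma measurable_round_up [measurable]: "round_up n \<in> borel_measurable borel"
  unfolding round_up_def by measurable

definition grid :: "real \<Rightarrow> real \<Rightarrow> nat \<Rightarrow> nat \<Rightarrow> real" where
  "grid s t n k = s + (t - s) * (real k / real (Suc n))"

text \<open>Weights sit at left end points. Squaring a weight doubles \<open>l\<close>, so the sum
  with rate \<open>2 * l\<close>, taken of a clock, is the variance of the sum with rate
  \<open>l\<close> of Brownian motion read at that clock.\<close>

definition riemann_conv :: "real \<Rightarrow> real \<Rightarrow> real \<Rightarrow> nat \<Rightarrow> (real \<Rightarrow> real) \<Rightarrow> real" where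
  "riemann_conv l s t n q =
     (\<Sum>k<Suc n. exp (- l * (t - grid s t n k)) * (q (grid s t n (Suc k)) - q (grid s t n k)))"

lemma grid_bounds:
  assumes "s \<le> t" "k \<le> Suc n"
  shows "s \<le> grid s t n k" "grid s t n k \<le> t"
proof -
  have "real k / real (Suc n) \<le> 1" using assms by (simp add: field_simps)
  then have "(t - s) * (real k / real (Suc n)) \<le> (t - s) * 1"
    using assms by (intro mult_left_mono) auto
  then show "grid s t n k \<le> t" unfolding grid_def by simp
  show "s \<le> grid s t n k" unfolding grid_def using assms by simp
qed

lemma grid_mono: "s \<le> t \<Longrightarrow> k \<le> k' \<Longrightarrow> grid s t n k \<le> grid s t n k'"
  unfolding grid_def by (intro add_left_mono mult_left_mono divide_right_mono) auto

lemma grid_0 [simp]: "grid s t n 0 = s" and grid_Suc [simp]: "grid s t n (Suc n) = t"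
  unfolding grid_def by (simp_all del: of_nat_Suc)

lemma has_integral_exp_decay:
  fixes l t :: real
  assumes "a \<le> b"
  shows "set_integrable lborel {a<..<b} (\<lambda>r. l * exp (- l * (t - r)))"
    "(LINT r:{a<..<b}|lborel. l * exp (- l * (t - r))) = exp (- l * (t - b)) - exp (- l * (t - a))"
proof -
  have D: "((\<lambda>r. exp (- l * (t - r))) has_vector_derivative l * exp (- l * (t - r))) (at r within X)" for r X
    unfolding has_real_derivative_iff_has_vector_derivative[symmetric]
    by (auto intro!: derivative_eq_intros)
  have c: "continuous_on {a..b} (\<lambda>r. l * exp (- l * (t - r)))"
    by (intro continuous_intros)
  from has_bochner_integral_FTC_Icc[OF assms D c]
  have 1: "has_bochner_integral lborel (\<lambda>r. indicator {a..b} r *\<^sub>R (l * exp (- l * (t - r))))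
    (exp (- l * (t - b)) - exp (- l * (t - a)))" .
  have 2: "has_bochner_integral lborel (\<lambda>r. indicator {a..b} r *\<^sub>R (l * exp (- l * (t - r)))) x \<longleftrightarrow>
     has_bochner_integral lborel (\<lambda>r. indicator {a<..<b} r *\<^sub>R (l * exp (- l * (t - r)))) x" for x
    by (rule has_bochner_integral_discrete_difference[of "{a, b}"]) (auto simp: indicator_def)
  from 1[unfolded 2] show "set_integrable lborel {a<..<b} (\<lambda>r. l * exp (- l * (t - r)))"
    "(LINT r:{a<..<b}|lborel. l * exp (- l * (t - r))) = exp (- l * (t - b)) - exp (- l * (t - a))"
    unfolding set_integrable_def set_lebesgue_integral_def by (auto simp: has_bochner_integral_iff)
qed

text \<open>Right end point of the grid cell containing \<open>r\<close>: it approaches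
  \<open>r\<close> from the right, the side on which cadlag paths are continuous.\<close>

definition grid_up :: "real \<Rightarrow> real \<Rightarrow> nat \<Rightarrow> real \<Rightarrow> real" where
  "grid_up s t n r = s + (t - s) * round_up n ((r - s) / (t - s))"

lemma grid_up_eq:
  assumes "s < t" "grid s t n k < r" "r \<le> grid s t n (Suc k)"
  shows "grid_up s t n r = grid s t n (Suc k)"
proof -
  have "real k / real (Suc n) < (r - s) / (t - s)" "(r - s) / (t - s) \<le> real (Suc k) / real (Suc n)"
    using assms unfolding grid_def by (auto simp: pos_less_divide_eq pos_divide_le_eq mult.commute)
  from round_up_eq[OF this] show ?thesis
    unfolding grid_up_def grid_def by simp
qed

lemma grid_up_bounds:
  assumes "s < t" "s \<le> r" "r \<le> t"
  shows "r \<le> grid_up s t n r" "grid_up s t n r \<le> t"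
proof -
  have "(r - s) / (t - s) \<le> round_up n ((r - s) / (t - s))"
    by (rule round_up_bounds) (use assms in auto)
  then have "(t - s) * ((r - s) / (t - s)) \<le> (t - s) * round_up n ((r - s) / (t - s))"
    using assms by (intro mult_left_mono) auto
  then show "r \<le> grid_up s t n r"
    unfolding grid_up_def using assms by simp
  have "round_up n ((r - s) / (t - s)) \<le> round_up n 1"
    by (rule round_up_mono) (use assms in auto)
  then have "(t - s) * round_up n ((r - s) / (t - s)) \<le> (t - s) * 1"
    using assms by (intro mult_left_mono) auto
  then show "grid_up s t n r \<le> t" unfolding grid_up_def by simp
qed

lemma tendsto_grid_up:
  assumes "s < t" "s \<le> r"
  shows "(\<lambda>n. grid_up s t n r) \<longlonglongrightarrow> r"
proof -
  have "(\<lambda>n. grid_up s t n r) \<longlonglongrightarrow> s + (t - s) * ((r - s) / (t - s))"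
    unfolding grid_up_def by (intro tendsto_intros tendsto_round_up) (use assms in auto)
  then show ?thesis using assms by simp
qed

text \<open>\<open>q\<close> is an arbitrary function here: \<open>grid_up\<close> depends on
  \<open>r\<close> through an integer, so the composition is a countable case distinction.\<close>

lemma measurable_grid_up: "(\<lambda>r. q (grid_up s t n r)) \<in> borel_measurable borel"
proof -
  have "(\<lambda>r. (\<lambda>k::nat. \<lambda>_::real. q (s + (t - s) * (real k / real (Suc n)))) (nat \<lceil>real (Suc n) * ((r - s) / (t - s))\<rceil>) r)
    \<in> borel_measurable borel"
    by (rule measurable_compose_countable) measurable
  then show ?thesis
    unfolding grid_up_def round_up_def by simp
qed

lemma right_continuous_tendsto_grid_up:
  fixes p :: "real \<Rightarrow> 'a::topological_space"
  assumes "(p \<longlongrightarrow> p r) (at r within {r<..})" "s < t" "s \<le> r" "r < t"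
  shows "(\<lambda>n. p (grid_up s t n r)) \<longlonglongrightarrow> p r"
proof -
  have "(p \<longlongrightarrow> p r) (at r within {r..})"
    using assms(1) by (simp add: at_within_Ici_at_right)
  then have "continuous (at r within {r..}) p"
    by (simp add: continuous_within)
  then show ?thesis
    by (rule continuous_within_tendsto_compose')
      (use assms grid_up_bounds[of s t r] tendsto_grid_up[of s t r] in auto)
qed

text \<open>Abel summation turns the Riemann sum into the integral of a step function.\<close>

lemma riemann_conv_eq:
  assumes "s < t"
  shows "set_integrable lborel {s<..<t} (\<lambda>r. l * exp (- l * (t - r)) * q (grid_up s t n r))"
    "riemann_conv l s t n q = q t - exp (- l * (t - s)) * q s
       - (LINT r:{s<..<t}|lborel. l * exp (- l * (t - r)) * q (grid_up s t n r))"
proof -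
  let ?g = "grid s t n"
  let ?w = "\<lambda>k. exp (- l * (t - ?g k))"
  have mono: "?g k \<le> ?g (Suc k)" for k
    by (rule grid_mono) (use assms in auto)
  have step: "has_bochner_integral lborel (\<lambda>r. indicator {s<..<?g j} r *\<^sub>R (l * exp (- l * (t - r)) * q (grid_up s t n r)))
      (\<Sum>k<j. (?w (Suc k) - ?w k) * q (?g (Suc k)))" for j
  proof (induction j)
    case (Suc j)
    have "has_bochner_integral lborel (\<lambda>r. indicator {?g j<..<?g (Suc j)} r *\<^sub>R (l * exp (- l * (t - r)))) (?w (Suc j) - ?w j)"
      using has_integral_exp_decay[where a="?g j" and b="?g (Suc j)" and l=l and t=t, OF mono]
      unfolding set_integrable_def set_lebesgue_integral_def by (simp add: has_bochner_integral_iff)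
    from has_bochner_integral_mult_left[OF this, of "q (?g (Suc j))"]
    have "has_bochner_integral lborel (\<lambda>r. indicator {?g j<..<?g (Suc j)} r *\<^sub>R (l * exp (- l * (t - r)) * q (?g (Suc j))))
      ((?w (Suc j) - ?w j) * q (?g (Suc j)))" by (simp add: mult.assoc)
    from has_bochner_integral_add[OF Suc.IH this]
    have "has_bochner_integral lborel (\<lambda>r. indicator {s<..<?g j} r *\<^sub>R (l * exp (- l * (t - r)) * q (grid_up s t n r)) +
       indicator {?g j<..<?g (Suc j)} r *\<^sub>R (l * exp (- l * (t - r)) * q (?g (Suc j))))
       (\<Sum>k<Suc j. (?w (Suc k) - ?w k) * q (?g (Suc k)))" by simp
    also have "?this \<longleftrightarrow> has_bochner_integral lborel (\<lambda>r. indicator {s<..<?g (Suc j)} r *\<^sub>R (l * exp (- l * (t - r)) * q (grid_up s t n r)))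
       (\<Sum>k<Suc j. (?w (Suc k) - ?w k) * q (?g (Suc k)))"
    \<comment> \<open>Adjacent open cells miss only the node \<open>?g j\<close>, a null set;
      elsewhere \<open>grid_up\<close> is constant on the cell.\<close>
    proof (rule has_bochner_integral_discrete_difference[of "{?g j}"])
      fix r assume "r \<notin> {?g j}"
      moreover have "s \<le> ?g j" using grid_mono[of s t 0 j n] assms by simp
      ultimately show "indicator {s<..<?g j} r *\<^sub>R (l * exp (- l * (t - r)) * q (grid_up s t n r)) +
         indicator {?g j<..<?g (Suc j)} r *\<^sub>R (l * exp (- l * (t - r)) * q (?g (Suc j))) =
         indicator {s<..<?g (Suc j)} r *\<^sub>R (l * exp (- l * (t - r)) * q (grid_up s t n r))"
        using mono[of j] grid_up_eq[OF assms, of n j r] by (auto simp: indicator_def)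
    qed auto
    finally show ?case .
  qed (simp add: has_bochner_integral_zero)
  have 1: "has_bochner_integral lborel (\<lambda>r. indicator {s<..<t} r *\<^sub>R (l * exp (- l * (t - r)) * q (grid_up s t n r)))
      (\<Sum>k<Suc n. (?w (Suc k) - ?w k) * q (?g (Suc k)))"
    using step[of "Suc n"] by (simp only: grid_Suc)
  then show "set_integrable lborel {s<..<t} (\<lambda>r. l * exp (- l * (t - r)) * q (grid_up s t n r))"
    unfolding set_integrable_def by (rule integrable.intros)
  have "(\<Sum>k<Suc n. ?w (Suc k) * q (?g (Suc k)) - ?w k * q (?g k)) = ?w (Suc n) * q (?g (Suc n)) - ?w 0 * q (?g 0)"
    by (rule sum_lessThan_telescope)
  moreover have "riemann_conv l s t n q = (\<Sum>k<Suc n. ?w (Suc k) * q (?g (Suc k)) - ?w k * q (?g k)) -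
     (\<Sum>k<Suc n. (?w (Suc k) - ?w k) * q (?g (Suc k)))"
    unfolding riemann_conv_def sum_subtractf[symmetric] by (intro sum.cong) (auto simp: algebra_simps)
  ultimately show "riemann_conv l s t n q = q t - exp (- l * (t - s)) * q s
       - (LINT r:{s<..<t}|lborel. l * exp (- l * (t - r)) * q (grid_up s t n r))"
    using 1 unfolding set_lebesgue_integral_def by (simp add: has_bochner_integral_iff del: sum.lessThan_Suc)
qed

text \<open>The path \<open>q n\<close> may change together with the mesh, because rounding and
  refinement share the index \<open>n\<close>. Measurability and integrability of the limit path
  come out of dominated convergence.\<close>

lemma riemann_conv_tendsto:
  assumes st: "s < t"
    and bound: "\<And>n r. s \<le> r \<Longrightarrow> r \<le> t \<Longrightarrow> \<bar>q n r\<bar> \<le> c"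
    and lim: "(\<lambda>n. q n t) \<longlonglongrightarrow> p t" "(\<lambda>n. q n s) \<longlonglongrightarrow> p s"
      "\<And>r. s < r \<Longrightarrow> r < t \<Longrightarrow> (\<lambda>n. q n (grid_up s t n r)) \<longlonglongrightarrow> p r"
  shows "(\<lambda>n. riemann_conv l s t n (q n)) \<longlonglongrightarrow> exp_conv l s t p"
    and "set_integrable lborel {s<..<t} (\<lambda>r. l * exp (- l * (t - r)) * p r)"
proof -
  let ?f = "\<lambda>n r. indicator {s<..<t} r *\<^sub>R (l * exp (- l * (t - r)) * q n (grid_up s t n r))"
  let ?h = "\<lambda>r. indicator {s<..<t} r *\<^sub>R (l * exp (- l * (t - r)) * p r)"
  have c0: "0 \<le> c" using bound[of s 0] st by auto
  have lim': "(\<lambda>n. ?f n r) \<longlonglongrightarrow> ?h r" for r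
    by (cases "s < r \<and> r < t") (auto simp: indicator_def intro!: tendsto_intros lim)
  have meas: "?f n \<in> borel_measurable lborel" for n
    using measurable_grid_up[of "q n" s t n] by measurable
  have meas': "?h \<in> borel_measurable lborel"
    by (rule borel_measurable_LIMSEQ_real[OF lim' meas])
  have int: "integrable lborel (\<lambda>r. indicator {s<..<t} r *\<^sub>R (c * (l * exp (- l * (t - r)))))"
    using set_integrable_mult_right[of c lborel "{s<..<t}", OF has_integral_exp_decay(1)[of s t l t]] st
    by (auto simp: set_integrable_def)
  have dom: "AE r in lborel. norm (?f n r) \<le> norm (indicator {s<..<t} r *\<^sub>R (c * (l * exp (- l * (t - r)))))" for n
  proof (intro always_eventually allI)
    fix r
    have "\<bar>l\<bar> * exp (- l * (t - r)) * \<bar>q n (grid_up s t n r)\<bar> \<le> \<bar>l\<bar> * exp (- l * (t - r)) * c" if "s < r" "r < t"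
      using that grid_up_bounds[of s t r n] st by (intro mult_left_mono bound) auto
    then show "norm (?f n r) \<le> norm (indicator {s<..<t} r *\<^sub>R (c * (l * exp (- l * (t - r)))))"
      using c0 by (auto simp: indicator_def abs_mult mult_ac)
  qed
  have "(\<lambda>n. integral\<^sup>L lborel (?f n)) \<longlonglongrightarrow> integral\<^sup>L lborel ?h"
    by (rule integral_dominated_convergence[where s="?f" and f="?h", OF meas' meas integrable_norm[OF int] _ dom])
      (use lim' in auto)
  then have "(\<lambda>n. q n t - exp (- l * (t - s)) * q n s - integral\<^sup>L lborel (?f n)) \<longlonglongrightarrow>
     p t - exp (- l * (t - s)) * p s - integral\<^sup>L lborel ?h"
    by (intro tendsto_intros lim)
  moreover have "integral\<^sup>L lborel ?h = l * (LINT r:{s<..<t}|lborel. exp (- l * (t - r)) * p r)"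
    unfolding set_lebesgue_integral_def integral_mult_right_zero[symmetric] by (simp add: mult_ac)
  ultimately show "(\<lambda>n. riemann_conv l s t n (q n)) \<longlonglongrightarrow> exp_conv l s t p"
    unfolding riemann_conv_eq(2)[OF st] exp_conv_def set_lebesgue_integral_def by simp
  show "set_integrable lborel {s<..<t} (\<lambda>r. l * exp (- l * (t - r)) * p r)"
    unfolding set_integrable_def
    by (rule integrable_dominated_convergence[where s="?f" and f="?h", OF meas' meas integrable_norm[OF int] _ dom])
      (use lim' in auto)
qed

section \<open>Variation of constants\<close>

lemma set_integrable_bounded_mult:
  fixes p f :: "real \<Rightarrow> real"
  assumes p: "set_integrable lborel S p" and f: "f \<in> borel_measurable borel"
    and bound: "\<And>r. r \<in> S \<Longrightarrow> \<bar>f r\<bar> \<le> c"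
  shows "set_integrable lborel S (\<lambda>r. f r * p r)"
  unfolding set_integrable_def
proof (rule Bochner_Integration.integrable_bound)
  show "integrable lborel (\<lambda>r. c * (indicator S r *\<^sub>R p r))"
    using p unfolding set_integrable_def by (rule integrable_mult_right)
  have "(\<lambda>r. f r * (indicator S r *\<^sub>R p r)) \<in> borel_measurable lborel"
    using p f unfolding set_integrable_def by (intro borel_measurable_times) auto
  then show "(\<lambda>r. indicator S r *\<^sub>R (f r * p r)) \<in> borel_measurable lborel"
    by (simp add: mult.left_commute)
  show "AE r in lborel. norm (indicator S r *\<^sub>R (f r * p r)) \<le> norm (c * (indicator S r *\<^sub>R p r))"
  proof (intro always_eventually allI)
    fix r
    show "norm (indicator S r *\<^sub>R (f r * p r)) \<le> norm (c * (indicator S r *\<^sub>R p r))"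
    proof (cases "r \<in> S")
      case True
      have "\<bar>f r\<bar> * \<bar>p r\<bar> \<le> \<bar>c\<bar> * \<bar>p r\<bar>"
        by (rule mult_right_mono) (use bound[OF True] in auto)
      then show ?thesis using True by (simp add: abs_mult)
    qed simp
  qed
qed

lemma exp_decay_bound:
  fixes l t r :: real
  assumes "a \<le> r" "r \<le> b" "a \<le> t" "t \<le> b"
  shows "exp (- l * (t - r)) \<le> exp (\<bar>l\<bar> * (b - a))"
proof -
  have "\<bar>t - r\<bar> \<le> b - a" using assms by auto
  then have "\<bar>l\<bar> * \<bar>t - r\<bar> \<le> \<bar>l\<bar> * (b - a)" by (rule mult_left_mono) simp
  moreover have "- l * (t - r) \<le> \<bar>l\<bar> * \<bar>t - r\<bar>" by (metis abs_ge_self abs_minus_cancel abs_mult)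
  ultimately show ?thesis by simp
qed

lemma set_integrable_exp_mult:
  fixes p :: "real \<Rightarrow> real"
  assumes p: "set_integrable lborel {a..b} p" and ab: "a \<le> s" "t \<le> b"
  shows "set_integrable lborel {s<..<t} (\<lambda>r. exp (- l * (t - r)) * p r)"
proof (rule set_integrable_bounded_mult)
  show "set_integrable lborel {s<..<t} p"
    by (rule set_integrable_subset[OF p]) (use ab in auto)
  show "\<bar>exp (- l * (t - r))\<bar> \<le> exp (\<bar>l\<bar> * (t - s))" if "r \<in> {s<..<t}" for r
    using exp_decay_bound[of s r t t l] that by auto
qed measurable

lemma set_integral_Icc_eq_Ioo:
  fixes p :: "real \<Rightarrow> real"
  shows "(LINT r:{a..b}|lborel. p r) = (LINT r:{a<..<b}|lborel. p r)"
  unfolding set_lebesgue_integral_def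
  by (rule integral_discrete_difference[of "{a, b}"]) (auto simp: indicator_def)

text \<open>Variation of constants for paths that are merely integrable: the double integral
  of the weight against \<open>z\<close> is exchanged by Fubini instead of differentiating.\<close>

lemma linear_integral_equation_solution:
  fixes z g :: "real \<Rightarrow> real"
  assumes z: "set_integrable lborel {s..t} z"
    and eq: "\<And>r. s \<le> r \<Longrightarrow> r \<le> t \<Longrightarrow> z r = g r - l * (LINT q:{s..r}|lborel. z q)"
    and st: "s \<le> t"
  shows "set_integrable lborel {s<..<t} (\<lambda>r. l * exp (- l * (t - r)) * g r)"
    "z t = g t - (LINT r:{s<..<t}|lborel. l * exp (- l * (t - r)) * g r)"
proof -
  define I where "I r = (LINT q:{s<..<r}|lborel. z q)" for r
  let ?w = "\<lambda>r. l * exp (- l * (t - r))"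
  \<comment> \<open>Integrand over the triangle \<open>s < q < r < t\<close>: integrating in
    \<open>q\<close> first gives the weight against \<open>I\<close>, in \<open>r\<close> first
    gives \<open>1 - exp (- l * (t - q))\<close> against \<open>z\<close>.\<close>
  define f where "f r q = indicator {s<..<t} r * ?w r * (indicator {s<..<r} q * z q)" for r q
  have zi: "set_integrable lborel {s<..<t} z"
    by (rule set_integrable_subset[OF z]) auto
  then have zi': "integrable lborel (\<lambda>q. indicator {s<..<t} q * z q)"
    by (simp add: set_integrable_def)
  have wi: "integrable lborel (\<lambda>r. indicator {s<..<t} r * ?w r)"
    using has_integral_exp_decay(1)[OF st, of l t] by (simp add: set_integrable_def)
  have f_eq: "f r q = indicator {(r, q). q < r} (r, q) * ((indicator {s<..<t} r * ?w r) * (indicator {s<..<t} q * z q))" for r q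
    by (auto simp: f_def indicator_def)
  have prod_int: "integrable (lborel \<Otimes>\<^sub>M lborel) (\<lambda>(r, q). (indicator {s<..<t} r * ?w r) * (indicator {s<..<t} q * z q))"
  proof (rule lborel_pair.Fubini_integrable)
    show "(\<lambda>(r, q). (indicator {s<..<t} r * ?w r) * (indicator {s<..<t} q * z q)) \<in> borel_measurable (lborel \<Otimes>\<^sub>M lborel)"
      using borel_measurable_integrable[OF wi] borel_measurable_integrable[OF zi'] by measurable
    have "integrable lborel (\<lambda>r. \<bar>indicator {s<..<t} r * ?w r\<bar> * (LINT q|lborel. \<bar>indicator {s<..<t} q * z q\<bar>))"
      by (intro integrable_mult_left integrable_abs wi)
    then show "integrable lborel (\<lambda>x. LINT y|lborel. norm (case (x, y) of (r, q) \<Rightarrow>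
        indicator {s<..<t} r * ?w r * (indicator {s<..<t} q * z q)))"
      by (simp only: prod.case real_norm_def abs_mult[of "indicator {s<..<t} _ * ?w _" "indicator {s<..<t} _ * z _"]
        integral_mult_right_zero)
    show "AE x in lborel. integrable lborel (\<lambda>y. case (x, y) of (r, q) \<Rightarrow>
        indicator {s<..<t} r * ?w r * (indicator {s<..<t} q * z q))"
      using zi' by (intro always_eventually allI) (simp only: prod.case, rule integrable_mult_right)
  qed
  have f_int: "integrable (lborel \<Otimes>\<^sub>M lborel) (case_prod f)"
  proof -
    have "{(r, q). q < r} \<in> sets (lborel \<Otimes>\<^sub>M (lborel :: real measure))"
    proof -
      have "{(r, q). q < r} = {x \<in> space (lborel \<Otimes>\<^sub>M (lborel :: real measure)). snd x < fst x}"
        by (auto simp: space_pair_measure)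
      also have "\<dots> \<in> sets (lborel \<Otimes>\<^sub>M lborel)" by measurable
      finally show ?thesis .
    qed
    from integrable_mult_indicator[OF this prod_int] show ?thesis
      by (simp add: f_eq[abs_def] case_prod_unfold)
  qed
  have inner_q: "(LINT q|lborel. f r q) = indicator {s<..<t} r * ?w r * I r" for r
    by (simp add: f_def I_def set_lebesgue_integral_def)
  have inner_r: "(LINT r|lborel. f r q) = indicator {s<..<t} q * ((1 - exp (- l * (t - q))) * z q)" for q
  proof (cases "s < q \<and> q < t")
    case True
    have "(LINT r|lborel. f r q) = (LINT r|lborel. (indicator {q<..<t} r * ?w r) * z q)"
      using True by (intro Bochner_Integration.integral_cong) (auto simp: f_def indicator_def)
    also have "\<dots> = (LINT r|lborel. indicator {q<..<t} r * ?w r) * z q"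
      by simp
    also have "\<dots> = (1 - exp (- l * (t - q))) * z q"
      using has_integral_exp_decay(2)[of q t l t, unfolded set_lebesgue_integral_def real_scaleR_def] True by simp
    finally show ?thesis using True by simp
  next
    case False
    then have "f r q = 0" for r by (auto simp: f_def indicator_def)
    with False show ?thesis by (auto simp: indicator_def)
  qed
  have wI: "set_integrable lborel {s<..<t} (\<lambda>r. ?w r * I r)"
    using lborel_pair.integrable_fst[OF f_int] by (simp add: inner_q set_integrable_def mult.assoc)
  have ez: "set_integrable lborel {s<..<t} (\<lambda>r. exp (- l * (t - r)) * z r)"
    by (rule set_integrable_exp_mult[OF z]) auto
  have fub: "(LINT r:{s<..<t}|lborel. ?w r * I r) = I t - (LINT r:{s<..<t}|lborel. exp (- l * (t - r)) * z r)"
  proof -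
    have "(LINT r:{s<..<t}|lborel. ?w r * I r) = (LINT r|lborel. LINT q|lborel. f r q)"
      by (simp only: inner_q set_lebesgue_integral_def mult.assoc real_scaleR_def)
    also have "\<dots> = (LINT q|lborel. LINT r|lborel. f r q)"
      by (rule lborel_pair.Fubini_integral[OF f_int, symmetric])
    also have "\<dots> = (LINT q:{s<..<t}|lborel. z q - exp (- l * (t - q)) * z q)"
      by (simp add: inner_r set_lebesgue_integral_def algebra_simps)
    also have "\<dots> = I t - (LINT r:{s<..<t}|lborel. exp (- l * (t - r)) * z r)"
      unfolding I_def by (rule set_integral_diff[OF zi ez])
    finally show ?thesis .
  qed
  \<comment> \<open>The equation is read backwards, expressing the forcing \<open>g\<close> through
    the solution; the integrals of the exponential against \<open>z\<close> then cancel and only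
    \<open>l * I t\<close> is left.\<close>
  have g_eq: "g r = z r + l * I r" if "s < r" "r < t" for r
    using eq[of r] that by (simp add: I_def set_integral_Icc_eq_Ioo)
  have lez: "set_integrable lborel {s<..<t} (\<lambda>r. l * (exp (- l * (t - r)) * z r))"
    using ez by simp
  have lwI: "set_integrable lborel {s<..<t} (\<lambda>r. l * (?w r * I r))"
    using wI by simp
  have sum: "set_integrable lborel {s<..<t} (\<lambda>r. l * (exp (- l * (t - r)) * z r) + l * (?w r * I r))"
    by (rule set_integral_add(1)[OF lez lwI])
  have alg: "l * X + l * (Y - X) = l * Y" for X Y :: real
    by (simp add: algebra_simps)
  have cong: "indicator {s<..<t} r *\<^sub>R (?w r * g r) =
      indicator {s<..<t} r *\<^sub>R (l * (exp (- l * (t - r)) * z r) + l * (?w r * I r))" for r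
    by (auto simp: indicator_def g_eq algebra_simps)
  show "set_integrable lborel {s<..<t} (\<lambda>r. ?w r * g r)"
    using sum unfolding set_integrable_def cong .
  have "(LINT r:{s<..<t}|lborel. ?w r * g r) =
      (LINT r:{s<..<t}|lborel. l * (exp (- l * (t - r)) * z r) + l * (?w r * I r))"
    unfolding set_lebesgue_integral_def cong ..
  also have "\<dots> = l * (LINT r:{s<..<t}|lborel. exp (- l * (t - r)) * z r) + l * (LINT r:{s<..<t}|lborel. ?w r * I r)"
    by (subst set_integral_add(2)[OF lez lwI]) simp
  also have "\<dots> = l * I t"
    unfolding fub by (rule alg)
  finally show "z t = g t - (LINT r:{s<..<t}|lborel. ?w r * g r)"
    using eq[of t] st by (simp add: I_def set_integral_Icc_eq_Ioo)
qed

text \<open>Moving the end points alters the integrand only near \<open>s\<close> and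
  \<open>t\<close>, a null set in the limit; hence convergence of \<open>p\<close> matters just for
  the two boundary terms and along the given sequences.\<close>

lemma exp_conv_tendsto:
  fixes p :: "real \<Rightarrow> real"
  assumes p: "set_integrable lborel {a..b} p"
    and mem: "\<And>n. a \<le> S n" "\<And>n. U n \<le> b" "\<And>n. S n \<le> U n" "s \<le> t"
    and lim: "S \<longlonglongrightarrow> s" "U \<longlonglongrightarrow> t" "(\<lambda>n. p (S n)) \<longlonglongrightarrow> p s" "(\<lambda>n. p (U n)) \<longlonglongrightarrow> p t"
  shows "(\<lambda>n. exp_conv l (S n) (U n) p) \<longlonglongrightarrow> exp_conv l s t p"
proof -
  have st: "a \<le> s" "t \<le> b"
    using lim(1,2) mem(1,2) by (auto intro: LIMSEQ_le_const LIMSEQ_le_const2)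
  let ?h = "\<lambda>s t r. indicator {s<..<t} r *\<^sub>R (exp (- l * (t - r)) * p r)"
  have meas: "?h s t \<in> borel_measurable lborel" if "a \<le> s" "t \<le> b" for s t
    using set_integrable_exp_mult[OF p that, of l] by (auto simp: set_integrable_def dest: borel_measurable_integrable)
  have "(\<lambda>n. integral\<^sup>L lborel (?h (S n) (U n))) \<longlonglongrightarrow> integral\<^sup>L lborel (?h s t)"
  proof (rule integral_dominated_convergence[where w="\<lambda>r. exp (\<bar>l\<bar> * (b - a)) * \<bar>indicator {a..b} r *\<^sub>R p r\<bar>"])
    show "?h s t \<in> borel_measurable lborel" "\<And>n. ?h (S n) (U n) \<in> borel_measurable lborel"
      using meas st mem by auto
    show "integrable lborel (\<lambda>r. exp (\<bar>l\<bar> * (b - a)) * \<bar>indicator {a..b} r *\<^sub>R p r\<bar>)"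
      using p by (intro integrable_mult_right integrable_abs) (simp add: set_integrable_def)
    have "AE r in lborel. r \<noteq> s" "AE r in lborel. r \<noteq> t"
      by (rule AE_lborel_singleton)+
    then show "AE r in lborel. (\<lambda>n. ?h (S n) (U n) r) \<longlonglongrightarrow> ?h s t r"
    proof eventually_elim
      case (elim r)
      have *: "(\<lambda>n. exp (- l * (U n - r)) * p r) \<longlonglongrightarrow> exp (- l * (t - r)) * p r"
        by (intro tendsto_intros lim)
      have i: "eventually (\<lambda>n. (indicator {S n<..<U n} r :: real) = indicator {s<..<t} r) sequentially"
      proof -
        consider "r < s" | "s < r" "r < t" | "t < r" using elim by linarith
        then show ?thesis
        proof cases
          case 1
          from order_tendstoD(1)[OF lim(1) 1] show ?thesis
            by eventually_elim (use 1 in \<open>auto simp: indicator_def\<close>)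
        next
          case 2
          from order_tendstoD(2)[OF lim(1) 2(1)] order_tendstoD(1)[OF lim(2) 2(2)] show ?thesis
            by eventually_elim (use 2 in \<open>auto simp: indicator_def\<close>)
        next
          case 3
          from order_tendstoD(2)[OF lim(2) 3] show ?thesis
            by eventually_elim (use 3 in \<open>auto simp: indicator_def\<close>)
        qed
      qed
      have "(\<lambda>n. (indicator {S n<..<U n} r :: real)) \<longlonglongrightarrow> indicator {s<..<t} r"
        by (rule tendsto_eventually[OF i])
      from tendsto_scaleR[OF this *] show ?case .
    qed
    show "AE r in lborel. norm (?h (S n) (U n) r) \<le> exp (\<bar>l\<bar> * (b - a)) * \<bar>indicator {a..b} r *\<^sub>R p r\<bar>" for n
    proof (intro always_eventually allI)
      fix r
      show "norm (?h (S n) (U n) r) \<le> exp (\<bar>l\<bar> * (b - a)) * \<bar>indicator {a..b} r *\<^sub>R p r\<bar>"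
      proof (cases "r \<in> {S n<..<U n}")
        case True
        then have r: "a \<le> r" "r \<le> b" "a \<le> U n" using mem(1)[of n] mem(2)[of n] mem(3)[of n] by auto
        then have "exp (- l * (U n - r)) * \<bar>p r\<bar> \<le> exp (\<bar>l\<bar> * (b - a)) * \<bar>p r\<bar>"
          by (intro mult_right_mono exp_decay_bound mem) auto
        then show ?thesis using True r by (simp add: abs_mult)
      qed simp
    qed
  qed
  then show ?thesis
    unfolding exp_conv_def set_lebesgue_integral_def by (intro tendsto_intros lim)
qed

lemma set_integrable_mono:
  fixes p :: "real \<Rightarrow> real"
  assumes "mono p"
  shows "set_integrable lborel {s..t} p"
proof -
  have "set_integrable lborel {s..t} (\<lambda>r. p r * 1)"
  proof (rule set_integrable_bounded_mult)
    show "set_integrable lborel {s..t} (\<lambda>_. 1 :: real)"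
      by (rule borel_integrable_atLeastAtMost') (rule continuous_on_const)
    show "p \<in> borel_measurable borel" by (rule borel_measurable_mono[OF assms(1)])
    show "\<bar>p r\<bar> \<le> \<bar>p s\<bar> + \<bar>p t\<bar>" if "r \<in> {s..t}" for r
      using monoD[OF assms(1), of s r] monoD[OF assms(1), of r t] that by auto
  qed
  then show ?thesis by simp
qed

text \<open>Replacing \<open>p r\<close> by the larger \<open>p t\<close> under the integral
  corresponds to replacing the Stieltjes weight by its minimum \<open>exp (- l * (t - s))\<close>.
  Applied to the subordinator, this bounds the conditional variance below by an increment of
  \<open>L\<close>.\<close>

lemma exp_conv_mono_lower_bound:
  fixes p :: "real \<Rightarrow> real"
  assumes "mono p" "s \<le> t" "0 \<le> l"
  shows "exp (- l * (t - s)) * (p t - p s) \<le> exp_conv l s t p"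
proof -
  have p: "set_integrable lborel {s..t} p"
    by (rule set_integrable_mono[OF assms(1)])
  have "(LINT r:{s<..<t}|lborel. l * exp (- l * (t - r)) * p r) \<le> (LINT r:{s<..<t}|lborel. l * exp (- l * (t - r)) * p t)"
  proof (rule set_integral_mono)
    have "set_integrable lborel {s<..<t} (\<lambda>r. exp (- l * (t - r)) * p r)"
      by (rule set_integrable_exp_mult[OF p]) auto
    then have "set_integrable lborel {s<..<t} (\<lambda>r. l * (exp (- l * (t - r)) * p r))"
      by simp
    then show "set_integrable lborel {s<..<t} (\<lambda>r. l * exp (- l * (t - r)) * p r)"
      by (simp add: mult.assoc)
    show "set_integrable lborel {s<..<t} (\<lambda>r. l * exp (- l * (t - r)) * p t)"
      using has_integral_exp_decay(1)[OF assms(2), of l t] by (rule set_integrable_mult_left)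
    show "l * exp (- l * (t - r)) * p r \<le> l * exp (- l * (t - r)) * p t" if "r \<in> {s<..<t}" for r
      using that assms(3) monoD[OF assms(1), of r t] by (intro mult_left_mono) auto
  qed
  also have "\<dots> = (1 - exp (- l * (t - s))) * p t"
    using has_integral_exp_decay(2)[OF assms(2), of l t] by simp
  finally have "l * (LINT r:{s<..<t}|lborel. exp (- l * (t - r)) * p r) \<le> (1 - exp (- l * (t - s))) * p t"
    by (simp add: mult.assoc)
  note le = this
  have "E * (b - a) \<le> b - E * a - J" if "J \<le> (1 - E) * b" for E a b J :: real
    using that by (simp add: algebra_simps)
  from this[OF le] show ?thesis
    unfolding exp_conv_def .
qed

section \<open>Explicit solution of the diagonal linear equation\<close>

lemma diag_matrix_vector_mult: "(diag_matrix d *v v) $ i = d i * v $ i"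
  by (simp add: diag_matrix_def matrix_vector_mult_def if_distrib [where f="\<lambda>z. z * _"] sum.delta cong: if_cong)

lemma uminus_diag_matrix: "- diag_matrix d = diag_matrix (\<lambda>i. - d i)"
  by (simp add: diag_matrix_def vec_eq_iff)

text \<open>Treating the deterministic forcing as one more path, its primitive, lets drift and noise
  go through the same \<open>exp_conv\<close>.\<close>

definition primitive :: "(real \<Rightarrow> real^'n) \<Rightarrow> 'n \<Rightarrow> real \<Rightarrow> real" where
  "primitive f i r = integral {0..r} (\<lambda>q. f q $ i)"

lemma primitive_facts:
  assumes f: "continuous_on {0..T} f"
  shows "continuous_on {0..T} (primitive f i)"
    "0 \<le> s \<Longrightarrow> s \<le> t \<Longrightarrow> t \<le> T \<Longrightarrow> set_integrable lborel {s..t} (\<lambda>q. f q $ i)"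
    "0 \<le> s \<Longrightarrow> s \<le> t \<Longrightarrow> t \<le> T \<Longrightarrow> (LINT q:{s..t}|lborel. f q $ i) = primitive f i t - primitive f i s"
proof -
  have fi: "continuous_on {0..T} (\<lambda>q. f q $ i)"
    by (intro continuous_intros f)
  show "continuous_on {0..T} (primitive f i)"
    unfolding primitive_def by (rule indefinite_integral_continuous_1[OF integrable_continuous_real[OF fi]])
  assume st: "0 \<le> s" "s \<le> t" "t \<le> T"
  show *: "set_integrable lborel {s..t} (\<lambda>q. f q $ i)"
    by (rule borel_integrable_atLeastAtMost') (rule continuous_on_subset[OF fi], use st in auto)
  have "(LINT q:{s..t}|lborel. f q $ i) = integral {s..t} (\<lambda>q. f q $ i)"
    by (rule set_borel_integral_eq_integral(2)[OF *])
  moreover have "integral {0..s} (\<lambda>q. f q $ i) + integral {s..t} (\<lambda>q. f q $ i) = integral {0..t} (\<lambda>q. f q $ i)"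
    using st by (intro Henstock_Kurzweil_Integration.integral_combine integrable_continuous_real continuous_on_subset[OF fi]) auto
  ultimately show "(LINT q:{s..t}|lborel. f q $ i) = primitive f i t - primitive f i s"
    unfolding primitive_def by simp
qed

text \<open>Ornstein-Uhlenbeck formula, pathwise and coordinate by coordinate. The exceptional null
  set depends on neither time nor coordinate, and integrability of the noise path is extracted from
  that of the solution.\<close>

lemma linear_SDE_solution_component:
  fixes Z :: "real \<Rightarrow> 'w \<Rightarrow> real^'n::finite"
  assumes sol: "linear_SDE_solution M (- diag_matrix lam) f (diag_matrix sg) Y T s x Z"
    and f: "continuous_on {0..T} f" and s: "0 \<le> s" and lam: "\<And>i. lam i \<noteq> 0" and sg: "\<And>i. sg i \<noteq> 0"
  shows "AE \<omega> in M. \<forall>t\<in>{s..T}. \<forall>i. Z t \<omega> $ i = exp (- lam i * (t - s)) * x $ i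
    + exp_conv (lam i) s t (primitive f i) + sg i * exp_conv (lam i) s t (\<lambda>r. Y r \<omega> $ i)"
proof -
  have "AE \<omega> in M. \<forall>t\<in>{s..T}.
       set_integrable lborel {s..t} (\<lambda>r. - diag_matrix lam *v Z r \<omega> + f r) \<and>
       Z t \<omega> = x + (LINT r:{s..t}|lborel. - diag_matrix lam *v Z r \<omega> + f r) + diag_matrix sg *v (Y t \<omega> - Y s \<omega>)"
    using sol unfolding linear_SDE_solution_def by auto
  then show ?thesis
  proof eventually_elim
    case (elim \<omega>)
    show ?case
    proof (intro ballI allI)
      fix t i assume t: "t \<in> {s..T}"
      let ?z = "\<lambda>r. Z r \<omega> $ i" and ?y = "\<lambda>r. Y r \<omega> $ i" and ?F = "primitive f i" and ?l = "lam i"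
      have int1: "set_integrable lborel {s..r} (\<lambda>q. - ?l * ?z q + f q $ i)"
        and eq1: "?z r = x $ i + (LINT q:{s..r}|lborel. - ?l * ?z q + f q $ i) + sg i * (?y r - ?y s)"
        if r: "s \<le> r" "r \<le> T" for r
      proof -
        let ?v = "\<lambda>q. - diag_matrix lam *v Z q \<omega> + f q"
        have v: "set_integrable lborel {s..r} ?v" and Zr: "Z r \<omega> = x + (LINT q:{s..r}|lborel. ?v q) + diag_matrix sg *v (Y r \<omega> - Y s \<omega>)"
          using elim r by auto
        have c: "?v q $ i = - ?l * ?z q + f q $ i" for q
          by (simp add: uminus_diag_matrix diag_matrix_vector_mult)
        have ind: "(indicator {s..r} q *\<^sub>R ?v q) $ i = indicator {s..r} q *\<^sub>R (- ?l * ?z q + f q $ i)" for q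
          unfolding vector_scaleR_component c by simp
        show "set_integrable lborel {s..r} (\<lambda>q. - ?l * ?z q + f q $ i)"
          using integrable_bounded_linear[OF bounded_linear_vec_nth[of i] v[unfolded set_integrable_def]]
          unfolding set_integrable_def ind .
        have "(LINT q:{s..r}|lborel. ?v q) $ i = (LINT q:{s..r}|lborel. - ?l * ?z q + f q $ i)"
          using integral_bounded_linear[OF bounded_linear_vec_nth[of i] v[unfolded set_integrable_def]]
          unfolding set_lebesgue_integral_def ind by simp
        then show "?z r = x $ i + (LINT q:{s..r}|lborel. - ?l * ?z q + f q $ i) + sg i * (?y r - ?y s)"
          unfolding Zr by (simp add: diag_matrix_vector_mult)
      qed
      \<comment> \<open>The definition integrates the whole right-hand side; removing
        \<open>f\<close> and dividing by \<open>- lam i\<close> isolates the solution path.\<close>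
      have zint: "set_integrable lborel {s..r} ?z" if r: "s \<le> r" "r \<le> T" for r
      proof -
        have "set_integrable lborel {s..r} (\<lambda>q. (- ?l * ?z q + f q $ i) - f q $ i)"
          by (rule set_integral_diff(1)[OF int1[OF r] primitive_facts(2)[OF f s r(1) r(2)]])
        then have "set_integrable lborel {s..r} (\<lambda>q. - ?l * ?z q)" by simp
        then have "set_integrable lborel {s..r} (\<lambda>q. (- 1 / ?l) * (- ?l * ?z q))"
          by (rule set_integrable_mult_right)
        then show ?thesis using lam[of i] by simp
      qed
      \<comment> \<open>\<open>g\<close> collects initial value, integrated forcing and noise, so
        that each coordinate solves the scalar equation treated before.\<close>
      define g where "g r = x $ i + (?F r - ?F s) + sg i * (?y r - ?y s)" for r
      have zeq: "?z r = g r - ?l * (LINT q:{s..r}|lborel. ?z q)" if r: "s \<le> r" "r \<le> t" for r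
      proof -
        have rT: "r \<le> T" using r t by auto
        have "set_integrable lborel {s..r} (\<lambda>q. - ?l * ?z q)"
          by (rule set_integrable_mult_right) (rule zint[OF r(1) rT])
        then have "(LINT q:{s..r}|lborel. - ?l * ?z q + f q $ i) = - ?l * (LINT q:{s..r}|lborel. ?z q) + (?F r - ?F s)"
          by (simp only: set_integral_add(2)[OF _ primitive_facts(2)[OF f s r(1) rT]]
            set_integral_mult_right primitive_facts(3)[OF f s r(1) rT])
        with eq1[OF r(1) rT] show ?thesis unfolding g_def by simp
      qed
      have st: "s \<le> t" and tT: "t \<le> T" using t by auto
      let ?w = "\<lambda>r. ?l * exp (- ?l * (t - r))"
      have sol: "set_integrable lborel {s<..<t} (\<lambda>r. ?w r * g r)"
        "?z t = g t - (LINT r:{s<..<t}|lborel. ?w r * g r)"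
        by (rule linear_integral_equation_solution[OF zint[OF st tT] _ st], rule zeq, assumption+)+
      let ?c = "x $ i - ?F s - sg i * ?y s"
      have wc: "set_integrable lborel {s<..<t} (\<lambda>r. ?w r * ?c)"
        using has_integral_exp_decay(1)[OF st, of ?l t] by (rule set_integrable_mult_left)
      have wF: "set_integrable lborel {s<..<t} (\<lambda>r. ?w r * ?F r)"
      proof -
        have "set_integrable lborel {s..t} ?F"
          by (rule borel_integrable_atLeastAtMost')
            (rule continuous_on_subset[OF primitive_facts(1)[OF f]], use s tT in auto)
        then have "set_integrable lborel {s<..<t} (\<lambda>r. exp (- ?l * (t - r)) * ?F r)"
          by (rule set_integrable_exp_mult) auto
        then have "set_integrable lborel {s<..<t} (\<lambda>r. ?l * (exp (- ?l * (t - r)) * ?F r))"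
          by simp
        then show ?thesis by (simp add: mult.assoc)
      qed
      have wsum: "set_integrable lborel {s<..<t} (\<lambda>r. ?w r * ?c + ?w r * ?F r)"
        by (rule set_integral_add(1)[OF wc wF])
      have "set_integrable lborel {s<..<t} (\<lambda>r. ?w r * g r - (?w r * ?c + ?w r * ?F r))"
        by (rule set_integral_diff(1)[OF sol(1) wsum])
      \<comment> \<open>The weighted noise is what remains of \<open>?w r * g r\<close> after
        subtracting the parts already known to be integrable.\<close>
      then have wy: "set_integrable lborel {s<..<t} (\<lambda>r. sg i * (?w r * ?y r))"
        by (rule back_subst) (auto simp: g_def fun_eq_iff algebra_simps intro!: arg_cong[where f="set_integrable lborel {s<..<t}"])
      have "(LINT r:{s<..<t}|lborel. ?w r * g r) =
          (LINT r:{s<..<t}|lborel. (?w r * ?c + ?w r * ?F r) + sg i * (?w r * ?y r))"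
        by (rule arg_cong[where f="set_lebesgue_integral lborel {s<..<t}"]) (auto simp: g_def fun_eq_iff algebra_simps)
      also have "\<dots> = (LINT r:{s<..<t}|lborel. ?w r * ?c) + (LINT r:{s<..<t}|lborel. ?w r * ?F r) +
          (LINT r:{s<..<t}|lborel. sg i * (?w r * ?y r))"
        by (simp only: set_integral_add(2)[OF wsum wy] set_integral_add(2)[OF wc wF])
      also have "(LINT r:{s<..<t}|lborel. ?w r * ?c) = (1 - exp (- ?l * (t - s))) * ?c"
        using has_integral_exp_decay(2)[OF st, of ?l t] by simp
      also have "(LINT r:{s<..<t}|lborel. ?w r * ?F r) = ?l * (LINT r:{s<..<t}|lborel. exp (- ?l * (t - r)) * ?F r)"
        by (simp add: mult.assoc)
      also have "(LINT r:{s<..<t}|lborel. sg i * (?w r * ?y r)) = sg i * (?l * (LINT r:{s<..<t}|lborel. exp (- ?l * (t - r)) * ?y r))"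
        by (simp add: mult.assoc)
      finally show "?z t = exp (- ?l * (t - s)) * x $ i + exp_conv ?l s t ?F + sg i * exp_conv ?l s t ?y"
      proof -
        assume "(LINT r:{s<..<t}|lborel. ?w r * g r) = (1 - exp (- ?l * (t - s))) * ?c +
          ?l * (LINT r:{s<..<t}|lborel. exp (- ?l * (t - r)) * ?F r) +
          sg i * (?l * (LINT r:{s<..<t}|lborel. exp (- ?l * (t - r)) * ?y r))"
        note 1 = sol(2)[unfolded this, unfolded g_def]
        have "x0 + (Ft - Fs) + a * (yt - ys) - ((1 - E) * (x0 - Fs - a * ys) + J + a * K) =
          E * x0 + (Ft - E * Fs - J) + a * (yt - E * ys - K)" for x0 Ft Fs a yt ys E J K :: real
          by (simp add: algebra_simps)
        note alg = this
        show ?thesis unfolding exp_conv_def by (rule trans[OF 1 alg])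
      qed
    qed
  qed
qed

section \<open>The law of the noise\<close>

lemma measurable_vec_borel:
  fixes f :: "'n::finite \<Rightarrow> 'a \<Rightarrow> real"
  assumes "\<And>i. f i \<in> borel_measurable M"
  shows "(\<lambda>x. \<chi> i. f i x) \<in> borel_measurable M"
proof -
  have "(\<lambda>x i. f i x) \<in> M \<rightarrow>\<^sub>M PiM UNIV (\<lambda>_. borel)"
    by (rule measurable_PiM_single') (use assms in auto)
  from measurable_compose[OF this measurable_vec_lambda] show ?thesis .
qed

lemma measurable_vec_nth [measurable]: "(\<lambda>x. x $ i) \<in> borel_measurable (borel :: (real^'n::finite) measure)"
  by (intro borel_measurable_continuous_onI continuous_intros)

text \<open>A sum of independent normals. Times may coincide, since a rounded clock can stand still;
  zero increments have no density and are dropped before the normal law is applied.\<close>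

lemma (in prob_space) brownian_weighted_increments:
  fixes \<beta> :: "real \<Rightarrow> 'a \<Rightarrow> real"
  assumes bm: "standard_brownian_motion1 M \<beta>"
    and l: "0 \<le> l 0" "mono l" and c: "\<And>k. 0 < c k"
  shows "distr M borel (\<lambda>\<omega>. \<Sum>k<n. c k * (\<beta> (l (Suc k)) \<omega> - \<beta> (l k) \<omega>)) =
    distr (density lborel (\<lambda>x. ennreal (std_normal_density x))) borel
      (\<lambda>g. 0 + sqrt (\<Sum>k<n. (c k)\<^sup>2 * (l (Suc k) - l k)) * g)"
proof -
  let ?N = "density lborel (\<lambda>x. ennreal (std_normal_density x))"
  interpret N: prob_space ?N by (rule prob_space_normal_density) simp
  let ?X = "\<lambda>k \<omega>. c k * (\<beta> (l (Suc k)) \<omega> - \<beta> (l k) \<omega>)"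
  define I where "I = {k. k < n \<and> l k < l (Suc k)}"
  have ls: "l k \<le> l (Suc k)" for k using l(2) by (simp add: mono_def)
  have l0: "0 \<le> l k" for k using l(1) monoD[OF l(2), of 0 k] by simp
  have zero: "l (Suc k) = l k" if "k < n" "k \<notin> I" for k
    using that ls[of k] by (auto simp: I_def)
  have sub: "I \<subseteq> {..<n}" by (auto simp: I_def)
  have s1: "(\<Sum>k<n. ?X k \<omega>) = (\<Sum>k\<in>I. ?X k \<omega>)" for \<omega>
    by (rule sum.mono_neutral_right[OF _ sub]) (simp_all add: zero)
  have s2: "(\<Sum>k<n. (c k)\<^sup>2 * (l (Suc k) - l k)) = (\<Sum>k\<in>I. (c k)\<^sup>2 * (l (Suc k) - l k))"
    by (rule sum.mono_neutral_right[OF _ sub]) (simp_all add: zero)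
  show ?thesis
  proof (cases "I = {}")
    case True
    then show ?thesis unfolding s1 s2 by simp
  next
    case False
    have "indep_vars (\<lambda>_. borel) (\<lambda>k \<omega>. \<beta> (l (Suc k)) \<omega> - \<beta> (l k) \<omega>) {..<n}"
      using bm l unfolding standard_brownian_motion1_def independent_increments_def by blast
    then have "indep_vars (\<lambda>_. borel) (\<lambda>k \<omega>. \<beta> (l (Suc k)) \<omega> - \<beta> (l k) \<omega>) I"
      by (rule indep_vars_subset) (auto simp: I_def)
    then have ind: "indep_vars (\<lambda>_. borel) ?X I"
      by (rule indep_vars_compose2) auto
    have "distributed M lborel (\<lambda>\<omega>. \<Sum>k\<in>I. ?X k \<omega>)
        (normal_density (\<Sum>k\<in>I. 0) (sqrt (\<Sum>k\<in>I. (c k * sqrt (l (Suc k) - l k))\<^sup>2)))"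
    proof (rule sum_indep_normal[OF _ False ind])
      fix k assume k: "k \<in> I"
      then have lt: "l k < l (Suc k)" by (simp add: I_def)
      then show "0 < c k * sqrt (l (Suc k) - l k)" using c[of k] by simp
      have "distributed M lborel (\<lambda>\<omega>. \<beta> (l (Suc k)) \<omega> - \<beta> (l k) \<omega>) (normal_density 0 (sqrt (l (Suc k) - l k)))"
        using bm lt l0[of k] unfolding standard_brownian_motion1_def by blast
      from normal_density_affine[OF this, of "c k" 0] lt c[of k]
      show "distributed M lborel (?X k) (normal_density 0 (c k * sqrt (l (Suc k) - l k)))"
        by simp
    qed (simp add: I_def)
    moreover have "(c k * sqrt (l (Suc k) - l k))\<^sup>2 = (c k)\<^sup>2 * (l (Suc k) - l k)" for k
      using ls[of k] by (simp add: power_mult_distrib)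
    ultimately have d: "distributed M lborel (\<lambda>\<omega>. \<Sum>k\<in>I. ?X k \<omega>)
        (normal_density 0 (sqrt (\<Sum>k\<in>I. (c k)\<^sup>2 * (l (Suc k) - l k))))"
      by simp
    have "0 < (\<Sum>k\<in>I. (c k)\<^sup>2 * (l (Suc k) - l k))"
      by (rule sum_pos) (use False c[THEN less_imp_neq] in \<open>auto simp: I_def intro!: mult_pos_pos\<close>)
    then show ?thesis
      unfolding s1 s2 by (intro distr_normal_eq_distr_std_normal[OF d]) simp
  qed
qed

text \<open>Coordinates use different weights but the same clock \<open>l\<close>. Each sum is a
  functional of the path of one coordinate, so independence of the coordinate processes yields a
  product law.\<close>

lemma (in prob_space) brownian_vector_weighted_increments:
  fixes W :: "real \<Rightarrow> 'a \<Rightarrow> real^'n::finite"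
  assumes bm: "standard_brownian_motion M W"
    and l: "0 \<le> l 0" "mono l" and c: "\<And>i k. 0 < c i k"
    and \<psi>: "\<psi> \<in> borel_measurable borel"
  shows "(LINT \<omega>|M. \<psi> (\<chi> i. \<Sum>k<n. c i k * (W (l (Suc k)) \<omega> $ i - W (l k) \<omega> $ i))) =
    (LINT g|std_gauss. (\<psi> (\<chi> i. sqrt (\<Sum>k<n. (c i k)\<^sup>2 * (l (Suc k) - l k)) * g i) :: real))"
proof -
  let ?N = "density lborel (\<lambda>x. ennreal (std_normal_density x))"
  let ?X = "\<lambda>i \<omega>. \<Sum>k<n. c i k * (W (l (Suc k)) \<omega> $ i - W (l k) \<omega> $ i)"
  let ?s = "\<lambda>i. sqrt (\<Sum>k<n. (c i k)\<^sup>2 * (l (Suc k) - l k))"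
  have l0: "0 \<le> l k" for k using l(1) monoD[OF l(2), of 0 k] by simp
  have bm1: "standard_brownian_motion1 M (\<lambda>t \<omega>. W t \<omega> $ i)" for i
    using bm by (simp add: standard_brownian_motion_def)
  have "indep_vars (\<lambda>_. PiM {0..} (\<lambda>_. borel)) (\<lambda>i. process_path (\<lambda>t \<omega>. W t \<omega> $ i)) UNIV"
    using bm by (simp add: standard_brownian_motion_def)
  then have "indep_vars (\<lambda>_. borel) (\<lambda>i \<omega>. (\<lambda>p. \<Sum>k<n. c i k * (p (l (Suc k)) - p (l k)))
      (process_path (\<lambda>t \<omega>. W t \<omega> $ i) \<omega>)) UNIV"
    by (rule indep_vars_compose2)
      (intro borel_measurable_sum borel_measurable_times borel_measurable_diff borel_measurable_const
        measurable_component_singleton, use l0 in auto)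
  then have ind: "indep_vars (\<lambda>_. borel) ?X UNIV"
    using l0 by (simp add: process_path_def)
  then have rv: "?X i \<in> borel_measurable M" for i
    by (simp add: indep_vars_def)
  have "distr M (PiM UNIV (\<lambda>_. borel)) (\<lambda>\<omega>. \<lambda>i\<in>UNIV. ?X i \<omega>) = PiM UNIV (\<lambda>i. distr M borel (?X i))"
    using ind rv by (subst indep_vars_iff_distr_eq_PiM'[symmetric]) auto
  also have "\<dots> = PiM UNIV (\<lambda>i. distr ?N borel (\<lambda>g. (0 :: real^'n) $ i + ?s i * g))"
    by (simp only: brownian_weighted_increments[OF bm1 l c] zero_index)
  also have "\<dots> = distr std_gauss (PiM UNIV (\<lambda>_. borel)) (\<lambda>g i. (0 :: real^'n) $ i + ?s i * g i)"
    by (rule distr_std_gauss_affine[symmetric])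
  finally have eq: "distr M (PiM UNIV (\<lambda>_. borel)) (\<lambda>\<omega> i. ?X i \<omega>) =
      distr std_gauss (PiM UNIV (\<lambda>_. borel)) (\<lambda>g i. ?s i * g i)"
    by (simp add: restrict_def)
  have X: "(\<lambda>\<omega> i. ?X i \<omega>) \<in> M \<rightarrow>\<^sub>M PiM UNIV (\<lambda>_. borel)"
    by (rule measurable_PiM_single') (use rv in auto)
  have G: "(\<lambda>g i. ?s i * g i) \<in> std_gauss \<rightarrow>\<^sub>M PiM UNIV (\<lambda>_::'n. borel)"
    by (rule measurable_PiM_single') auto
  have \<psi>v: "(\<lambda>y. \<psi> (vec_lambda y)) \<in> borel_measurable (PiM UNIV (\<lambda>_. borel))"
    by (rule measurable_compose[OF measurable_vec_lambda \<psi>])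
  show ?thesis
    using arg_cong[OF eq, of "\<lambda>\<mu>. LINT y|\<mu>. \<psi> (vec_lambda y)"]
    by (simp only: integral_distr[OF X \<psi>v] integral_distr[OF G \<psi>v])
qed

text \<open>Closed sets generate the Borel sets and are stable under intersection; the indicator of
  a nonempty closed set is a pointwise limit of bounded continuous cut-offs built from the
  distance.\<close>

lemma finite_measure_eqI_continuous:
  fixes \<mu> \<nu> :: "'a::metric_space measure"
  assumes fin: "finite_measure \<mu>" "finite_measure \<nu>" and sets: "sets \<mu> = sets borel" "sets \<nu> = sets borel"
    and eq: "\<And>\<phi> :: 'a \<Rightarrow> real. continuous_on UNIV \<phi> \<Longrightarrow> bounded (range \<phi>) \<Longrightarrow> (LINT x|\<mu>. \<phi> x) = (LINT x|\<nu>. \<phi> x)"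
  shows "\<mu> = \<nu>"
proof (rule measure_eqI_generator_eq[where E="{C. closed C}" and \<Omega>=UNIV and A="\<lambda>_. UNIV"])
  interpret \<mu>: finite_measure \<mu> by fact
  interpret \<nu>: finite_measure \<nu> by fact
  show "emeasure \<mu> UNIV \<noteq> \<infinity>" by simp
  show "sets \<mu> = sigma_sets UNIV {C. closed C}" "sets \<nu> = sigma_sets UNIV {C. closed C}"
    unfolding sets by (subst borel_eq_closed, simp)+
  show "Int_stable {C :: 'a set. closed C}" by (auto simp: Int_stable_def)
  fix C :: "'a set" assume "C \<in> {C. closed C}"
  then have C: "closed C" by simp
  show "emeasure \<mu> C = emeasure \<nu> C"
  \<comment> \<open>\<open>infdist\<close> to the empty set is 0, so the cut-offs below would be
    constantly 1 there.\<close>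
  proof (cases "C = {}")
    case False
    define \<phi> where "\<phi> n x = max 0 (1 - real n * infdist x C)" for n x
    have cont: "continuous_on UNIV (\<phi> n)" for n
      unfolding \<phi>_def by (intro continuous_intros)
    have b: "\<bar>\<phi> n x\<bar> \<le> 1" for n x
      unfolding \<phi>_def using infdist_nonneg[of x C] by (auto simp: max_def)
    have bdd: "bounded (range (\<phi> n))" for n
      unfolding bounded_iff using b by (auto intro!: exI[of _ 1])
    have lim: "(\<lambda>n. \<phi> n x) \<longlonglongrightarrow> indicator C x" for x
    proof (cases "x \<in> C")
      case True
      then show ?thesis by (simp add: \<phi>_def)
    next
      case x: False
      then have pos: "0 < infdist x C"
        using infdist_pos_not_in_closed[OF C False] by simp
      then obtain n0 where n0: "1 < real n0 * infdist x C"
        using reals_Archimedean3 by blast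
      have "\<phi> n x = 0" if "n0 \<le> n" for n
      proof -
        have "real n0 * infdist x C \<le> real n * infdist x C"
          using that pos by (intro mult_right_mono) auto
        with n0 show ?thesis by (simp add: \<phi>_def)
      qed
      then have "eventually (\<lambda>n. \<phi> n x = 0) sequentially"
        by (auto simp: eventually_sequentially)
      from tendsto_eventually[OF this] x show ?thesis by simp
    qed
    have conv: "(\<lambda>n. LINT x|\<kappa>. \<phi> n x) \<longlonglongrightarrow> measure \<kappa> C"
      if \<kappa>: "finite_measure \<kappa>" "sets \<kappa> = sets borel" for \<kappa>
    proof -
      interpret \<kappa>: finite_measure \<kappa> by fact
      have "\<phi> n \<in> borel_measurable borel" for n
        by (rule borel_measurable_continuous_onI[OF cont])
      then have meas: "\<phi> n \<in> borel_measurable \<kappa>" for n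
        using \<kappa>(2) by (simp cong: measurable_cong_sets)
      have Cs: "C \<in> sets \<kappa>" using C \<kappa>(2) by simp
      have "(\<lambda>n. LINT x|\<kappa>. \<phi> n x) \<longlonglongrightarrow> (LINT x|\<kappa>. indicator C x)"
        by (rule integral_dominated_convergence[where s=\<phi> and w="\<lambda>_. 1"])
          (use meas lim b Cs in auto)
      then show ?thesis using Cs by simp
    qed
    have "measure \<mu> C = measure \<nu> C"
      using LIMSEQ_unique[OF conv[OF fin(1) sets(1)]] conv[OF fin(2) sets(2)] eq[OF cont bdd] by simp
    then show ?thesis
      by (simp add: \<mu>.emeasure_eq_measure \<nu>.emeasure_eq_measure)
  qed simp
qed auto

section \<open>Independence of the clock and the Brownian motion\<close>

locale subordinated_noise = prob_space M
  for M :: "'w measure" +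
  fixes W :: "real \<Rightarrow> 'w \<Rightarrow> real^'n::finite" and L :: "real \<Rightarrow> 'w \<Rightarrow> real"
  assumes W: "standard_brownian_motion M W"
    and L: "subordinator M L"
    and indep: "independent_processes M L W"
begin

lemma measurable_W: "0 \<le> t \<Longrightarrow> (\<lambda>\<omega>. W t \<omega> $ i) \<in> borel_measurable M"
  using W by (simp add: standard_brownian_motion_def standard_brownian_motion1_def)

lemma measurable_W_vec: "0 \<le> t \<Longrightarrow> W t \<in> borel_measurable M"
  using measurable_vec_borel[of "\<lambda>i \<omega>. W t \<omega> $ i" M] measurable_W by simp

lemma measurable_L: "0 \<le> t \<Longrightarrow> L t \<in> borel_measurable M"
  using L by (simp add: subordinator_def levy_process_def)

definition good_path :: "'w \<Rightarrow> bool" where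
  "good_path \<omega> \<longleftrightarrow> L 0 \<omega> = 0 \<and> cadlag_on {0..} (\<lambda>t. L t \<omega>) \<and> mono_on {0..} (\<lambda>t. L t \<omega>)"

text \<open>A measurable null set enclosing the irregular paths, chosen once, so that the redefined
  process is measurable at every time.\<close>

definition bad_set :: "'w set" where
  "bad_set = (SOME N. N \<in> null_sets M \<and> {\<omega> \<in> space M. \<not> good_path \<omega>} \<subseteq> N)"

lemma bad_set: "bad_set \<in> null_sets M" "\<And>\<omega>. \<omega> \<in> space M - bad_set \<Longrightarrow> good_path \<omega>"
proof -
  have "AE \<omega> in M. good_path \<omega>"
    using L by (simp add: good_path_def subordinator_def levy_process_def)
  then obtain N where "{\<omega> \<in> space M. \<not> good_path \<omega>} \<subseteq> N" "emeasure M N = 0" "N \<in> sets M"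
    by (rule AE_E)
  then have "\<exists>N. N \<in> null_sets M \<and> {\<omega> \<in> space M. \<not> good_path \<omega>} \<subseteq> N"
    by (intro exI[of _ N]) (simp add: null_sets_def)
  from someI_ex[OF this]
  have "bad_set \<in> null_sets M \<and> {\<omega> \<in> space M. \<not> good_path \<omega>} \<subseteq> bad_set"
    unfolding bad_set_def .
  then show "bad_set \<in> null_sets M" "\<And>\<omega>. \<omega> \<in> space M - bad_set \<Longrightarrow> good_path \<omega>"
    by auto
qed

text \<open>A version of the subordinator all of whose paths are nondecreasing and right-continuous.\<close>

definition Lr :: "real \<Rightarrow> 'w \<Rightarrow> real" where
  "Lr t \<omega> = (if \<omega> \<in> space M - bad_set then L (max 0 t) \<omega> else max 0 t)"

lemma measurable_Lr [measurable]: "Lr t \<in> borel_measurable M"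
proof -
  have [measurable]: "L (max 0 t) \<in> borel_measurable M" by (rule measurable_L) simp
  have [measurable]: "space M - bad_set \<in> sets M" using bad_set(1) by auto
  show ?thesis unfolding Lr_def by measurable
qed

text \<open>Monotone on the whole line because negative times are clamped to 0; the estimates for
  monotone integrators then apply without restricting the domain.\<close>

lemma mono_Lr: "mono (\<lambda>t. Lr t \<omega>)"
proof (rule monoI)
  fix s t :: real assume "s \<le> t"
  then have le: "max 0 s \<le> max 0 t" by simp
  show "Lr s \<omega> \<le> Lr t \<omega>"
  proof (cases "\<omega> \<in> space M - bad_set")
    case True
    then have "mono_on {0..} (\<lambda>t. L t \<omega>)" using bad_set(2) by (simp add: good_path_def)
    from mono_onD[OF this _ _ le] True show ?thesis by (simp add: Lr_def)
  next
    case False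
    with le show ?thesis unfolding Lr_def by (simp only: if_False)
  qed
qed

lemma Lr_0 [simp]: "t \<le> 0 \<Longrightarrow> Lr t \<omega> = 0"
  using bad_set(2)[of \<omega>] unfolding Lr_def good_path_def by auto

lemma Lr_nonneg [simp]: "0 \<le> Lr t \<omega>"
  using monoD[OF mono_Lr, of "min 0 t" t] by simp

lemma Lr_right_continuous:
  assumes "0 \<le> t"
  shows "((\<lambda>t. Lr t \<omega>) \<longlongrightarrow> Lr t \<omega>) (at_right t)"
proof (cases "\<omega> \<in> space M - bad_set")
  case True
  then have "cadlag_on {0..} (\<lambda>t. L t \<omega>)"
    using bad_set(2) by (simp add: good_path_def)
  then have "((\<lambda>t. L t \<omega>) \<longlongrightarrow> L t \<omega>) (at t within ({0..} \<inter> {t<..}))"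
    using assms by (auto simp: cadlag_on_def)
  moreover have "{0..} \<inter> {t<..} = {t<..}" using assms by auto
  ultimately have "((\<lambda>t. L t \<omega>) \<longlongrightarrow> L t \<omega>) (at_right t)" by simp
  then have "((\<lambda>t. L t \<omega>) \<longlongrightarrow> Lr t \<omega>) (at_right t)"
    using True assms by (simp add: Lr_def)
  moreover have "eventually (\<lambda>r. L r \<omega> = Lr r \<omega>) (at_right t)"
    using True assms by (auto simp: Lr_def eventually_at_filter)
  ultimately show ?thesis by (rule Lim_transform_eventually)
next
  case False
  then have "(\<lambda>t. Lr t \<omega>) = (\<lambda>t. max 0 t)" by (auto simp: Lr_def)
  moreover have "((\<lambda>t. max 0 t) \<longlongrightarrow> max 0 t) (at_right t)"
    by (intro tendsto_intros)
  ultimately show ?thesis by (simp add: fun_eq_iff)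
qed

lemma AE_Lr: "AE \<omega> in M. \<forall>t\<ge>0. Lr t \<omega> = L t \<omega>"
proof -
  have "AE \<omega> in M. \<omega> \<notin> bad_set" using bad_set(1) by (rule AE_not_in)
  moreover have "AE \<omega> in M. \<omega> \<in> space M" by (rule AE_space)
  ultimately show ?thesis by eventually_elim (simp add: Lr_def)
qed

abbreviation time_paths :: "(real \<Rightarrow> 'b::topological_space) measure" where
  "time_paths \<equiv> PiM {0..} (\<lambda>_. borel)"

lemma measurable_path_L: "process_path L \<in> M \<rightarrow>\<^sub>M time_paths"
  unfolding process_path_def[abs_def] by (rule measurable_restrict) (simp add: measurable_L)

lemma measurable_path_W: "process_path W \<in> M \<rightarrow>\<^sub>M time_paths"
  unfolding process_path_def[abs_def] by (rule measurable_restrict) (simp add: measurable_W_vec)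

text \<open>By independence the joint law of the two paths is the product law, checked on
  rectangles. The second sample point \<open>\<omega>'\<close> makes the conditional expectation
  given \<open>L\<close> an ordinary inner integral, with the clock frozen.\<close>

lemma expectation_paths:
  fixes F :: "(real \<Rightarrow> real) \<times> (real \<Rightarrow> real^'n) \<Rightarrow> real"
  assumes F: "F \<in> borel_measurable (time_paths \<Otimes>\<^sub>M time_paths)" and b: "\<And>p. \<bar>F p\<bar> \<le> c"
  shows "(LINT \<omega>|M. F (process_path L \<omega>, process_path W \<omega>)) =
    (LINT \<omega>|M. LINT \<omega>'|M. F (process_path L \<omega>, process_path W \<omega>'))"
proof -
  let ?P = "time_paths :: (real \<Rightarrow> real) measure" and ?Q = "time_paths :: (real \<Rightarrow> real^'n) measure"
  note pL = measurable_path_L and pW = measurable_path_W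
  interpret P: prob_space "distr M ?P (process_path L)" by (rule prob_space_distr[OF pL])
  interpret Q: prob_space "distr M ?Q (process_path W)" by (rule prob_space_distr[OF pW])
  have joint: "distr M ?P (process_path L) \<Otimes>\<^sub>M distr M ?Q (process_path W) =
      distr M (?P \<Otimes>\<^sub>M ?Q) (\<lambda>\<omega>. (process_path L \<omega>, process_path W \<omega>))"
  proof (rule pair_measure_eqI)
    show "sets (distr M ?P (process_path L) \<Otimes>\<^sub>M distr M ?Q (process_path W)) =
        sets (distr M (?P \<Otimes>\<^sub>M ?Q) (\<lambda>\<omega>. (process_path L \<omega>, process_path W \<omega>)))"
      by (simp cong: sets_pair_measure_cong)
    fix A B assume "A \<in> sets (distr M ?P (process_path L))" "B \<in> sets (distr M ?Q (process_path W))"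
    then have A: "A \<in> sets ?P" and B: "B \<in> sets ?Q" by auto
    have "prob ((process_path L -` A \<inter> space M) \<inter> (process_path W -` B \<inter> space M)) =
        prob (process_path L -` A \<inter> space M) * prob (process_path W -` B \<inter> space M)"
      using indep unfolding independent_processes_def
      by (rule indep_setD) (intro in_vimage_algebra A B)+
    moreover have "(\<lambda>\<omega>. (process_path L \<omega>, process_path W \<omega>)) -` (A \<times> B) \<inter> space M =
        (process_path L -` A \<inter> space M) \<inter> (process_path W -` B \<inter> space M)"
      by auto
    ultimately show "emeasure (distr M ?P (process_path L)) A * emeasure (distr M ?Q (process_path W)) B =
        emeasure (distr M (?P \<Otimes>\<^sub>M ?Q) (\<lambda>\<omega>. (process_path L \<omega>, process_path W \<omega>))) (A \<times> B)"
      using pL pW A B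
      by (simp add: emeasure_distr emeasure_eq_measure ennreal_mult)
  qed (intro P.sigma_finite_measure_axioms Q.sigma_finite_measure_axioms)+
  interpret PQ: pair_prob_space "distr M ?P (process_path L)" "distr M ?Q (process_path W)" ..
  have F': "F \<in> borel_measurable (distr M ?P (process_path L) \<Otimes>\<^sub>M distr M ?Q (process_path W))"
    using F by (simp cong: measurable_cong_sets sets_pair_measure_cong)
  have int: "integrable (distr M ?P (process_path L) \<Otimes>\<^sub>M distr M ?Q (process_path W)) F"
    by (rule PQ.P.integrable_const_bound[where B=c]) (use b F' in auto)
  have "(LINT \<omega>|M. F (process_path L \<omega>, process_path W \<omega>)) =
      (LINT p|distr M (?P \<Otimes>\<^sub>M ?Q) (\<lambda>\<omega>. (process_path L \<omega>, process_path W \<omega>)). F p)"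
    by (rule integral_distr[symmetric]) (use pL pW F in auto)
  also have "\<dots> = (LINT p|distr M ?P (process_path L). LINT q|distr M ?Q (process_path W). F (p, q))"
    unfolding joint[symmetric] by (rule PQ.integral_fst'[OF int, symmetric])
  also have "\<dots> = (LINT \<omega>|M. LINT q|distr M ?Q (process_path W). F (process_path L \<omega>, q))"
  proof (rule integral_distr[OF pL])
    have "(\<lambda>p. LINT q|distr M ?Q (process_path W). F (p, q)) \<in> borel_measurable (distr M ?P (process_path L))"
      using F' by (intro Q.borel_measurable_lebesgue_integral) simp
    then show "(\<lambda>p. LINT q|distr M ?Q (process_path W). F (p, q)) \<in> borel_measurable ?P"
      by simp
  qed
  also have "\<dots> = (LINT \<omega>|M. LINT \<omega>'|M. F (process_path L \<omega>, process_path W \<omega>'))"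
  proof (rule Bochner_Integration.integral_cong[OF refl])
    fix \<omega> assume "\<omega> \<in> space M"
    then have "process_path L \<omega> \<in> space ?P" by (rule measurable_space[OF pL])
    then have "(\<lambda>q. F (process_path L \<omega>, q)) \<in> borel_measurable ?Q"
      by (rule measurable_compose[OF measurable_Pair1' F])
    then show "(LINT q|distr M ?Q (process_path W). F (process_path L \<omega>, q)) =
        (LINT \<omega>'|M. F (process_path L \<omega>, process_path W \<omega>'))"
      by (rule integral_distr[OF pW])
  qed
  finally show ?thesis .
qed

end

section \<open>Conditional Gaussian law of the noise\<close>

lemma riemann_conv_cong:
  assumes "s \<le> t" "\<And>r. s \<le> r \<Longrightarrow> r \<le> t \<Longrightarrow> p r = q r"
  shows "riemann_conv l s t n p = riemann_conv l s t n q"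
  unfolding riemann_conv_def
  by (intro sum.cong refl arg_cong2[where f="(*)"] arg_cong2[where f="(-)"] assms(2) grid_bounds assms(1)) auto

lemma exp_conv_cong:
  assumes "s \<le> t" "\<And>r. s \<le> r \<Longrightarrow> r \<le> t \<Longrightarrow> p r = q r"
  shows "exp_conv l s t p = exp_conv l s t q"
proof -
  have "(LINT r:{s<..<t}|lborel. exp (- l * (t - r)) * p r) = (LINT r:{s<..<t}|lborel. exp (- l * (t - r)) * q r)"
    by (rule set_lebesgue_integral_cong) (use assms(2) in auto)
  then show ?thesis unfolding exp_conv_def using assms by simp
qed

lemma measurable_gauss_mixture:
  fixes m :: "real^'n::finite"
  assumes "\<And>i. V i \<in> borel_measurable N" and "\<phi> \<in> borel_measurable borel"
  shows "(\<lambda>(\<omega>, g). \<phi> (\<chi> i. m $ i + sg i * (sqrt (V i \<omega>) * g i))) \<in> borel_measurable (N \<Otimes>\<^sub>M std_gauss)"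
proof -
  have [measurable]: "(\<lambda>p. V i (fst p)) \<in> borel_measurable (N \<Otimes>\<^sub>M std_gauss)" for i
    by (rule measurable_compose[OF measurable_fst assms(1)])
  have [measurable]: "(\<lambda>p. snd p i) \<in> borel_measurable (N \<Otimes>\<^sub>M (std_gauss :: ('n \<Rightarrow> real) measure))" for i
    by measurable
  have "(\<lambda>p. \<chi> i. m $ i + sg i * (sqrt (V i (fst p)) * snd p i)) \<in> borel_measurable (N \<Otimes>\<^sub>M std_gauss)"
    by (rule measurable_vec_borel) measurable
  from measurable_compose[OF this assms(2)] show ?thesis
    by (simp add: case_prod_unfold)
qed

context subordinated_noise
begin

text \<open>With rounded clock values everything is a measurable functional of the pair of paths, so
  the clock can be frozen; the inner expectation then concerns Brownian increments at deterministic
  times and is Gaussian.\<close>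

lemma noise_law_riemann:
  fixes m :: "real^'n" and \<phi> :: "real^'n \<Rightarrow> real"
  assumes \<phi>: "\<phi> \<in> borel_measurable borel" "\<And>x. \<bar>\<phi> x\<bar> \<le> c" and st: "0 \<le> s" "s < t"
  shows "(\<lambda>\<omega>. \<phi> (\<chi> i. m $ i + sg i * riemann_conv (lam i) s t n (\<lambda>r. W (round_up n (L r \<omega>)) \<omega> $ i))) \<in> borel_measurable M"
    "(LINT \<omega>|M. \<phi> (\<chi> i. m $ i + sg i * riemann_conv (lam i) s t n (\<lambda>r. W (round_up n (L r \<omega>)) \<omega> $ i))) =
     (LINT \<omega>|M. LINT g|std_gauss. \<phi> (\<chi> i. m $ i + sg i * (sqrt (riemann_conv (2 * lam i) s t n (\<lambda>r. round_up n (Lr r \<omega>))) * g i)))"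
proof -
  let ?P = "time_paths \<Otimes>\<^sub>M time_paths :: ((real \<Rightarrow> real) \<times> (real \<Rightarrow> real^'n)) measure"
  define F where "F p = \<phi> (\<chi> i. m $ i + sg i * riemann_conv (lam i) s t n (\<lambda>r. snd p (round_up n (fst p r)) $ i))"
    for p :: "(real \<Rightarrow> real) \<times> (real \<Rightarrow> real^'n)"
  \<comment> \<open>The path of \<open>W\<close> at a random time becomes measurable because the
    rounded time takes countably many values, one coordinate for each.\<close>
  have ev: "(\<lambda>p. snd p (round_up n (fst p r)) $ i) \<in> borel_measurable ?P" if "0 \<le> r" for r i
  proof -
    have "(\<lambda>p. fst p r) \<in> borel_measurable ?P"
      by (rule measurable_compose[OF measurable_fst measurable_component_singleton]) (use that in simp)
    then have 1: "(\<lambda>p. nat \<lceil>real (Suc n) * fst p r\<rceil>) \<in> ?P \<rightarrow>\<^sub>M count_space UNIV"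
      by measurable
    have 2: "(\<lambda>p. snd p (real k / real (Suc n)) $ i) \<in> borel_measurable ?P" for k
    proof -
      have "(\<lambda>p. snd p (real k / real (Suc n))) \<in> borel_measurable ?P"
        by (rule measurable_compose[OF measurable_snd measurable_component_singleton]) simp
      then show ?thesis by measurable
    qed
    show ?thesis
      using measurable_compose_countable[OF 2 1] unfolding round_up_def .
  qed
  have grid0: "0 \<le> grid s t n k" if "k \<le> Suc n" for k
    using grid_bounds(1)[of s t k n] that st by simp
  have F: "F \<in> borel_measurable ?P"
    unfolding F_def riemann_conv_def
    by (rule measurable_compose[OF measurable_vec_borel \<phi>(1)], intro borel_measurable_add borel_measurable_times
        borel_measurable_sum borel_measurable_diff borel_measurable_const ev grid0) auto
  have Fb: "\<bar>F p\<bar> \<le> c" for p unfolding F_def by (rule \<phi>(2))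
  have path: "F (process_path L \<omega>, process_path W \<omega>') =
      \<phi> (\<chi> i. m $ i + sg i * riemann_conv (lam i) s t n (\<lambda>r. W (round_up n (L r \<omega>)) \<omega>' $ i))" for \<omega> \<omega>'
  proof -
    have "riemann_conv (lam i) s t n (\<lambda>r. process_path W \<omega>' (round_up n (process_path L \<omega> r)) $ i) =
       riemann_conv (lam i) s t n (\<lambda>r. W (round_up n (L r \<omega>)) \<omega>' $ i)" for i
      by (rule riemann_conv_cong) (use st in \<open>auto simp: process_path_def\<close>)
    then show ?thesis unfolding F_def by simp
  qed
  note pL = measurable_path_L and pW = measurable_path_W
  show "(\<lambda>\<omega>. \<phi> (\<chi> i. m $ i + sg i * riemann_conv (lam i) s t n (\<lambda>r. W (round_up n (L r \<omega>)) \<omega> $ i))) \<in> borel_measurable M"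
    using measurable_compose[OF measurable_Pair[OF pL pW] F] unfolding path .
  have inner: "(LINT \<omega>'|M. \<phi> (\<chi> i. m $ i + sg i * riemann_conv (lam i) s t n (\<lambda>r. W (round_up n (L r \<omega>)) \<omega>' $ i))) =
      (LINT g|std_gauss. \<phi> (\<chi> i. m $ i + sg i * (sqrt (riemann_conv (2 * lam i) s t n (\<lambda>r. round_up n (Lr r \<omega>))) * g i)))"
    if \<omega>: "\<forall>r\<ge>0. Lr r \<omega> = L r \<omega>" for \<omega>
  proof -
    let ?l = "\<lambda>k. round_up n (Lr (grid s t n k) \<omega>)"
    let ?c = "\<lambda>i k. exp (- lam i * (t - grid s t n k))"
    have 1: "riemann_conv (lam i) s t n (\<lambda>r. W (round_up n (L r \<omega>)) \<omega>' $ i) =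
       (\<Sum>k<Suc n. ?c i k * (W (?l (Suc k)) \<omega>' $ i - W (?l k) \<omega>' $ i))" for i \<omega>'
    proof -
      have "riemann_conv (lam i) s t n (\<lambda>r. W (round_up n (L r \<omega>)) \<omega>' $ i) =
        riemann_conv (lam i) s t n (\<lambda>r. W (round_up n (Lr r \<omega>)) \<omega>' $ i)"
        by (rule riemann_conv_cong) (use st \<omega> in auto)
      then show ?thesis by (simp only: riemann_conv_def)
    qed
    \<comment> \<open>Squaring the weights doubles the rate; this is why variances involve
      \<open>2 * lam i\<close> throughout.\<close>
    have sq: "(?c i k)\<^sup>2 = exp (- (2 * lam i) * (t - grid s t n k))" for i k
      by (simp add: power2_eq_square exp_add[symmetric] algebra_simps)
    have 2: "riemann_conv (2 * lam i) s t n (\<lambda>r. round_up n (Lr r \<omega>)) = (\<Sum>k<Suc n. (?c i k)\<^sup>2 * (?l (Suc k) - ?l k))" for i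
      by (simp only: riemann_conv_def sq)
    have "mono ?l"
      by (intro monoI round_up_mono monoD[OF mono_Lr] grid_mono) (use st in auto)
    moreover have "(\<lambda>x. \<phi> (\<chi> i. m $ i + sg i * x $ i)) \<in> borel_measurable borel"
      by (rule measurable_compose[OF measurable_vec_borel \<phi>(1)]) measurable
    ultimately have "(LINT \<omega>'|M. \<phi> (\<chi> j. m $ j + sg j * (\<chi> i. \<Sum>k<Suc n. ?c i k * (W (?l (Suc k)) \<omega>' $ i - W (?l k) \<omega>' $ i)) $ j)) =
      (LINT g|std_gauss. \<phi> (\<chi> j. m $ j + sg j * (\<chi> i. sqrt (\<Sum>k<Suc n. (?c i k)\<^sup>2 * (?l (Suc k) - ?l k)) * g i) $ j))"
      by (intro brownian_vector_weighted_increments[OF W, where l="?l" and c="?c" and n="Suc n" and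
          \<psi>="\<lambda>x. \<phi> (\<chi> i. m $ i + sg i * x $ i)"]) auto
    then show ?thesis unfolding 1 2 by (simp only: vec_lambda_beta)
  qed
  have meas: "(\<lambda>\<omega>. LINT \<omega>'|M. F (process_path L \<omega>, process_path W \<omega>')) \<in> borel_measurable M"
  proof (rule borel_measurable_lebesgue_integral)
    have "(\<lambda>p. (process_path L (fst p), process_path W (snd p))) \<in> M \<Otimes>\<^sub>M M \<rightarrow>\<^sub>M ?P"
      by (intro measurable_Pair measurable_compose[OF measurable_fst pL] measurable_compose[OF measurable_snd pW])
    from measurable_compose[OF this F]
    show "(\<lambda>(x, y). F (process_path L x, process_path W y)) \<in> borel_measurable (M \<Otimes>\<^sub>M M)"
      by (simp add: case_prod_unfold)
  qed
  have measG: "(\<lambda>\<omega>. LINT g|std_gauss. \<phi> (\<chi> i. m $ i + sg i * (sqrt (riemann_conv (2 * lam i) s t n (\<lambda>r. round_up n (Lr r \<omega>))) * g i))) \<in> borel_measurable M"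
  proof (rule sigma_finite_measure.borel_measurable_lebesgue_integral)
    show "sigma_finite_measure (std_gauss :: ('n \<Rightarrow> real) measure)"
      using prob_space_std_gauss by (rule prob_space_imp_sigma_finite)
    show "(\<lambda>(\<omega>, g). \<phi> (\<chi> i. m $ i + sg i * (sqrt (riemann_conv (2 * lam i) s t n (\<lambda>r. round_up n (Lr r \<omega>))) * g i)))
        \<in> borel_measurable (M \<Otimes>\<^sub>M std_gauss)"
      by (rule measurable_gauss_mixture[OF _ \<phi>(1)]) (simp only: riemann_conv_def, measurable)
  qed
  have "(LINT \<omega>|M. F (process_path L \<omega>, process_path W \<omega>)) =
     (LINT \<omega>|M. LINT \<omega>'|M. F (process_path L \<omega>, process_path W \<omega>'))"
    by (rule expectation_paths[OF F Fb])
  also have "\<dots> = (LINT \<omega>|M. LINT g|std_gauss. \<phi> (\<chi> i. m $ i + sg i * (sqrt (riemann_conv (2 * lam i) s t n (\<lambda>r. round_up n (Lr r \<omega>))) * g i)))"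
  proof (rule integral_cong_AE[OF meas measG])
    show "AE \<omega> in M. (LINT \<omega>'|M. F (process_path L \<omega>, process_path W \<omega>')) =
      (LINT g|std_gauss. \<phi> (\<chi> i. m $ i + sg i * (sqrt (riemann_conv (2 * lam i) s t n (\<lambda>r. round_up n (Lr r \<omega>))) * g i)))"
      using AE_Lr by eventually_elim (simp only: path inner)
  qed
  finally show "(LINT \<omega>|M. \<phi> (\<chi> i. m $ i + sg i * riemann_conv (lam i) s t n (\<lambda>r. W (round_up n (L r \<omega>)) \<omega> $ i))) =
     (LINT \<omega>|M. LINT g|std_gauss. \<phi> (\<chi> i. m $ i + sg i * (sqrt (riemann_conv (2 * lam i) s t n (\<lambda>r. round_up n (Lr r \<omega>))) * g i)))"
    unfolding path .
qed

text \<open>The unrounded version yields measurability of the limit in \<omega>; the rounded one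
  identifies the limit variance. The bound \<open>Lr t \<omega> + 1\<close> allows for the rounding
  error, at most 1.\<close>

lemma riemann_conv_Lr_tendsto:
  assumes st: "0 \<le> s" "s < t"
  shows "(\<lambda>n. riemann_conv l s t n (\<lambda>r. Lr r \<omega>)) \<longlonglongrightarrow> exp_conv l s t (\<lambda>r. Lr r \<omega>)"
    "(\<lambda>n. riemann_conv l s t n (\<lambda>r. round_up n (Lr r \<omega>))) \<longlonglongrightarrow> exp_conv l s t (\<lambda>r. Lr r \<omega>)"
proof -
  have rc: "(\<lambda>n. Lr (grid_up s t n r) \<omega>) \<longlonglongrightarrow> Lr r \<omega>" if "s < r" "r < t" for r
    by (rule right_continuous_tendsto_grid_up[where p="\<lambda>r. Lr r \<omega>"]) (use st that Lr_right_continuous in auto)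
  show "(\<lambda>n. riemann_conv l s t n (\<lambda>r. Lr r \<omega>)) \<longlonglongrightarrow> exp_conv l s t (\<lambda>r. Lr r \<omega>)"
    by (rule riemann_conv_tendsto[where c="Lr t \<omega>" and q="\<lambda>n r. Lr r \<omega>"])
      (use st rc monoD[OF mono_Lr] in auto)
  show "(\<lambda>n. riemann_conv l s t n (\<lambda>r. round_up n (Lr r \<omega>))) \<longlonglongrightarrow> exp_conv l s t (\<lambda>r. Lr r \<omega>)"
  proof (rule riemann_conv_tendsto[where c="Lr t \<omega> + 1" and q="\<lambda>n r. round_up n (Lr r \<omega>)"])
    fix n r assume "s \<le> r" "r \<le> t"
    then have "Lr r \<omega> \<le> Lr t \<omega>" by (intro monoD[OF mono_Lr])
    moreover have "round_up n (Lr r \<omega>) \<le> Lr r \<omega> + 1 / real (Suc n)" by (rule round_up_bounds) simp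
    moreover have "1 / real (Suc n) \<le> 1" by simp
    ultimately have "round_up n (Lr r \<omega>) \<le> Lr t \<omega> + 1" by linarith
    then show "\<bar>round_up n (Lr r \<omega>)\<bar> \<le> Lr t \<omega> + 1" by simp
  qed (use st rc in \<open>auto intro!: tendsto_round_up\<close>)
qed

lemma measurable_exp_conv_Lr:
  assumes "0 \<le> s" "s < t"
  shows "(\<lambda>\<omega>. exp_conv l s t (\<lambda>r. Lr r \<omega>)) \<in> borel_measurable M"
  by (rule borel_measurable_LIMSEQ_real[OF riemann_conv_Lr_tendsto(1)[OF assms]])
    (simp only: riemann_conv_def, measurable)

text \<open>The rounded clock stays in the compact interval up to \<open>Lr t \<omega> + 1\<close>,
  on which the continuous path of \<open>W\<close> is bounded; convergence combines right-continuity
  of the clock with continuity of \<open>W\<close>.\<close>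

lemma riemann_conv_W_tendsto:
  assumes st: "0 \<le> s" "s < t" and cont: "continuous_on {0..} (\<lambda>t. W t \<omega> $ i)"
    and \<omega>: "\<forall>r\<ge>0. Lr r \<omega> = L r \<omega>"
  shows "(\<lambda>n. riemann_conv l s t n (\<lambda>r. W (round_up n (L r \<omega>)) \<omega> $ i)) \<longlonglongrightarrow> exp_conv l s t (\<lambda>r. W (L r \<omega>) \<omega> $ i)"
proof -
  let ?w = "\<lambda>t. W t \<omega> $ i"
  have "compact (?w ` {0..Lr t \<omega> + 1})"
    by (intro compact_continuous_image continuous_on_subset[OF cont]) auto
  then obtain c where "\<forall>y\<in>?w ` {0..Lr t \<omega> + 1}. norm y \<le> c"
    using compact_imp_bounded bounded_iff by blast
  then have c: "\<bar>?w x\<bar> \<le> c" if "0 \<le> x" "x \<le> Lr t \<omega> + 1" for x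
    using that by auto
  have lim: "(\<lambda>n. ?w (x n)) \<longlonglongrightarrow> ?w a" if "x \<longlonglongrightarrow> a" "\<And>n. 0 \<le> x n" "0 \<le> a" for x a
    by (rule continuous_on_tendsto_compose[OF cont that(1)]) (use that in auto)
  have rc: "(\<lambda>n. Lr (grid_up s t n r) \<omega>) \<longlonglongrightarrow> Lr r \<omega>" if "s < r" "r < t" for r
    by (rule right_continuous_tendsto_grid_up[where p="\<lambda>r. Lr r \<omega>"]) (use st that Lr_right_continuous in auto)
  have "(\<lambda>n. riemann_conv l s t n (\<lambda>r. ?w (round_up n (Lr r \<omega>)))) \<longlonglongrightarrow> exp_conv l s t (\<lambda>r. ?w (Lr r \<omega>))"
  proof (rule riemann_conv_tendsto[where c=c and q="\<lambda>n r. ?w (round_up n (Lr r \<omega>))"])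
    fix n r assume "s \<le> r" "r \<le> t"
    then have "Lr r \<omega> \<le> Lr t \<omega>" by (intro monoD[OF mono_Lr])
    moreover have "round_up n (Lr r \<omega>) \<le> Lr r \<omega> + 1 / real (Suc n)" by (rule round_up_bounds) simp
    moreover have "1 / real (Suc n) \<le> 1" by simp
    ultimately have "round_up n (Lr r \<omega>) \<le> Lr t \<omega> + 1" by linarith
    then show "\<bar>?w (round_up n (Lr r \<omega>))\<bar> \<le> c" by (intro c) auto
  qed (use st rc in \<open>auto intro!: lim tendsto_round_up\<close>)
  also have "(\<lambda>n. riemann_conv l s t n (\<lambda>r. ?w (round_up n (Lr r \<omega>)))) = (\<lambda>n. riemann_conv l s t n (\<lambda>r. ?w (round_up n (L r \<omega>))))"
    by (intro ext riemann_conv_cong) (use st \<omega> in auto)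
  also have "exp_conv l s t (\<lambda>r. ?w (Lr r \<omega>)) = exp_conv l s t (\<lambda>r. ?w (L r \<omega>))"
    by (rule exp_conv_cong) (use st \<omega> in auto)
  finally show ?thesis .
qed

text \<open>Passage to the limit on both sides by dominated convergence: continuity of
  \<open>\<phi>\<close> turns convergence of paths into convergence of values, and the standard
  Gaussian form tolerates vanishing variances.\<close>

lemma noise_law_continuous:
  fixes m :: "real^'n" and \<phi> :: "real^'n \<Rightarrow> real"
  assumes \<phi>: "continuous_on UNIV \<phi>" "bounded (range \<phi>)" and st: "0 \<le> s" "s < t"
    and Z: "Z \<in> borel_measurable M"
    and eq: "AE \<omega> in M. \<forall>i. Z \<omega> $ i = m $ i + sg i * exp_conv (lam i) s t (\<lambda>r. W (L r \<omega>) \<omega> $ i)"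
  shows "(LINT \<omega>|M. \<phi> (Z \<omega>)) =
     (LINT \<omega>|M. LINT g|std_gauss. \<phi> (\<chi> i. m $ i + sg i * (sqrt (exp_conv (2 * lam i) s t (\<lambda>r. Lr r \<omega>)) * g i)))"
proof -
  have \<phi>m: "\<phi> \<in> borel_measurable borel" by (rule borel_measurable_continuous_onI[OF \<phi>(1)])
  obtain c where c: "\<And>x. \<bar>\<phi> x\<bar> \<le> c" using \<phi>(2) by (auto simp: bounded_iff)
  interpret G: prob_space "std_gauss :: ('n \<Rightarrow> real) measure" by (rule prob_space_std_gauss)
  let ?X = "\<lambda>n \<omega>. \<phi> (\<chi> i. m $ i + sg i * riemann_conv (lam i) s t n (\<lambda>r. W (round_up n (L r \<omega>)) \<omega> $ i))"
  let ?V = "\<lambda>n i \<omega>. riemann_conv (2 * lam i) s t n (\<lambda>r. round_up n (Lr r \<omega>))"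
  let ?V' = "\<lambda>i \<omega>. exp_conv (2 * lam i) s t (\<lambda>r. Lr r \<omega>)"
  let ?f = "\<lambda>v g. \<phi> (\<chi> i. m $ i + sg i * (sqrt (v i) * g i))"
  have lim\<phi>: "(\<lambda>n. \<phi> (x n)) \<longlonglongrightarrow> \<phi> y" if "x \<longlonglongrightarrow> y" for x y
    by (rule continuous_on_tendsto_compose[OF \<phi>(1) that]) auto
  have cont: "AE \<omega> in M. \<forall>i. continuous_on {0..} (\<lambda>t. W t \<omega> $ i)"
  proof -
    have "AE \<omega> in M. \<forall>i\<in>UNIV. continuous_on {0..} (\<lambda>t. W t \<omega> $ i)"
      by (rule AE_finite_allI)
        (use W in \<open>simp_all add: standard_brownian_motion_def standard_brownian_motion1_def\<close>)
    then show ?thesis by simp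
  qed
  have "(\<lambda>n. LINT \<omega>|M. ?X n \<omega>) \<longlonglongrightarrow> (LINT \<omega>|M. \<phi> (Z \<omega>))"
  proof (rule integral_dominated_convergence[where w="\<lambda>_. c"])
    show "?X n \<in> borel_measurable M" for n by (rule noise_law_riemann(1)[OF \<phi>m c st])
    show "AE \<omega> in M. (\<lambda>n. ?X n \<omega>) \<longlonglongrightarrow> \<phi> (Z \<omega>)"
      using cont AE_Lr eq
    proof eventually_elim
      case (elim \<omega>)
      have "(\<lambda>n. \<chi> i. m $ i + sg i * riemann_conv (lam i) s t n (\<lambda>r. W (round_up n (L r \<omega>)) \<omega> $ i)) \<longlonglongrightarrow> Z \<omega>"
      proof (rule vec_tendstoI)
        fix i
        have "(\<lambda>n. m $ i + sg i * riemann_conv (lam i) s t n (\<lambda>r. W (round_up n (L r \<omega>)) \<omega> $ i)) \<longlonglongrightarrow>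
          m $ i + sg i * exp_conv (lam i) s t (\<lambda>r. W (L r \<omega>) \<omega> $ i)"
          by (intro tendsto_intros riemann_conv_W_tendsto st) (use elim in auto)
        then show "(\<lambda>n. (\<chi> i. m $ i + sg i * riemann_conv (lam i) s t n (\<lambda>r. W (round_up n (L r \<omega>)) \<omega> $ i)) $ i) \<longlonglongrightarrow> Z \<omega> $ i"
          using elim(3) by simp
      qed
      then show ?case by (rule lim\<phi>)
    qed
  qed (use Z \<phi>m c in auto)
  moreover have "(\<lambda>n. LINT \<omega>|M. LINT g|std_gauss. ?f (\<lambda>i. ?V n i \<omega>) g) \<longlonglongrightarrow> (LINT \<omega>|M. LINT g|std_gauss. ?f (\<lambda>i. ?V' i \<omega>) g)"
  proof (rule integral_dominated_convergence[where w="\<lambda>_. c"])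
    have meas: "(\<lambda>\<omega>. LINT g|std_gauss. ?f (\<lambda>i. U i \<omega>) g) \<in> borel_measurable M"
      if "\<And>i. U i \<in> borel_measurable M" for U :: "'n \<Rightarrow> 'w \<Rightarrow> real"
      by (rule G.borel_measurable_lebesgue_integral) (rule measurable_gauss_mixture[OF that \<phi>m])
    show "(\<lambda>\<omega>. LINT g|std_gauss. ?f (\<lambda>i. ?V n i \<omega>) g) \<in> borel_measurable M" for n
      by (rule meas) (simp only: riemann_conv_def, measurable)
    show "(\<lambda>\<omega>. LINT g|std_gauss. ?f (\<lambda>i. ?V' i \<omega>) g) \<in> borel_measurable M"
      by (rule meas) (rule measurable_exp_conv_Lr[OF st])
    have gm: "?f v \<in> borel_measurable std_gauss" for v
      using measurable_compose[OF measurable_vec_borel \<phi>m, of "\<lambda>i g. m $ i + sg i * (sqrt (v i) * g i)" std_gauss] by simp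
    show "AE \<omega> in M. (\<lambda>n. LINT g|std_gauss. ?f (\<lambda>i. ?V n i \<omega>) g) \<longlonglongrightarrow> (LINT g|std_gauss. ?f (\<lambda>i. ?V' i \<omega>) g)"
    proof (intro always_eventually allI)
      fix \<omega>
      show "(\<lambda>n. LINT g|std_gauss. ?f (\<lambda>i. ?V n i \<omega>) g) \<longlonglongrightarrow> (LINT g|std_gauss. ?f (\<lambda>i. ?V' i \<omega>) g)"
      proof (rule integral_dominated_convergence[where w="\<lambda>_. c"])
        show "AE g in std_gauss. (\<lambda>n. ?f (\<lambda>i. ?V n i \<omega>) g) \<longlonglongrightarrow> ?f (\<lambda>i. ?V' i \<omega>) g"
          by (intro always_eventually allI lim\<phi> vec_tendstoI)
            (simp only: vec_lambda_beta, intro tendsto_intros riemann_conv_Lr_tendsto st)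
      qed (use gm c in auto)
    qed
    show "AE \<omega> in M. norm (LINT g|std_gauss. ?f (\<lambda>i. ?V n i \<omega>) g) \<le> c" for n
    proof (intro always_eventually allI)
      fix \<omega>
      have "norm (LINT g|std_gauss. ?f (\<lambda>i. ?V n i \<omega>) g) \<le> (LINT g|std_gauss. norm (?f (\<lambda>i. ?V n i \<omega>) g))"
        by (rule integral_norm_bound)
      also have "\<dots> \<le> (LINT g|(std_gauss :: ('n \<Rightarrow> real) measure). c)"
        by (intro integral_mono integrable_norm G.integrable_const_bound[where B=c])
          (use gm c order_trans[OF abs_ge_zero c] in \<open>auto simp: G.prob_space\<close>)
      finally have "norm (LINT g|std_gauss. ?f (\<lambda>i. ?V n i \<omega>) g) \<le> (LINT g|(std_gauss :: ('n \<Rightarrow> real) measure). c)" .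
      then show "norm (LINT g|std_gauss. ?f (\<lambda>i. ?V n i \<omega>) g) \<le> c" by (simp add: G.prob_space)
    qed
  qed simp
  moreover have "(LINT \<omega>|M. ?X n \<omega>) = (LINT \<omega>|M. LINT g|std_gauss. ?f (\<lambda>i. ?V n i \<omega>) g)" for n
    by (rule noise_law_riemann(2)[OF \<phi>m c st])
  ultimately show ?thesis by (simp only: LIMSEQ_unique)
qed

text \<open>Both sides integrate \<open>\<phi>\<close> against Borel probability measures, the law
  of \<open>Z\<close> and a Gaussian mixture. They agree on bounded continuous functions, hence
  coincide, and Borel functions follow.\<close>

lemma noise_law:
  fixes m :: "real^'n"
  assumes \<phi>: "bounded_borel \<phi>" and st: "0 \<le> s" "s < t"
    and Z: "Z \<in> borel_measurable M"
    and eq: "AE \<omega> in M. \<forall>i. Z \<omega> $ i = m $ i + sg i * exp_conv (lam i) s t (\<lambda>r. W (L r \<omega>) \<omega> $ i)"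
  shows "(LINT \<omega>|M. \<phi> (Z \<omega>)) =
     (LINT \<omega>|M. LINT g|std_gauss. \<phi> (\<chi> i. m $ i + sg i * (sqrt (exp_conv (2 * lam i) s t (\<lambda>r. Lr r \<omega>)) * g i)))"
proof -
  interpret G: prob_space "std_gauss :: ('n \<Rightarrow> real) measure" by (rule prob_space_std_gauss)
  interpret MG: pair_prob_space M "std_gauss :: ('n \<Rightarrow> real) measure" ..
  let ?h = "\<lambda>p. \<chi> i. m $ i + sg i * (sqrt (exp_conv (2 * lam i) s t (\<lambda>r. Lr r (fst p))) * snd p i)"
  have h: "?h \<in> borel_measurable (M \<Otimes>\<^sub>M std_gauss)"
  proof (rule measurable_vec_borel)
    fix i
    have [measurable]: "(\<lambda>p. exp_conv (2 * lam i) s t (\<lambda>r. Lr r (fst p))) \<in> borel_measurable (M \<Otimes>\<^sub>M (std_gauss :: ('n \<Rightarrow> real) measure))"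
      by (rule measurable_compose[OF measurable_fst measurable_exp_conv_Lr[OF st]])
    show "(\<lambda>p. m $ i + sg i * (sqrt (exp_conv (2 * lam i) s t (\<lambda>r. Lr r (fst p))) * snd p i)) \<in> borel_measurable (M \<Otimes>\<^sub>M (std_gauss :: ('n \<Rightarrow> real) measure))"
      by measurable
  qed
  have fub: "(LINT p|(M \<Otimes>\<^sub>M std_gauss). \<psi> (?h p)) = (LINT \<omega>|M. LINT g|std_gauss. \<psi> (?h (\<omega>, g)))"
    if "\<psi> \<in> borel_measurable borel" "\<And>x. \<bar>\<psi> x\<bar> \<le> c" for \<psi> :: "real^'n \<Rightarrow> real" and c
    by (rule MG.integral_fst'[symmetric])
      (rule MG.P.integrable_const_bound[where B=c], use that measurable_compose[OF h that(1)] in auto)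
  have d: "distr M borel Z = distr (M \<Otimes>\<^sub>M std_gauss) borel ?h"
  proof (rule finite_measure_eqI_continuous)
    show "finite_measure (distr M borel Z)" "finite_measure (distr (M \<Otimes>\<^sub>M std_gauss) borel ?h)"
      using prob_space_distr[OF Z] MG.P.prob_space_distr[OF h] by (auto intro: prob_space.axioms(1))
    fix \<psi> :: "real^'n \<Rightarrow> real" assume \<psi>: "continuous_on UNIV \<psi>" "bounded (range \<psi>)"
    then have \<psi>m: "\<psi> \<in> borel_measurable borel" by (intro borel_measurable_continuous_onI)
    obtain c where c: "\<And>x. \<bar>\<psi> x\<bar> \<le> c" using \<psi>(2) by (auto simp: bounded_iff)
    show "(LINT x|distr M borel Z. \<psi> x) = (LINT x|distr (M \<Otimes>\<^sub>M std_gauss) borel ?h. \<psi> x)"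
      unfolding integral_distr[OF Z \<psi>m] integral_distr[OF h \<psi>m] fub[OF \<psi>m c]
      using noise_law_continuous[OF \<psi> st Z eq] by simp
  qed simp_all
  obtain c where c: "\<And>x. \<bar>\<phi> x\<bar> \<le> c" and \<phi>m: "\<phi> \<in> borel_measurable borel"
    using \<phi> by (rule bounded_borelE) blast
  have "(LINT \<omega>|M. \<phi> (Z \<omega>)) = (LINT x|distr M borel Z. \<phi> x)"
    by (rule integral_distr[OF Z \<phi>m, symmetric])
  also have "\<dots> = (LINT \<omega>|M. LINT g|std_gauss. \<phi> (?h (\<omega>, g)))"
    unfolding d integral_distr[OF h \<phi>m] by (rule fub[OF \<phi>m c])
  finally show ?thesis by simp
qed

end

section \<open>The stable subordinator\<close>

lemma power4_le_exp:
  assumes "0 \<le> (y::real)" shows "y ^ 4 / 256 \<le> exp y"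
proof -
  have "y / 4 \<le> exp (y / 4)" using exp_ge_add_one_self[of "y / 4"] by linarith
  then have "(y / 4) ^ 4 \<le> exp (y / 4) ^ 4" using assms by (intro power_mono) auto
  also have "\<dots> = exp y" by (simp add: exp_of_nat_mult[symmetric])
  finally show ?thesis by (simp add: power_divide)
qed

text \<open>Since \<alpha> is at least 1/2, \<open>(\<bar>v\<bar> powr \<alpha>) ^ 4\<close>
  dominates \<open>v\<^sup>2\<close> outside the unit interval, so the fourth-power bound on the
  exponential reaches the Cauchy profile. The 2 covers the unit interval; 512 is twice the 256 of
  \<open>power4_le_exp\<close>.\<close>

lemma stretched_exp_le:
  fixes v :: real
  assumes c: "0 < c" and \<alpha>: "1/2 \<le> \<alpha>"
  shows "exp (- (c * \<bar>v\<bar> powr \<alpha>)) \<le> (2 + 512 / c ^ 4) * inverse (1 + v\<^sup>2)"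
proof -
  let ?e = "exp (- (c * \<bar>v\<bar> powr \<alpha>))"
  have "?e * (1 + v\<^sup>2) \<le> 2 + 512 / c ^ 4"
  proof (cases "\<bar>v\<bar> \<le> 1")
    case True
    then have "v\<^sup>2 \<le> 1" by (simp add: abs_square_le_1)
    moreover have "?e \<le> 1" using c by simp
    ultimately have "?e * (1 + v\<^sup>2) \<le> 1 * 2" by (intro mult_mono) auto
    also have "\<dots> \<le> 2 + 512 / c ^ 4" using c by simp
    finally show ?thesis .
  next
    case False
    then have v: "1 < \<bar>v\<bar>" by simp
    have "(c * \<bar>v\<bar> powr \<alpha>) ^ 4 / 256 \<le> exp (c * \<bar>v\<bar> powr \<alpha>)"
      by (rule power4_le_exp) (use c in simp)
    moreover have "v\<^sup>2 \<le> (\<bar>v\<bar> powr \<alpha>) ^ 4"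
    proof -
      have "v\<^sup>2 = \<bar>v\<bar> powr 2" using v by (simp add: powr_numeral)
      also have "\<dots> \<le> \<bar>v\<bar> powr (\<alpha> * 4)" using v \<alpha> by (intro powr_mono) auto
      also have "\<dots> = (\<bar>v\<bar> powr \<alpha>) ^ 4" using v by (simp add: powr_powr[symmetric] powr_numeral)
      finally show ?thesis .
    qed
    then have "c ^ 4 * v\<^sup>2 / 256 \<le> (c * \<bar>v\<bar> powr \<alpha>) ^ 4 / 256"
      using c by (simp add: power_mult_distrib)
    ultimately have le: "c ^ 4 * v\<^sup>2 / 256 \<le> exp (c * \<bar>v\<bar> powr \<alpha>)" by linarith
    have "1 + v\<^sup>2 \<le> 2 * v\<^sup>2" using v by (simp add: abs_square_less_1[symmetric] not_less power2_eq_square) (metis abs_le_square_iff abs_one less_imp_le one_power2 power2_eq_square)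
    also have "\<dots> = 512 / c ^ 4 * (c ^ 4 * v\<^sup>2 / 256)" using c by simp
    also have "\<dots> \<le> 512 / c ^ 4 * exp (c * \<bar>v\<bar> powr \<alpha>)"
      by (intro mult_left_mono le) (use c in auto)
    finally have "?e * (1 + v\<^sup>2) \<le> ?e * (512 / c ^ 4 * exp (c * \<bar>v\<bar> powr \<alpha>))"
      by (intro mult_left_mono) auto
    also have "\<dots> = 512 / c ^ 4" by (simp add: exp_minus)
    finally show ?thesis by simp
  qed
  moreover have "0 < 1 + v\<^sup>2" by (simp add: add_pos_nonneg)
  ultimately show ?thesis by (simp add: field_simps)
qed

lemma integrable_stretched_exp:
  assumes c: "0 < c" and \<alpha>: "1/2 \<le> \<alpha>"
  shows "integrable lborel (\<lambda>v::real. exp (- (c * \<bar>v\<bar> powr \<alpha>)))"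
proof (rule Bochner_Integration.integrable_bound)
  have "integrable lborel (\<lambda>v::real. inverse (1 + v\<^sup>2))"
    using integrable_inverse_1_plus_square by (simp add: set_integrable_def)
  then show "integrable lborel (\<lambda>v::real. (2 + 512 / c ^ 4) * inverse (1 + v\<^sup>2))"
    by (rule integrable_mult_right)
  show "AE v in lborel. norm (exp (- (c * \<bar>v\<bar> powr \<alpha>))) \<le> norm ((2 + 512 / c ^ 4) * inverse (1 + v\<^sup>2))"
    using order_trans[OF stretched_exp_le[OF assms] abs_ge_self] by simp
qed measurable

text \<open>Averaging the characteristic function against a Gaussian of width \<open>1/\<epsilon>\<close> bounds the mass
  of \<open>[-\<epsilon>, \<epsilon>]\<close>.\<close>

lemma (in real_distribution) small_ball_probability:
  assumes char: "\<And>u. cmod (char M u) \<le> exp (- (c * \<bar>u\<bar> powr \<alpha>))"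
    and c: "0 < c" and \<alpha>: "1/2 \<le> \<alpha>" and \<epsilon>: "0 < \<epsilon>"
  shows "measure M {-\<epsilon>..\<epsilon>} \<le> exp (1/2) * (LINT v|lborel. exp (- (c * \<bar>v\<bar> powr \<alpha>))) * \<epsilon>"
proof -
  let ?N = "std_normal_distribution"
  let ?I = "LINT v|lborel. exp (- (c * \<bar>v\<bar> powr \<alpha>))"
  interpret N: real_distribution ?N by (rule real_dist_normal_dist)
  interpret MN: pair_prob_space M ?N ..
  \<comment> \<open>\<open>?e\<close> is the characteristic function of the standard normal law at
    \<open>x / \<epsilon>\<close>; Fubini moves the average onto \<open>char M\<close>.\<close>
  let ?e = "\<lambda>x. exp (- ((x / \<epsilon>)\<^sup>2) / 2)"
  have int: "integrable (M \<Otimes>\<^sub>M ?N) (\<lambda>(x, u). iexp (u / \<epsilon> * x))"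
    by (rule MN.P.integrable_const_bound[where B=1]) auto
  have "complex_of_real (LINT x|M. ?e x) = (CLINT x|M. char ?N (x / \<epsilon>))"
    by (simp add: char_std_normal_distribution integral_complex_of_real)
  also have "\<dots> = (CLINT x|M. CLINT u|?N. iexp (u / \<epsilon> * x))"
    unfolding char_def by (simp add: mult.commute)
  also have "\<dots> = (CLINT u|?N. CLINT x|M. iexp (u / \<epsilon> * x))"
    by (rule MN.Fubini_integral[OF int, symmetric])
  also have "\<dots> = (CLINT u|?N. char M (u / \<epsilon>))"
    unfolding char_def ..
  finally have eq: "complex_of_real (LINT x|M. ?e x) = (CLINT u|?N. char M (u / \<epsilon>))" .
  have charm: "(\<lambda>u. char M (u / \<epsilon>)) \<in> borel_measurable borel"
    by (intro borel_measurable_continuous_onI continuous_at_imp_continuous_on ballI)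
      (auto intro!: isCont_o2[OF _ isCont_char] continuous_intros simp: \<epsilon>[THEN less_imp_neq, symmetric])
  have sint: "integrable lborel (\<lambda>u. exp (- (c * \<bar>u / \<epsilon>\<bar> powr \<alpha>)))"
    using lborel_integrable_real_affine[OF integrable_stretched_exp[OF c \<alpha>], of "1 / \<epsilon>" 0] \<epsilon> by simp
  \<comment> \<open>The substitution \<open>v = u / \<epsilon>\<close> produces the factor
    \<epsilon> of the final bound.\<close>
  have sval: "(LINT u|lborel. exp (- (c * \<bar>u / \<epsilon>\<bar> powr \<alpha>))) = \<epsilon> * ?I"
    using lborel_integral_real_affine[of "1 / \<epsilon>" "\<lambda>v. exp (- (c * \<bar>v\<bar> powr \<alpha>))" 0] \<epsilon> by simp
  have nle: "std_normal_density u \<le> 1" for u :: real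
  proof -
    have "1 \<le> sqrt (2 * pi)" using pi_gt3 by simp
    then have "1 / sqrt (2 * pi) \<le> 1" by simp
    moreover have "exp (- u\<^sup>2 / 2) \<le> 1" by simp
    ultimately have "1 / sqrt (2 * pi) * exp (- u\<^sup>2 / 2) \<le> 1 * 1" by (intro mult_mono) auto
    then show ?thesis by (simp add: std_normal_density_def)
  qed
  have "(LINT x|M. ?e x) = cmod (CLINT u|?N. char M (u / \<epsilon>))"
    unfolding eq[symmetric] norm_of_real by (simp add: integral_nonneg)
  also have "\<dots> \<le> (LINT u|?N. cmod (char M (u / \<epsilon>)))"
    by (rule integral_norm_bound)
  also have "\<dots> = (LINT u|lborel. std_normal_density u * cmod (char M (u / \<epsilon>)))"
    using charm by (subst integral_density) auto
  also have "\<dots> \<le> (LINT u|lborel. exp (- (c * \<bar>u / \<epsilon>\<bar> powr \<alpha>)))"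
  proof (rule integral_mono[OF _ sint])
    have le: "std_normal_density u * cmod (char M (u / \<epsilon>)) \<le> exp (- (c * \<bar>u / \<epsilon>\<bar> powr \<alpha>))" for u
      using mult_mono[OF nle[of u] char[of "u / \<epsilon>"]] by simp
    then show "std_normal_density u * cmod (char M (u / \<epsilon>)) \<le> exp (- (c * \<bar>u / \<epsilon>\<bar> powr \<alpha>))" for u .
    show "integrable lborel (\<lambda>u. std_normal_density u * cmod (char M (u / \<epsilon>)))"
      by (rule Bochner_Integration.integrable_bound[OF sint]) (use le charm in auto)
  qed
  finally have up: "(LINT x|M. ?e x) \<le> \<epsilon> * ?I" by (simp only: sval)
  \<comment> \<open>On the interval, \<open>?e\<close> is at least \<open>exp (- 1 / 2)\<close>, its
    value at the end points.\<close>
  have "exp (- 1 / 2) * measure M {-\<epsilon>..\<epsilon>} = (LINT x|M. exp (- 1 / 2) * indicator {-\<epsilon>..\<epsilon>} x)"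
    by simp
  also have "\<dots> \<le> (LINT x|M. ?e x)"
  proof (rule integral_mono)
    show "integrable M ?e"
      by (rule integrable_const_bound[where B=1]) auto
    show "exp (- 1 / 2) * indicator {-\<epsilon>..\<epsilon>} x \<le> ?e x" for x
    proof (cases "x \<in> {-\<epsilon>..\<epsilon>}")
      case True
      then have "\<bar>x / \<epsilon>\<bar> \<le> 1" using \<epsilon> by (simp add: abs_le_iff field_simps)
      then have "(x / \<epsilon>)\<^sup>2 \<le> 1" by (simp add: abs_square_le_1)
      then show ?thesis using True by simp
    qed simp
    show "integrable M (\<lambda>x. exp (- 1 / 2) * indicator {-\<epsilon>..\<epsilon>} x :: real)"
      by (rule integrable_const_bound[where B=1]) (auto split: split_indicator)
  qed
  finally have "exp (- 1 / 2) * measure M {-\<epsilon>..\<epsilon>} \<le> \<epsilon> * ?I" using up by linarith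
  then have le: "exp (1 / 2) * (exp (- 1 / 2) * measure M {-\<epsilon>..\<epsilon>}) \<le> exp (1 / 2) * (\<epsilon> * ?I)"
    by (intro mult_left_mono) auto
  have "exp (1 / 2) * (exp (- 1 / 2) * x) = x" for x :: real
    unfolding mult.assoc[symmetric] exp_add[symmetric] by simp
  with le have "measure M {-\<epsilon>..\<epsilon>} \<le> exp (1 / 2) * (\<epsilon> * ?I)" by (simp only:)
  then show ?thesis by (simp only: mult_ac)
qed

text \<open>Layers between consecutive powers of 1/4: on the \<open>k\<close>-th one
  \<open>1 / sqrt (X x)\<close> is at most \<open>2 * 2 ^ k\<close>, while its mass is at most
  \<open>C * (1/4) ^ k\<close>, and the products sum geometrically.\<close>

lemma (in finite_measure) nn_integral_inverse_sqrt_finite: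
  assumes X: "X \<in> borel_measurable M" and pos: "AE x in M. 0 < X x"
    and small: "\<And>\<epsilon>. 0 < \<epsilon> \<Longrightarrow> measure M {x \<in> space M. X x \<le> \<epsilon>} \<le> C * \<epsilon>"
  shows "(\<integral>\<^sup>+x. ennreal (1 / sqrt (X x)) \<partial>M) < \<infinity>"
proof -
  let ?A = "\<lambda>k. {x \<in> space M. X x \<le> (1/4) ^ k}"
  have [measurable]: "?A k \<in> sets M" for k using X by measurable
  have C: "0 \<le> C" using order_trans[OF measure_nonneg small[of 1]] by simp
  have "(\<integral>\<^sup>+x. ennreal (1 / sqrt (X x)) \<partial>M) \<le> (\<integral>\<^sup>+x. 1 + (\<Sum>k. ennreal (2 * 2 ^ k) * indicator (?A k) x) \<partial>M)"
  proof (rule nn_integral_mono_AE)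
    have "AE x in M. x \<in> space M" by simp
    with pos show "AE x in M. ennreal (1 / sqrt (X x)) \<le> 1 + (\<Sum>k. ennreal (2 * 2 ^ k) * indicator (?A k) x)"
    proof eventually_elim
      case (elim x)
      show ?case
      proof (cases "1 < X x")
        case True
        then have "1 / sqrt (X x) \<le> 1" by simp
        then have "ennreal (1 / sqrt (X x)) \<le> ennreal 1" by (rule ennreal_leI)
        then show ?thesis by (simp add: add_increasing2)
      next
        case False
        \<comment> \<open>The least \<open>k\<close> with \<open>?P k\<close> is the layer
          containing \<open>X x\<close>; base 4 is chosen so that square roots are powers of
          1/2.\<close>
        let ?P = "\<lambda>k. (1/4) ^ Suc k < X x"
        have ex: "\<exists>k. ?P k"
        proof -
          obtain k where "(1/4::real) ^ k < X x" using real_arch_pow_inv[OF elim(1), of "1/4"] by auto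
          moreover have "(1/4::real) ^ Suc k \<le> (1/4) ^ k" by simp
          ultimately show ?thesis by (intro exI[of _ k]) linarith
        qed
        define k where "k = (LEAST k. ?P k)"
        have k: "?P k" unfolding k_def by (rule LeastI_ex[OF ex])
        have le: "X x \<le> (1/4) ^ k"
        proof (cases k)
          case 0 then show ?thesis using False by simp
        next
          case (Suc j)
          then have "\<not> ?P j" using not_less_Least[of j ?P] k_def by auto
          then show ?thesis using Suc by simp
        qed
        have le_sqrt: "sqrt ((1/4) ^ Suc k) \<le> sqrt (X x)" using k by simp
        have sqrt_eq: "sqrt ((1/4) ^ Suc k) = (1/2) ^ Suc k"
          by (simp add: real_sqrt_power real_sqrt_divide real_sqrt_four power_one_over flip: power_Suc)
        have "(1/2) ^ Suc k \<le> sqrt (X x)" using le_sqrt unfolding sqrt_eq .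
        then have "1 / sqrt (X x) \<le> 1 / (1/2) ^ Suc k" by (intro divide_left_mono) (use elim in auto)
        then have "1 / sqrt (X x) \<le> 2 * 2 ^ k" by (simp add: power_one_over)
        then have "ennreal (1 / sqrt (X x)) \<le> ennreal (2 * 2 ^ k) * indicator (?A k) x"
          using le elim by (simp add: ennreal_leI)
        also have "\<dots> \<le> (\<Sum>k. ennreal (2 * 2 ^ k) * indicator (?A k) x)"
        proof -
          define f where "f k = ennreal (2 * 2 ^ k) * indicator (?A k) x" for k
          have "sum f {k} \<le> suminf f" by (rule sum_le_suminf) auto
          then have "f k \<le> suminf f" by simp
          then show ?thesis unfolding f_def .
        qed
        finally show ?thesis by (simp add: add_increasing)
      qed
    qed
  qed
  also have "\<dots> = emeasure M (space M) + (\<Sum>k. ennreal (2 * 2 ^ k) * emeasure M (?A k))"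
    by (subst nn_integral_add, simp, simp, subst nn_integral_suminf) (auto simp: nn_integral_cmult)
  also have "(\<Sum>k. ennreal (2 * 2 ^ k) * emeasure M (?A k)) \<le> (\<Sum>k. ennreal (2 * C * (1/2) ^ k))"
  proof (intro suminf_le summableI)
    fix k
    have "2 * 2 ^ k * measure M (?A k) \<le> 2 * 2 ^ k * (C * (1/4) ^ k)"
      by (intro mult_left_mono small) auto
    also have "\<dots> = 2 * C * (1/2) ^ k"
      by (simp add: power_mult_distrib[symmetric] flip: power_mult_distrib)
    finally show "ennreal (2 * 2 ^ k) * emeasure M (?A k) \<le> ennreal (2 * C * (1/2) ^ k)"
      by (simp add: emeasure_eq_measure ennreal_mult[symmetric] ennreal_leI)
  qed
  also have "(\<Sum>k. ennreal (2 * C * (1/2) ^ k)) = ennreal (\<Sum>k. 2 * C * (1/2) ^ k)"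
    by (rule suminf_ennreal2) (use C in \<open>auto intro!: summable_mult summable_geometric\<close>)
  finally have "(\<integral>\<^sup>+x. ennreal (1 / sqrt (X x)) \<partial>M) \<le> emeasure M (space M) + ennreal (\<Sum>k. 2 * C * (1/2) ^ k)"
    by (simp add: add_left_mono)
  then show ?thesis
    by (rule le_less_trans)
      (simp only: infinity_ennreal_def ennreal_add_less_top emeasure_eq_measure ennreal_less_top simp_thms)
qed

text \<open>Monotonicity makes a single sequence from the left decide the left limit, so continuity
  at a point can be tested on countably many increments.\<close>

lemma mono_isCont:
  fixes p :: "real \<Rightarrow> real"
  assumes p: "mono p" and left: "(\<lambda>n. p (s - 1 / real (Suc n))) \<longlonglongrightarrow> p s"
    and right: "(p \<longlongrightarrow> p s) (at_right s)"
  shows "isCont p s"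
proof -
  have "(p \<longlongrightarrow> p s) (at_left s)"
  proof (rule order_tendstoI)
    fix a assume "a < p s"
    from order_tendstoD(1)[OF left this] obtain n where n: "a < p (s - 1 / real (Suc n))"
      by (auto simp: eventually_sequentially)
    have "eventually (\<lambda>r. s - 1 / real (Suc n) < r) (at_left s)"
      by (rule eventually_at_left[THEN iffD2, of "s - 1"]) (auto intro!: exI[of _ "s - 1 / real (Suc n)"])
    then show "eventually (\<lambda>r. a < p r) (at_left s)"
    proof eventually_elim
      case (elim r)
      then have "p (s - 1 / real (Suc n)) \<le> p r" by (intro monoD[OF p]) simp
      with n show ?case by simp
    qed
  next
    fix a assume "p s < a"
    have "eventually (\<lambda>r. r < s) (at_left s)" by (simp add: eventually_at_filter)
    then show "eventually (\<lambda>r. p r < a) (at_left s)"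
    proof eventually_elim
      case (elim r)
      then have "p r \<le> p s" by (intro monoD[OF p]) simp
      with \<open>p s < a\<close> show ?case by simp
    qed
  qed
  with right show ?thesis
    unfolding isCont_def by (simp add: filterlim_at_split)
qed

section \<open>Scaling, positivity and inverse moments of the stable clock\<close>

locale stable_noise = subordinated_noise M W L
  for M :: "'w measure" and W :: "real \<Rightarrow> 'w \<Rightarrow> real^'n::finite" and L :: "real \<Rightarrow> 'w \<Rightarrow> real" +
  fixes \<alpha> \<gamma>bar :: real
  assumes alpha: "1/2 < \<alpha>" "\<alpha> < 1" and gbar: "0 < \<gamma>bar"
    and stable: "stable_subordinator M \<alpha> \<gamma>bar L"
begin

lemma measurable_L1 [measurable]: "L 1 \<in> borel_measurable M"
  by (rule measurable_L) simp

lemma distr_L_scaling: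
  assumes "0 < a"
  shows "distr M borel (L a) = distr M borel (\<lambda>\<omega>. a powr (1 / \<alpha>) * L 1 \<omega>)"
proof -
  let ?P = "time_paths :: (real \<Rightarrow> real) measure"
  have 1: "process_path (\<lambda>t. L (a * t)) \<in> M \<rightarrow>\<^sub>M ?P"
    unfolding process_path_def[abs_def] by (rule measurable_restrict) (use assms in \<open>simp add: measurable_L\<close>)
  have 2: "process_path (\<lambda>t \<omega>. a powr (1 / \<alpha>) * L t \<omega>) \<in> M \<rightarrow>\<^sub>M ?P"
    unfolding process_path_def[abs_def]
    by (rule measurable_restrict) (intro borel_measurable_times borel_measurable_const measurable_L, simp)
  have 3: "(\<lambda>p. p 1) \<in> ?P \<rightarrow>\<^sub>M borel"
    by (rule measurable_component_singleton) simp
  have "distr M ?P (process_path (\<lambda>t. L (a * t))) = distr M ?P (process_path (\<lambda>t \<omega>. a powr (1 / \<alpha>) * L t \<omega>))"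
    using stable assms unfolding stable_subordinator_def strictly_stable_process_def by blast
  from arg_cong[OF this, of "\<lambda>\<mu>. distr \<mu> borel (\<lambda>p. p 1)"]
  show ?thesis
    unfolding distr_distr[OF 3 1] distr_distr[OF 3 2] by (simp add: process_path_def o_def)
qed

lemma distr_L_increment:
  assumes "0 \<le> s" "s < t"
  shows "distr M borel (\<lambda>\<omega>. L t \<omega> - L s \<omega>) = distr M borel (\<lambda>\<omega>. (t - s) powr (1 / \<alpha>) * L 1 \<omega>)"
proof -
  have "\<forall>s\<ge>0. \<forall>t\<ge>0. distr M borel (\<lambda>\<omega>. L (s + t) \<omega> - L s \<omega>) = distr M borel (L t)"
    using L by (simp add: subordinator_def levy_process_def)
  from this[rule_format, of s "t - s"] show ?thesis
    using assms distr_L_scaling[of "t - s"] by simp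
qed

text \<open>Extended nonnegative integrands allow one transfer for indicators, inverse square roots
  and truncated increments, before any integrability is known.\<close>

lemma nn_integral_Lr_increment:
  assumes st: "0 \<le> s" "s < t" and g: "g \<in> borel_measurable borel"
  shows "(\<integral>\<^sup>+\<omega>. g (Lr t \<omega> - Lr s \<omega>) \<partial>M) = (\<integral>\<^sup>+\<omega>. g ((t - s) powr (1 / \<alpha>) * L 1 \<omega>) \<partial>M)"
proof -
  have m: "(\<lambda>\<omega>. L t \<omega> - L s \<omega>) \<in> borel_measurable M"
    by (intro borel_measurable_diff measurable_L) (use st in auto)
  have m': "(\<lambda>\<omega>. (t - s) powr (1 / \<alpha>) * L 1 \<omega>) \<in> borel_measurable M"
    by measurable
  have "(\<integral>\<^sup>+\<omega>. g (Lr t \<omega> - Lr s \<omega>) \<partial>M) = (\<integral>\<^sup>+\<omega>. g (L t \<omega> - L s \<omega>) \<partial>M)"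
  proof (rule nn_integral_cong_AE)
    show "AE \<omega> in M. g (Lr t \<omega> - Lr s \<omega>) = g (L t \<omega> - L s \<omega>)"
      using AE_Lr by eventually_elim (use st in simp)
  qed
  also have "\<dots> = (\<integral>\<^sup>+x. g x \<partial>distr M borel (\<lambda>\<omega>. L t \<omega> - L s \<omega>))"
    using m g by (subst nn_integral_distr) auto
  also have "\<dots> = (\<integral>\<^sup>+\<omega>. g ((t - s) powr (1 / \<alpha>) * L 1 \<omega>) \<partial>M)"
    unfolding distr_L_increment[OF st] using m' g by (subst nn_integral_distr) auto
  finally show ?thesis .
qed

definition small_ball_const :: real where
  "small_ball_const = exp (1/2) * (LINT v|lborel. exp (- (\<gamma>bar powr \<alpha> * \<bar>v\<bar> powr \<alpha>)))"

text \<open>The tangent term contributes a purely imaginary part to the exponent, so the modulus of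
  the characteristic function is a stretched exponential and the general small ball estimate
  applies.\<close>

lemma L1_small_ball:
  assumes "0 < \<epsilon>"
  shows "prob {\<omega> \<in> space M. \<bar>L 1 \<omega>\<bar> \<le> \<epsilon>} \<le> small_ball_const * \<epsilon>"
proof -
  interpret D: real_distribution "distr M borel (L 1)"
    by (rule real_distribution_distr) measurable
  have "cmod (char (distr M borel (L 1)) u) = exp (- (\<gamma>bar powr \<alpha> * \<bar>u\<bar> powr \<alpha>))" for u
  proof -
    have "char (distr M borel (L 1)) u =
        exp (- complex_of_real (\<gamma>bar powr \<alpha> * \<bar>u\<bar> powr \<alpha>) *
               (1 - \<i> * complex_of_real (tan (pi * \<alpha> / 2) * sgn u)))"
      using stable by (simp only: stable_subordinator_def)
    then show ?thesis by (simp add: norm_exp_eq_Re)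
  qed
  then have "measure (distr M borel (L 1)) {-\<epsilon>..\<epsilon>} \<le> small_ball_const * \<epsilon>"
    unfolding small_ball_const_def
    by (intro D.small_ball_probability) (use gbar alpha assms in auto)
  moreover have "measure (distr M borel (L 1)) {-\<epsilon>..\<epsilon>} = prob (L 1 -` {-\<epsilon>..\<epsilon>} \<inter> space M)"
    by (rule measure_distr) auto
  moreover have "L 1 -` {-\<epsilon>..\<epsilon>} \<inter> space M = {\<omega> \<in> space M. \<bar>L 1 \<omega>\<bar> \<le> \<epsilon>}"
    by (auto simp: abs_le_iff)
  ultimately show ?thesis by simp
qed

text \<open>Letting \<epsilon> tend to 0 in the small ball estimate excludes an atom at 0; monotone
  paths starting at 0 give nonnegativity.\<close>

lemma AE_L1_pos: "AE \<omega> in M. 0 < L 1 \<omega>"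
proof -
  have nn: "AE \<omega> in M. 0 \<le> L 1 \<omega>"
    using AE_Lr
  proof eventually_elim
    case (elim \<omega>)
    then have "Lr 1 \<omega> = L 1 \<omega>" by simp
    then show ?case using Lr_nonneg[of 1 \<omega>] by simp
  qed
  let ?Z = "{\<omega> \<in> space M. L 1 \<omega> = 0}"
  have "prob ?Z \<le> small_ball_const / real (Suc n)" for n
  proof -
    have "prob ?Z \<le> prob {\<omega> \<in> space M. \<bar>L 1 \<omega>\<bar> \<le> 1 / real (Suc n)}"
      by (rule finite_measure_mono) auto
    also have "\<dots> \<le> small_ball_const * (1 / real (Suc n))"
      by (rule L1_small_ball) simp
    finally show ?thesis by simp
  qed
  moreover have "(\<lambda>n. small_ball_const / real (Suc n)) \<longlonglongrightarrow> 0"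
    by (rule LIMSEQ_Suc[OF lim_const_over_n])
  ultimately have "prob ?Z \<le> 0"
    by (intro LIMSEQ_le_const) auto
  then have "prob ?Z = 0" by (simp add: measure_le_0_iff)
  then have "AE \<omega> in M. \<omega> \<notin> ?Z"
    by (intro AE_not_in) (simp add: null_sets_def emeasure_eq_measure)
  moreover have "AE \<omega> in M. \<omega> \<in> space M" by simp
  ultimately show ?thesis using nn by eventually_elim auto
qed

definition inv_sqrt_moment :: real where
  "inv_sqrt_moment = enn2real (\<integral>\<^sup>+\<omega>. ennreal (1 / sqrt (L 1 \<omega>)) \<partial>M)"

lemma nn_integral_inv_sqrt_L1: "(\<integral>\<^sup>+\<omega>. ennreal (1 / sqrt (L 1 \<omega>)) \<partial>M) = ennreal inv_sqrt_moment"
proof -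
  have "(\<integral>\<^sup>+\<omega>. ennreal (1 / sqrt (L 1 \<omega>)) \<partial>M) < \<infinity>"
  proof (rule nn_integral_inverse_sqrt_finite[OF measurable_L1 AE_L1_pos])
    fix \<epsilon> :: real assume "0 < \<epsilon>"
    have "prob {\<omega> \<in> space M. L 1 \<omega> \<le> \<epsilon>} = prob {\<omega> \<in> space M. \<bar>L 1 \<omega>\<bar> \<le> \<epsilon>}"
    proof (rule measure_eq_AE)
      show "AE \<omega> in M. (\<omega> \<in> {\<omega> \<in> space M. L 1 \<omega> \<le> \<epsilon>}) = (\<omega> \<in> {\<omega> \<in> space M. \<bar>L 1 \<omega>\<bar> \<le> \<epsilon>})"
        using AE_L1_pos by eventually_elim auto
    qed measurable
    with L1_small_ball[OF \<open>0 < \<epsilon>\<close>]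
    show "prob {\<omega> \<in> space M. L 1 \<omega> \<le> \<epsilon>} \<le> small_ball_const * \<epsilon>" by simp
  qed
  then show ?thesis unfolding inv_sqrt_moment_def by simp
qed

lemma AE_Lr_increment_pos:
  assumes st: "0 \<le> s" "s < t"
  shows "AE \<omega> in M. 0 < Lr t \<omega> - Lr s \<omega>"
proof -
  have "(\<integral>\<^sup>+\<omega>. indicator {..0} (Lr t \<omega> - Lr s \<omega>) \<partial>M) = (\<integral>\<^sup>+\<omega>. indicator {..0} ((t - s) powr (1 / \<alpha>) * L 1 \<omega>) \<partial>M)"
    by (rule nn_integral_Lr_increment[OF st]) simp
  also have "\<dots> = (\<integral>\<^sup>+\<omega>. 0 \<partial>M)"
  proof (rule nn_integral_cong_AE)
    show "AE \<omega> in M. (indicator {..0} ((t - s) powr (1 / \<alpha>) * L 1 \<omega>) :: ennreal) = 0"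
      using AE_L1_pos
    proof eventually_elim
      case (elim \<omega>)
      have "0 < (t - s) powr (1 / \<alpha>)" using st by simp
      then have "0 < (t - s) powr (1 / \<alpha>) * L 1 \<omega>" using elim by (rule mult_pos_pos)
      then show ?case by (simp add: indicator_def)
    qed
  qed
  finally have "(\<integral>\<^sup>+\<omega>. indicator {..0} (Lr t \<omega> - Lr s \<omega>) \<partial>M) = (0 :: ennreal)" by simp
  then have "AE \<omega> in M. (indicator {..0} (Lr t \<omega> - Lr s \<omega>) :: ennreal) = 0"
    by (subst (asm) nn_integral_0_iff_AE) auto
  then show ?thesis by eventually_elim (simp add: indicator_def split: if_splits)
qed

text \<open>Self-similarity scales the increment by \<open>(t - s) powr (1 / \<alpha>)\<close>; the
  inverse square root of this factor is the origin of the exponent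
  \<open>1 / (2 * \<alpha>)\<close>.\<close>

lemma inv_sqrt_Lr_increment:
  assumes st: "0 \<le> s" "s < t"
  shows "integrable M (\<lambda>\<omega>. 1 / sqrt (Lr t \<omega> - Lr s \<omega>))"
    "(LINT \<omega>|M. 1 / sqrt (Lr t \<omega> - Lr s \<omega>)) = inv_sqrt_moment * (t - s) powr (- (1 / (2 * \<alpha>)))"
proof -
  let ?h = "t - s"
  have h: "0 < ?h" using st by simp
  have sc: "1 / sqrt (?h powr (1 / \<alpha>) * x) = ?h powr (- (1 / (2 * \<alpha>))) * (1 / sqrt x)" for x
  proof -
    have "sqrt (?h powr (1 / \<alpha>)) = ?h powr (1 / (2 * \<alpha>))"
      using h by (simp add: powr_half_sqrt[symmetric] powr_powr mult.commute)
    then show ?thesis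
      unfolding real_sqrt_mult powr_minus_divide by (simp only: times_divide_times_eq mult_1_left)
  qed
  have "(\<integral>\<^sup>+\<omega>. ennreal (1 / sqrt (Lr t \<omega> - Lr s \<omega>)) \<partial>M) = (\<integral>\<^sup>+\<omega>. ennreal (1 / sqrt (?h powr (1 / \<alpha>) * L 1 \<omega>)) \<partial>M)"
    by (rule nn_integral_Lr_increment[OF st]) measurable
  also have "\<dots> = (\<integral>\<^sup>+\<omega>. ennreal (?h powr (- (1 / (2 * \<alpha>)))) * ennreal (1 / sqrt (L 1 \<omega>)) \<partial>M)"
    by (intro nn_integral_cong) (simp only: sc, rule ennreal_mult', simp)
  also have "\<dots> = ennreal (?h powr (- (1 / (2 * \<alpha>)))) * ennreal inv_sqrt_moment"
    by (subst nn_integral_cmult) (auto simp: nn_integral_inv_sqrt_L1)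
  also have "\<dots> = ennreal (inv_sqrt_moment * ?h powr (- (1 / (2 * \<alpha>))))"
    by (simp add: inv_sqrt_moment_def ennreal_mult[symmetric] mult.commute)
  finally have nn: "(\<integral>\<^sup>+\<omega>. ennreal (1 / sqrt (Lr t \<omega> - Lr s \<omega>)) \<partial>M) = ennreal (inv_sqrt_moment * ?h powr (- (1 / (2 * \<alpha>))))" .
  have pos: "AE \<omega> in M. 0 \<le> 1 / sqrt (Lr t \<omega> - Lr s \<omega>)"
    using AE_Lr_increment_pos[OF st] by eventually_elim simp
  have "has_bochner_integral M (\<lambda>\<omega>. 1 / sqrt (Lr t \<omega> - Lr s \<omega>)) (inv_sqrt_moment * ?h powr (- (1 / (2 * \<alpha>))))"
    by (rule has_bochner_integral_nn_integral[OF _ pos _ nn]) (auto simp: inv_sqrt_moment_def)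
  then show "integrable M (\<lambda>\<omega>. 1 / sqrt (Lr t \<omega> - Lr s \<omega>))"
    "(LINT \<omega>|M. 1 / sqrt (Lr t \<omega> - Lr s \<omega>)) = inv_sqrt_moment * (t - s) powr (- (1 / (2 * \<alpha>)))"
    by (auto simp: has_bochner_integral_iff)
qed

text \<open>No fixed jumps: the truncated left increments decrease pathwise and their means vanish.\<close>

lemma AE_isCont_Lr:
  assumes s: "0 \<le> s"
  shows "AE \<omega> in M. isCont (\<lambda>t. Lr t \<omega>) s"
proof -
  \<comment> \<open>Truncation at 1 provides a dominating constant without a first moment of
    \<open>L\<close>. Times before 0 are harmless, as \<open>Lr\<close> vanishes there.\<close>
  let ?X = "\<lambda>n \<omega>. min 1 (Lr s \<omega> - Lr (s - 1 / real (Suc n)) \<omega>)"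
  have dec: "decseq (\<lambda>n. ?X n \<omega>)" for \<omega>
  proof (rule decseq_SucI)
    fix n
    have "1 / real (Suc (Suc n)) \<le> 1 / real (Suc n)" by (intro divide_left_mono) auto
    then have "Lr (s - 1 / real (Suc n)) \<omega> \<le> Lr (s - 1 / real (Suc (Suc n))) \<omega>"
      by (intro monoD[OF mono_Lr]) simp
    then show "?X (Suc n) \<omega> \<le> ?X n \<omega>" by (intro min.mono) auto
  qed
  have X0: "0 \<le> ?X n \<omega>" for n \<omega>
    using monoD[OF mono_Lr, of "s - 1 / real (Suc n)" s \<omega>] by simp
  have "convergent (\<lambda>n. ?X n \<omega>)" for \<omega>
    using decseq_convergent[OF dec, of 0 \<omega>] X0 unfolding convergent_def by metis
  then have lim: "(\<lambda>n. ?X n \<omega>) \<longlonglongrightarrow> lim (\<lambda>n. ?X n \<omega>)" for \<omega>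
    by (simp add: convergent_LIMSEQ_iff)
  have Xm: "?X n \<in> borel_measurable M" for n by measurable
  have Ym: "(\<lambda>\<omega>. lim (\<lambda>n. ?X n \<omega>)) \<in> borel_measurable M"
    by (rule borel_measurable_LIMSEQ_real[OF lim Xm])
  have Y0: "0 \<le> lim (\<lambda>n. ?X n \<omega>)" for \<omega>
    by (rule LIMSEQ_le_const[OF lim]) (use X0 in auto)
  have "(\<lambda>n. LINT \<omega>|M. ?X n \<omega>) \<longlonglongrightarrow> (LINT \<omega>|M. lim (\<lambda>n. ?X n \<omega>))"
    by (rule integral_dominated_convergence[where s="?X" and w="\<lambda>_. 1"])
      (use Xm Ym lim X0 in auto)
  moreover have "(\<lambda>n. LINT \<omega>|M. ?X n \<omega>) \<longlonglongrightarrow> 0"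
  \<comment> \<open>At 0 both values of \<open>Lr\<close> vanish; for \<open>s > 0\<close> the law
    of the increment is available once \<open>1 / (n + 1) < s\<close>.\<close>
  proof (cases "s = 0")
    case True
    then have "?X n \<omega> = 0" for n \<omega> by simp
    then show ?thesis by simp
  next
    case False
    let ?Y = "\<lambda>n \<omega>. min 1 ((1 / real (Suc n)) powr (1 / \<alpha>) * max 0 (L 1 \<omega>))"
    have eq: "(LINT \<omega>|M. ?X n \<omega>) = (LINT \<omega>|M. ?Y n \<omega>)" if n: "1 / real (Suc n) < s" for n
    proof -
      have "(\<integral>\<^sup>+\<omega>. ennreal (min 1 (Lr s \<omega> - Lr (s - 1 / real (Suc n)) \<omega>)) \<partial>M) =
        (\<integral>\<^sup>+\<omega>. ennreal (min 1 ((s - (s - 1 / real (Suc n))) powr (1 / \<alpha>) * L 1 \<omega>)) \<partial>M)"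
        by (rule nn_integral_Lr_increment) (use n in auto)
      also have "\<dots> = (\<integral>\<^sup>+\<omega>. ennreal (?Y n \<omega>) \<partial>M)"
      proof (rule nn_integral_cong_AE)
        show "AE \<omega> in M. ennreal (min 1 ((s - (s - 1 / real (Suc n))) powr (1 / \<alpha>) * L 1 \<omega>)) = ennreal (?Y n \<omega>)"
          using AE_L1_pos by eventually_elim simp
      qed
      finally have "(\<integral>\<^sup>+\<omega>. ennreal (?X n \<omega>) \<partial>M) = (\<integral>\<^sup>+\<omega>. ennreal (?Y n \<omega>) \<partial>M)" .
      then show ?thesis
        using X0 by (subst (1 2) integral_eq_nn_integral) auto
    qed
    have "(\<lambda>n. LINT \<omega>|M. ?Y n \<omega>) \<longlonglongrightarrow> (LINT \<omega>|M. 0)"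
    proof (rule integral_dominated_convergence[where w="\<lambda>_. 1"])
      show "AE \<omega> in M. (\<lambda>n. ?Y n \<omega>) \<longlonglongrightarrow> 0"
      proof (intro always_eventually allI)
        fix \<omega>
        have "(\<lambda>n. (1 / real (Suc n)) powr (1 / \<alpha>)) \<longlonglongrightarrow> 0 powr (1 / \<alpha>)"
          by (rule tendsto_powr'[OF LIMSEQ_Suc[OF lim_1_over_n] tendsto_const])
            (use alpha in \<open>auto intro!: always_eventually\<close>)
        then have "(\<lambda>n. (1 / real (Suc n)) powr (1 / \<alpha>)) \<longlonglongrightarrow> 0" by simp
        then have "(\<lambda>n. ?Y n \<omega>) \<longlonglongrightarrow> min 1 (0 * max 0 (L 1 \<omega>))"
          by (intro tendsto_intros)
        then show "(\<lambda>n. ?Y n \<omega>) \<longlonglongrightarrow> 0" by simp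
      qed
    qed auto
    moreover have "eventually (\<lambda>n. 1 / real (Suc n) < s) sequentially"
      using order_tendstoD(2)[OF LIMSEQ_Suc[OF lim_1_over_n], of s] False s by simp
    then have "eventually (\<lambda>n. (LINT \<omega>|M. ?Y n \<omega>) = (LINT \<omega>|M. ?X n \<omega>)) sequentially"
      by eventually_elim (simp only: eq)
    ultimately show ?thesis
      by (simp only: tendsto_cong[symmetric] integral_zero)
  qed
  ultimately have "(LINT \<omega>|M. lim (\<lambda>n. ?X n \<omega>)) = 0" by (rule LIMSEQ_unique)
  moreover have "lim (\<lambda>n. ?X n \<omega>) \<le> 1" for \<omega>
    by (rule LIMSEQ_le_const2[OF lim]) auto
  then have "integrable M (\<lambda>\<omega>. lim (\<lambda>n. ?X n \<omega>))"
    by (intro integrable_const_bound[where B=1]) (use Y0 Ym in auto)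
  ultimately have "AE \<omega> in M. lim (\<lambda>n. ?X n \<omega>) = 0"
    using Y0 by (subst (asm) integral_nonneg_eq_0_iff_AE) auto
  then show ?thesis
  proof eventually_elim
    case (elim \<omega>)
    then have l0: "(\<lambda>n. ?X n \<omega>) \<longlonglongrightarrow> 0" using lim[of \<omega>] by simp
    \<comment> \<open>Below 1 the truncation is inactive, so the left increments themselves tend to
      0.\<close>
    have "eventually (\<lambda>n. ?X n \<omega> < 1) sequentially"
      by (rule order_tendstoD(2)[OF l0]) simp
    then have "eventually (\<lambda>n. ?X n \<omega> = Lr s \<omega> - Lr (s - 1 / real (Suc n)) \<omega>) sequentially"
      by eventually_elim (simp add: min_def split: if_splits)
    from Lim_transform_eventually[OF l0 this]
    have "(\<lambda>n. Lr s \<omega> - (Lr s \<omega> - Lr (s - 1 / real (Suc n)) \<omega>)) \<longlonglongrightarrow> Lr s \<omega> - 0"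
      by (intro tendsto_intros)
    then have "(\<lambda>n. Lr (s - 1 / real (Suc n)) \<omega>) \<longlonglongrightarrow> Lr s \<omega>" by simp
    from mono_isCont[OF mono_Lr this Lr_right_continuous[OF s]] show ?case .
  qed
qed

end

section \<open>Singular Volterra kernels\<close>

text \<open>Affine substitution in the Beta integral on the unit interval: the exponent
  \<open>a + b - 1\<close> collects \<open>a - 1\<close> and \<open>b - 1\<close> from the two
  powers and 1 from the Jacobian.\<close>

lemma has_bochner_integral_Beta:
  fixes a b s t :: real
  assumes ab: "0 < a" "0 < b" and st: "s < t"
  shows "has_bochner_integral lborel
    (\<lambda>r. indicator {s<..<t} r * ((r - s) powr (a - 1) * (t - r) powr (b - 1)))
    (Beta a b * (t - s) powr (a + b - 1))"
proof -
  let ?f = "\<lambda>x. indicator {0..1} x * (x powr (a - 1) * (1 - x) powr (b - 1)) :: real"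
  have B0: "0 < Beta a b" using ab by (simp add: Beta_def Gamma_real_pos)
  have "((\<lambda>x. if x \<in> {0..1} then x powr (a - 1) * (1 - x) powr (b - 1) else 0) has_integral Beta a b) UNIV"
    unfolding has_integral_restrict_UNIV by (rule has_integral_Beta_real[OF ab])
  also have "(\<lambda>x. if x \<in> {0..1} then x powr (a - 1) * (1 - x) powr (b - 1) else 0) = ?f"
    by (auto simp: indicator_def)
  finally have "integral\<^sup>N lborel ?f = ennreal (Beta a b)"
    by (intro nn_integral_has_integral_lborel) auto
  then have "has_bochner_integral lborel ?f (Beta a b)"
    by (intro has_bochner_integral_nn_integral) (use B0 in auto)
  then have "has_bochner_integral lborel (\<lambda>x. ?f (- (s / (t - s)) + 1 / (t - s) * x)) (Beta a b /\<^sub>R \<bar>1 / (t - s)\<bar>)"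
    using st by (subst (asm) lborel_has_bochner_integral_real_affine_iff[where c="1 / (t - s)" and t="- (s / (t - s))"]) auto
  moreover have "- (s / (t - s)) + 1 / (t - s) * x = (x - s) / (t - s)" for x
    by (simp add: diff_divide_distrib)
  ultimately have 1: "has_bochner_integral lborel (\<lambda>x. ?f ((x - s) / (t - s))) (Beta a b * (t - s))"
    using st by (simp add: mult.commute)
  have 2: "has_bochner_integral lborel (\<lambda>x. (t - s) powr (a + b - 2) * ?f ((x - s) / (t - s)))
      ((t - s) powr (a + b - 2) * (Beta a b * (t - s)))"
    by (rule has_bochner_integral_mult_right) (rule 1)
  have 3: "(t - s) powr (a + b - 2) * (Beta a b * (t - s)) = Beta a b * (t - s) powr (a + b - 1)"
  proof -
    have "(t - s) powr (a + b - 1) = (t - s) powr (a + b - 2) * (t - s) powr 1"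
      by (simp only: powr_add[symmetric]) simp
    then show ?thesis using st by simp
  qed
  have 4: "has_bochner_integral lborel (\<lambda>x. (t - s) powr (a + b - 2) * ?f ((x - s) / (t - s))) y \<longleftrightarrow>
    has_bochner_integral lborel (\<lambda>r. indicator {s<..<t} r * ((r - s) powr (a - 1) * (t - r) powr (b - 1))) y" for y
  proof (rule has_bochner_integral_discrete_difference[of "{s, t}"])
    fix r assume r: "r \<notin> {s, t}"
    show "(t - s) powr (a + b - 2) * ?f ((r - s) / (t - s)) =
        indicator {s<..<t} r * ((r - s) powr (a - 1) * (t - r) powr (b - 1))"
    proof (cases "s < r \<and> r < t")
      case True
      have e: "1 - (r - s) / (t - s) = (t - r) / (t - s)" using st by (simp add: field_simps)
      have in01: "(r - s) / (t - s) \<in> {0..1}" using True st by (simp add: field_simps)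
      have "(t - s) powr (a + b - 2) = (t - s) powr (a - 1) * (t - s) powr (b - 1)"
        by (simp add: powr_add[symmetric])
      moreover have "((r - s) / (t - s)) powr (a - 1) = (r - s) powr (a - 1) / (t - s) powr (a - 1)"
        "((t - r) / (t - s)) powr (b - 1) = (t - r) powr (b - 1) / (t - s) powr (b - 1)"
        using True by (simp_all add: powr_divide)
      ultimately show ?thesis using True in01 st unfolding e by simp
    next
      case False
      then have "(r - s) / (t - s) \<notin> {0..1}" using r st by (auto simp: field_simps)
      with False show ?thesis by auto
    qed
  qed auto
  show ?thesis using 2 unfolding 3 4 .
qed

lemma exp_minus_le_powr:
  fixes x :: real
  assumes "0 < x" "0 \<le> d" "d \<le> 1"
  shows "exp (- x) \<le> x powr (- d)"
proof -
  have "x powr d \<le> exp x"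
  proof (cases "x \<le> 1")
    case True
    then have "x powr d \<le> 1 powr d" using assms by (intro powr_mono2) auto
    also have "\<dots> \<le> exp x" using assms by simp
    finally show ?thesis .
  next
    case False
    then have "x powr d \<le> x powr 1" using assms by (intro powr_mono) auto
    also have "\<dots> \<le> exp x" using assms(1) exp_ge_add_one_self[of x] unfolding powr_one[OF less_imp_le[OF assms(1)]] by linarith
    finally show ?thesis .
  qed
  then have "1 / exp x \<le> 1 / x powr d" using assms by (intro divide_left_mono) auto
  then show ?thesis by (simp add: powr_minus_divide exp_minus inverse_eq_divide)
qed

text \<open>A pointwise bound of gradients by a multiple of \<open>weight\<close> is the weighted
  gradient norm in inequality form: the power is the blow-up allowed at time \<open>t\<close>, the
  exponential is the price of a small contraction factor.\<close>

definition weight :: "real \<Rightarrow> real \<Rightarrow> real \<Rightarrow> real \<Rightarrow> real" where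
  "weight \<gamma> \<rho> t r = exp (\<rho> * (t - r)) * (t - r) powr (- \<gamma>)"

lemma weight_nonneg [simp]: "0 \<le> weight \<gamma> \<rho> t r"
  by (simp add: weight_def)

lemma measurable_weight [measurable]: "weight \<gamma> \<rho> t \<in> borel_measurable borel"
  unfolding weight_def by measurable

text \<open>The exponential is bounded by \<open>exp (\<rho> * T)\<close>, leaving Beta integrals.
  The last claim carries singularities at both ends, each integrable since \<gamma> < 1.\<close>

lemma weight_integral:
  assumes g: "0 < \<gamma>" "\<gamma> < 1" and \<rho>: "0 \<le> \<rho>" and s: "0 \<le> s" "s < t" "t \<le> T"
  shows "set_integrable lborel {s<..<t} (weight \<gamma> \<rho> t)"
    "(LINT r:{s<..<t}|lborel. weight \<gamma> \<rho> t r) \<le> exp (\<rho> * T) * Beta 1 (1 - \<gamma>) * T powr (1 - \<gamma>)"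
    "set_integrable lborel {s<..<t} (\<lambda>r. (r - s) powr (- \<gamma>) * weight \<gamma> \<rho> t r)"
proof -
  have B1: "has_bochner_integral lborel (\<lambda>r. indicator {s<..<t} r * ((r - s) powr (1 - 1) * (t - r) powr (1 - \<gamma> - 1)))
     (Beta 1 (1 - \<gamma>) * (t - s) powr (1 + (1 - \<gamma>) - 1))"
    by (rule has_bochner_integral_Beta) (use g s in auto)
  have B2: "has_bochner_integral lborel (\<lambda>r. indicator {s<..<t} r * ((r - s) powr (1 - \<gamma> - 1) * (t - r) powr (1 - \<gamma> - 1)))
     (Beta (1 - \<gamma>) (1 - \<gamma>) * (t - s) powr (1 - \<gamma> + (1 - \<gamma>) - 1))"
    by (rule has_bochner_integral_Beta) (use g s in auto)
  have le: "exp (\<rho> * (t - r)) \<le> exp (\<rho> * T)" if "s < r" for r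
    using that s \<rho> by (auto intro!: mult_left_mono)
  have w1: "indicator {s<..<t} r * weight \<gamma> \<rho> t r \<le>
     exp (\<rho> * T) * (indicator {s<..<t} r * ((r - s) powr (1 - 1) * (t - r) powr (1 - \<gamma> - 1)))" for r
    unfolding weight_def using le[of r] by (auto simp: indicator_def intro!: mult_right_mono)
  have w2: "indicator {s<..<t} r * ((r - s) powr (- \<gamma>) * weight \<gamma> \<rho> t r) \<le>
     exp (\<rho> * T) * (indicator {s<..<t} r * ((r - s) powr (1 - \<gamma> - 1) * (t - r) powr (1 - \<gamma> - 1)))" for r
    unfolding weight_def using le[of r] by (auto simp: indicator_def mult.left_commute[of "(r - s) powr - \<gamma>"] intro!: mult_right_mono)
  show i1: "set_integrable lborel {s<..<t} (weight \<gamma> \<rho> t)"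
    unfolding set_integrable_def
    by (rule Bochner_Integration.integrable_bound[OF integrable_mult_right[OF integrable.intros[OF B1], of "exp (\<rho> * T)"]])
      (use order_trans[OF w1 abs_ge_self] in auto)
  show "set_integrable lborel {s<..<t} (\<lambda>r. (r - s) powr (- \<gamma>) * weight \<gamma> \<rho> t r)"
    unfolding set_integrable_def
    by (rule Bochner_Integration.integrable_bound[OF integrable_mult_right[OF integrable.intros[OF B2], of "exp (\<rho> * T)"]])
      (use order_trans[OF w2 abs_ge_self] in auto)
  have "(LINT r:{s<..<t}|lborel. weight \<gamma> \<rho> t r) \<le> exp (\<rho> * T) * (Beta 1 (1 - \<gamma>) * (t - s) powr (1 + (1 - \<gamma>) - 1))"
    using integral_mono[OF i1[unfolded set_integrable_def]
        integrable_mult_right[OF integrable.intros[OF B1], of "exp (\<rho> * T)"]] w1 has_bochner_integral_integral_eq[OF B1]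
    unfolding set_lebesgue_integral_def by simp
  also have "\<dots> \<le> exp (\<rho> * T) * (Beta 1 (1 - \<gamma>) * T powr (1 - \<gamma>))"
  proof -
    have "0 < Beta 1 (1 - \<gamma>)" using g by (simp add: Beta_def Gamma_real_pos)
    moreover have "(t - s) powr (1 - \<gamma>) \<le> T powr (1 - \<gamma>)" using g s by (intro powr_mono2) auto
    ultimately show ?thesis by (intro mult_left_mono) auto
  qed
  finally show "(LINT r:{s<..<t}|lborel. weight \<gamma> \<rho> t r) \<le> exp (\<rho> * T) * Beta 1 (1 - \<gamma>) * T powr (1 - \<gamma>)"
    by (simp add: mult.assoc)
qed

text \<open>The exponential weight makes the singular Volterra kernel a contraction: bounding
  \<open>exp (- \<rho> (r - s))\<close> by a negative power of \<open>\<rho> (r - s)\<close> reduces to a Beta integral.\<close>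

lemma weight_contraction:
  assumes g: "0 < \<gamma>" "\<gamma> < 1" and \<epsilon>: "0 < \<epsilon>" and T: "0 < T"
  obtains \<rho> where "0 \<le> \<rho>" "\<And>s t. 0 \<le> s \<Longrightarrow> s < t \<Longrightarrow> t \<le> T \<Longrightarrow>
    (LINT r:{s<..<t}|lborel. (r - s) powr (- \<gamma>) * weight \<gamma> \<rho> t r) \<le> \<epsilon> * weight \<gamma> \<rho> t s"
proof -
  \<comment> \<open>Half of the integrability that is left over: \<open>- \<gamma> - d\<close>
    equals \<open>d - 1\<close>, so trading the exponential for the power \<open>- d\<close> keeps
    the singularity at \<open>s\<close> integrable.\<close>
  define d where "d = (1 - \<gamma>) / 2"
  have d: "0 < d" "d \<le> 1" "1 - \<gamma> - d = d" using g by (auto simp: d_def field_simps)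
  define \<beta> where "\<beta> = Beta d (1 - \<gamma>)"
  have \<beta>: "0 < \<beta>" using d g by (simp add: \<beta>_def Beta_def Gamma_real_pos)
  \<comment> \<open>Chosen to turn the final constant into exactly \<epsilon>.\<close>
  define \<rho> where "\<rho> = (\<beta> * T powr d / \<epsilon>) powr (1 / d)"
  have \<rho>0: "0 < \<rho>" unfolding \<rho>_def using \<beta> \<epsilon> T by simp
  have \<rho>d: "\<rho> powr (- d) * \<beta> * T powr d = \<epsilon>"
  proof -
    have "\<rho> powr d = \<beta> * T powr d / \<epsilon>" unfolding \<rho>_def powr_powr using d \<beta> \<epsilon> T by simp
    then show ?thesis using \<beta> \<epsilon> T by (simp add: powr_minus_divide)
  qed
  have "(LINT r:{s<..<t}|lborel. (r - s) powr (- \<gamma>) * weight \<gamma> \<rho> t r) \<le> \<epsilon> * weight \<gamma> \<rho> t s"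
    if st: "0 \<le> s" "s < t" "t \<le> T" for s t
  proof -
    let ?K = "exp (\<rho> * (t - s)) * \<rho> powr (- d)"
    have B: "has_bochner_integral lborel (\<lambda>r. indicator {s<..<t} r * ((r - s) powr (d - 1) * (t - r) powr (1 - \<gamma> - 1)))
       (\<beta> * (t - s) powr (d + (1 - \<gamma>) - 1))"
      unfolding \<beta>_def by (rule has_bochner_integral_Beta) (use d g st in auto)
    have le: "indicator {s<..<t} r * ((r - s) powr (- \<gamma>) * weight \<gamma> \<rho> t r) \<le>
      ?K * (indicator {s<..<t} r * ((r - s) powr (d - 1) * (t - r) powr (1 - \<gamma> - 1)))" for r
    proof (cases "s < r \<and> r < t")
      case True
      have "exp (\<rho> * (t - r)) = exp (\<rho> * (t - s)) * exp (- (\<rho> * (r - s)))"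
        by (simp add: exp_add[symmetric] algebra_simps)
      also have "\<dots> \<le> exp (\<rho> * (t - s)) * (\<rho> * (r - s)) powr (- d)"
        using True \<rho>0 d by (intro mult_left_mono exp_minus_le_powr) auto
      also have "\<dots> = ?K * (r - s) powr (- d)"
        using True \<rho>0 by (simp add: powr_mult)
      finally have "exp (\<rho> * (t - r)) * ((r - s) powr (- \<gamma>) * (t - r) powr (- \<gamma>)) \<le>
        ?K * (r - s) powr (- d) * ((r - s) powr (- \<gamma>) * (t - r) powr (- \<gamma>))"
        by (intro mult_right_mono) auto
      also have "\<dots> = ?K * ((r - s) powr (d - 1) * (t - r) powr (- \<gamma>))"
      proof -
        have "(r - s) powr (d - 1) = (r - s) powr (- d) * (r - s) powr (- \<gamma>)"
        proof -
          have "d - 1 = - d + - \<gamma>" using d(3) by linarith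
          then show ?thesis by (simp only: powr_add)
        qed
        then show ?thesis by simp
      qed
      finally show ?thesis using True by (simp add: weight_def mult.left_commute)
    qed auto
    have "(LINT r:{s<..<t}|lborel. (r - s) powr (- \<gamma>) * weight \<gamma> \<rho> t r) \<le> ?K * (\<beta> * (t - s) powr (d + (1 - \<gamma>) - 1))"
      using integral_mono[OF weight_integral(3)[OF g less_imp_le[OF \<rho>0] st, unfolded set_integrable_def]
          integrable_mult_right[OF integrable.intros[OF B], of ?K]] le has_bochner_integral_integral_eq[OF B]
      unfolding set_lebesgue_integral_def by simp
    also have "(t - s) powr (d + (1 - \<gamma>) - 1) = (t - s) powr d * (t - s) powr (- \<gamma>)"
      by (simp add: powr_add[symmetric])
    also have "?K * (\<beta> * ((t - s) powr d * (t - s) powr (- \<gamma>))) = (\<rho> powr (- d) * \<beta> * (t - s) powr d) * weight \<gamma> \<rho> t s"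
      by (simp add: weight_def mult_ac)
    also have "\<dots> \<le> \<epsilon> * weight \<gamma> \<rho> t s"
    proof (rule mult_right_mono)
      have "(t - s) powr d \<le> T powr d" using d st by (intro powr_mono2) auto
      then have "\<rho> powr (- d) * \<beta> * (t - s) powr d \<le> \<rho> powr (- d) * \<beta> * T powr d"
        using \<beta> by (intro mult_left_mono) auto
      then show "\<rho> powr (- d) * \<beta> * (t - s) powr d \<le> \<epsilon>" using \<rho>d by simp
    qed simp
    finally show ?thesis .
  qed
  with \<rho>0 show thesis by (intro that[of \<rho>]) auto
qed

section \<open>Functions with weighted gradient bounds\<close>

lemma Cb1D:
  assumes "Cb1 g"
  shows "continuous_on UNIV g" "bounded (range g)" "has_partial i g x"
    "continuous_on UNIV (partial i g)" "bounded (range (partial i g))"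
  using assms by (auto simp: Cb1_def)

lemma has_partial_diff:
  fixes f g :: "real^'n \<Rightarrow> real"
  assumes "has_partial i f x" "has_partial i g x"
  shows "has_partial i (\<lambda>y. f y - g y) x" "partial i (\<lambda>y. f y - g y) x = partial i f x - partial i g x"
proof -
  have "((\<lambda>h. f (x + h *\<^sub>R axis i 1) - g (x + h *\<^sub>R axis i 1)) has_real_derivative
      partial i f x - partial i g x) (at 0)"
    using assms by (intro DERIV_diff) (simp_all add: has_partial_iff_has_derivative)
  from has_partialI[OF this] show "has_partial i (\<lambda>y. f y - g y) x"
    "partial i (\<lambda>y. f y - g y) x = partial i f x - partial i g x" by auto
qed

text \<open>Along one countable sequence of steps the partial derivative is a limit of difference
  quotients, which is how it inherits measurability in parameters.\<close>

lemma partial_LIMSEQ: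
  fixes g :: "real^'n \<Rightarrow> real"
  assumes "has_partial i g x"
  shows "(\<lambda>n. (g (x + (1 / real (Suc n)) *\<^sub>R axis i 1) - g x) * real (Suc n)) \<longlonglongrightarrow> partial i g x"
proof -
  have "(\<lambda>h. (g (x + h *\<^sub>R axis i 1) - g x) / h) \<midarrow>0\<rightarrow> partial i g x"
    using assms by (simp add: has_partial_iff_has_derivative DERIV_def)
  moreover have "filterlim (\<lambda>n. 1 / real (Suc n)) (at 0) sequentially"
    using LIMSEQ_Suc[OF lim_1_over_n] by (auto simp: filterlim_at)
  ultimately have "(\<lambda>n. (g (x + (1 / real (Suc n)) *\<^sub>R axis i 1) - g x) / (1 / real (Suc n))) \<longlonglongrightarrow> partial i g x"
    by (rule filterlim_compose)
  then show ?thesis by simp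
qed

text \<open>\<open>D\<close> plays the role of the norm. Only gradients are bounded quantitatively;
  boundedness of the values is qualitative, contained in \<open>Cb1\<close>, and time
  \<open>t\<close> itself is excluded.\<close>

definition admissible :: "real \<Rightarrow> real \<Rightarrow> real \<Rightarrow> real \<Rightarrow> (real \<Rightarrow> real^'n::finite \<Rightarrow> real) \<Rightarrow> bool" where
  "admissible \<gamma> \<rho> t D v \<longleftrightarrow>
     (\<forall>s. 0 \<le> s \<and> s < t \<longrightarrow> Cb1 (v s) \<and> (\<forall>x i. \<bar>partial i (v s) x\<bar> \<le> D * weight \<gamma> \<rho> t s)) \<and>
     (\<forall>x. continuous_on {0..<t} (\<lambda>s. v s x))"

lemma admissible_diff:
  assumes "admissible \<gamma> \<rho> t D v" "admissible \<gamma> \<rho> t E w"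
  shows "admissible \<gamma> \<rho> t (D + E) (\<lambda>s x. v s x - w s x)"
  unfolding admissible_def
proof (intro conjI allI impI)
  fix x show "continuous_on {0..<t} (\<lambda>s. v s x - w s x)"
    using assms unfolding admissible_def by (intro continuous_intros) auto
next
  fix s assume s: "0 \<le> s \<and> s < t"
  have v: "Cb1 (v s)" "\<And>x i. \<bar>partial i (v s) x\<bar> \<le> D * weight \<gamma> \<rho> t s"
    and w: "Cb1 (w s)" "\<And>x i. \<bar>partial i (w s) x\<bar> \<le> E * weight \<gamma> \<rho> t s"
    using assms s unfolding admissible_def by auto
  note p = has_partial_diff[OF Cb1D(3)[OF v(1)] Cb1D(3)[OF w(1)]]
  have "bounded (range (\<lambda>x. v s x - w s x))"
    using bounded_minus_comp[OF Cb1D(2)[OF v(1)] Cb1D(2)[OF w(1)]] .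
  moreover have "bounded (range (\<lambda>x. partial i (v s) x - partial i (w s) x))" for i
    using bounded_minus_comp[OF Cb1D(5)[OF v(1)] Cb1D(5)[OF w(1)]] .
  ultimately show "Cb1 (\<lambda>x. v s x - w s x)"
    unfolding Cb1_def p(2) using p(1) Cb1D[OF v(1)] Cb1D[OF w(1)]
    by (auto intro!: continuous_intros)
  fix x i
  show "\<bar>partial i (\<lambda>x. v s x - w s x) x\<bar> \<le> (D + E) * weight \<gamma> \<rho> t s"
    unfolding p(2) using v(2)[of i x] w(2)[of i x] by (simp add: distrib_right)
qed

lemma admissible_cong:
  assumes "admissible \<gamma> \<rho> t D v" "\<And>s. 0 \<le> s \<Longrightarrow> s < t \<Longrightarrow> v s = w s"
  shows "admissible \<gamma> \<rho> t D w"
  using assms unfolding admissible_def by (auto cong: continuous_on_cong_simp)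

text \<open>Continuity in time for fixed \<open>x\<close> is combined with Lipschitz constants in
  \<open>x\<close> that converge along the time sequence, since the weight is continuous before
  \<open>t\<close>.\<close>

lemma admissible_continuous:
  fixes v :: "real \<Rightarrow> real^'n::finite \<Rightarrow> real"
  assumes v: "admissible \<gamma> \<rho> t D v"
  shows "continuous_on ({0..<t} \<times> UNIV) (\<lambda>(s, x). v s x)"
  unfolding continuous_on_sequentially
proof (intro allI ballI impI, elim conjE)
  fix p and P :: "nat \<Rightarrow> real \<times> (real^'n)"
  assume p: "p \<in> {0..<t} \<times> UNIV" and P: "\<forall>n. P n \<in> {0..<t} \<times> UNIV" and lim: "P \<longlonglongrightarrow> p"
  obtain s x where sx: "p = (s, x)" by (cases p)
  define S where "S n = fst (P n)" for n
  define X where "X n = snd (P n)" for n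
  have Sn: "0 \<le> S n" "S n < t" for n using P by (auto simp: S_def mem_Times_iff)
  have s: "0 \<le> s" "s < t" using p sx by auto
  have S: "S \<longlonglongrightarrow> s" and X: "X \<longlonglongrightarrow> x"
    using tendsto_fst[OF lim] tendsto_snd[OF lim] by (simp_all add: S_def[abs_def] X_def[abs_def] sx)
  have 1: "(\<lambda>n. v (S n) x) \<longlonglongrightarrow> v s x"
    by (rule continuous_on_tendsto_compose[of "{0..<t}" "\<lambda>s. v s x"]) (use v s Sn S in \<open>auto simp: admissible_def\<close>)
  have 2: "(\<lambda>n. D * weight \<gamma> \<rho> t (S n) * (\<Sum>i\<in>UNIV. \<bar>X n $ i - x $ i\<bar>)) \<longlonglongrightarrow>
      D * weight \<gamma> \<rho> t s * (\<Sum>i\<in>UNIV. \<bar>x $ i - x $ i\<bar>)"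
    unfolding weight_def by (intro tendsto_intros S X) (use s in auto)
  have 3: "\<bar>v (S n) (X n) - v (S n) x\<bar> \<le> D * weight \<gamma> \<rho> t (S n) * (\<Sum>i\<in>UNIV. \<bar>X n $ i - x $ i\<bar>)" for n
    by (rule partial_bound_imp_lipschitz) (use v Sn[of n] in \<open>auto simp: admissible_def Cb1_def\<close>)
  have "(\<lambda>n. v (S n) (X n) - v (S n) x) \<longlonglongrightarrow> 0"
    by (rule Lim_null_comparison[OF always_eventually]) (use 3 2 in auto)
  from tendsto_add[OF this 1] show "((\<lambda>(s, x). v s x) \<circ> P) \<longlonglongrightarrow> (case p of (s, x) \<Rightarrow> v s x)"
    by (simp add: o_def case_prod_unfold S_def X_def sx)
qed

lemma sets_borel_strip:
  "{0..<t} \<times> (UNIV :: 'a::second_countable_topology set) \<in> sets (borel :: (real \<times> 'a) measure)"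
proof -
  have "{0..<t} \<times> (UNIV :: 'a set) \<in> sets (borel \<Otimes>\<^sub>M borel)"
    by (rule pair_measureI) auto
  then show ?thesis by (simp only: borel_prod)
qed

text \<open>Difference quotients of a jointly continuous function are jointly Borel, and so is their
  limit. Extension by 0 outside the time strip makes this a statement on the whole space.\<close>

lemma admissible_partial_measurable:
  fixes v :: "real \<Rightarrow> real^'n::finite \<Rightarrow> real"
  assumes v: "admissible \<gamma> \<rho> t D v"
  shows "(\<lambda>(s, x). if 0 \<le> s \<and> s < t then partial i (v s) x else 0) \<in> borel_measurable borel"
proof -
  from borel_measurable_continuous_on_indicator[OF sets_borel_strip admissible_continuous[OF v]]
  have m: "(\<lambda>p. indicator ({0..<t} \<times> UNIV) p *\<^sub>R (case p of (s, x) \<Rightarrow> v s x)) \<in> borel_measurable borel" .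
  have sh: "(\<lambda>p :: real \<times> (real^'n). (fst p, snd p + a)) \<in> borel_measurable borel" for a
    by (intro borel_measurable_continuous_onI continuous_intros)
  let ?d = "\<lambda>n p. (indicator ({0..<t} \<times> UNIV) (fst p, snd p + (1 / real (Suc n)) *\<^sub>R axis i 1) *\<^sub>R
      (case (fst p, snd p + (1 / real (Suc n)) *\<^sub>R axis i 1) of (s, x) \<Rightarrow> v s x)
     - indicator ({0..<t} \<times> UNIV) p *\<^sub>R (case p of (s, x) \<Rightarrow> v s x)) * real (Suc n)"
  have dm: "?d n \<in> borel_measurable borel" for n
    by (intro borel_measurable_times borel_measurable_diff borel_measurable_const m measurable_compose[OF sh m])
  show ?thesis
  proof (rule borel_measurable_LIMSEQ_real[OF _ dm])
    fix p :: "real \<times> (real^'n)"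
    obtain s x where p: "p = (s, x)" by (cases p)
    show "(\<lambda>n. ?d n p) \<longlonglongrightarrow> (case p of (s, x) \<Rightarrow> if 0 \<le> s \<and> s < t then partial i (v s) x else 0)"
    proof (cases "0 \<le> s \<and> s < t")
      case True
      then have "has_partial i (v s) x" using v by (auto simp: admissible_def Cb1_def)
      from partial_LIMSEQ[OF this] show ?thesis using True by (simp add: p)
    qed (auto simp: p indicator_def)
  qed
qed

text \<open>Geometric decay of both values and gradients permits termwise differentiation and
  uniform limits; the factor 2 is the sum of the powers of 1/2.\<close>

lemma admissible_suminf:
  fixes w :: "nat \<Rightarrow> real \<Rightarrow> real^'n::finite \<Rightarrow> real"
  assumes adm: "\<And>n. admissible \<gamma> \<rho> t (D * (1/2) ^ n) (w n)"
    and bound: "\<And>n s x. 0 \<le> s \<Longrightarrow> s < t \<Longrightarrow> \<bar>w n s x\<bar> \<le> K * (1/2) ^ n"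
  shows "admissible \<gamma> \<rho> t (2 * D) (\<lambda>s x. \<Sum>n. w n s x)"
proof -
  have geo: "summable (\<lambda>n. c * (1/2) ^ n :: real)" "(\<Sum>n. c * (1/2) ^ n :: real) = 2 * c" for c :: real
    by (auto intro!: summable_mult summable_geometric simp: suminf_mult suminf_geometric summable_geometric)
  have lim0: "uniform_limit ({0..<t} \<times> UNIV) (\<lambda>m p. \<Sum>n<m. w n (fst p) (snd p)) (\<lambda>p. \<Sum>n. w n (fst p) (snd p)) sequentially"
    by (rule Weierstrass_m_test[OF _ geo(1)[of K]]) (use bound in auto)
  show ?thesis
    unfolding admissible_def
  proof (intro conjI allI impI)
    fix x :: "real^'n"
    have "uniform_limit {0..<t} (\<lambda>m s. \<Sum>n<m. w n s x) (\<lambda>s. \<Sum>n. w n s x) sequentially"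
      by (rule Weierstrass_m_test[OF _ geo(1)[of K]]) (use bound in auto)
    then show "continuous_on {0..<t} (\<lambda>s. \<Sum>n. w n s x)"
      by (rule uniform_limit_theorem[rotated])
        (use adm in \<open>auto simp: admissible_def intro!: always_eventually continuous_intros\<close>)
  next
    fix s assume s: "0 \<le> s \<and> s < t"
    have cb: "Cb1 (w n s)" and pb: "\<And>x i. \<bar>partial i (w n s) x\<bar> \<le> D * weight \<gamma> \<rho> t s * (1/2) ^ n" for n
      using adm[of n] s unfolding admissible_def by (auto simp: mult_ac)
    have wb: "\<bar>w n s x\<bar> \<le> K * (1/2) ^ n" for n x using bound s by auto
    have summ: "summable (\<lambda>n. w n s x)" "summable (\<lambda>n. partial i (w n s) x)" for x i
      by (rule summable_comparison_test'[OF geo(1)[of K], of 0], use wb in simp,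
          rule summable_comparison_test'[OF geo(1)[of "D * weight \<gamma> \<rho> t s"], of 0], use pb in simp)
    have sb: "\<bar>\<Sum>n. w n s x\<bar> \<le> 2 * K" and spb: "\<bar>\<Sum>n. partial i (w n s) x\<bar> \<le> 2 * (D * weight \<gamma> \<rho> t s)" for x i
      using norm_suminf_le[of "\<lambda>n. w n s x", OF _ geo(1)[of K]] wb
        norm_suminf_le[of "\<lambda>n. partial i (w n s) x", OF _ geo(1)[of "D * weight \<gamma> \<rho> t s"]] pb
      by (simp_all only: geo(2) real_norm_def)
    have hp: "((\<lambda>h. \<Sum>n. w n s (x + h *\<^sub>R axis i 1)) has_real_derivative (\<Sum>n. partial i (w n s) (x + 0 *\<^sub>R axis i 1))) (at 0)" for x i
    proof (rule has_field_derivative_series'(2)[where S=UNIV and x0=0])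
      show "uniformly_convergent_on UNIV (\<lambda>m h. \<Sum>n<m. partial i (w n s) (x + h *\<^sub>R axis i 1))"
        by (rule Weierstrass_m_test'[OF _ geo(1)[of "D * weight \<gamma> \<rho> t s"]]) (use pb in auto)
      show "((\<lambda>h. w n s (x + h *\<^sub>R axis i 1)) has_real_derivative partial i (w n s) (x + h *\<^sub>R axis i 1)) (at h)" for n h
        by (rule has_derivative_partial_line[OF Cb1D(3)[OF cb]])
    qed (use summ in auto)
    note p = has_partialI[OF hp, simplified]
    have uc: "uniform_limit UNIV (\<lambda>m x. \<Sum>n<m. w n s x) (\<lambda>x. \<Sum>n. w n s x) sequentially"
      by (rule Weierstrass_m_test[OF _ geo(1)[of K]]) (use wb in auto)
    have up: "uniform_limit UNIV (\<lambda>m x. \<Sum>n<m. partial i (w n s) x) (\<lambda>x. \<Sum>n. partial i (w n s) x) sequentially" for i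
      by (rule Weierstrass_m_test[OF _ geo(1)[of "D * weight \<gamma> \<rho> t s"]]) (use pb in auto)
    have "continuous_on UNIV (\<lambda>x. \<Sum>n. w n s x)"
      by (rule uniform_limit_theorem[OF _ uc])
        (use Cb1D(1)[OF cb] in \<open>auto intro!: always_eventually continuous_on_sum\<close>)
    moreover have "continuous_on UNIV (\<lambda>x. \<Sum>n. partial i (w n s) x)" for i
      by (rule uniform_limit_theorem[OF _ up])
        (use Cb1D(4)[OF cb] in \<open>auto intro!: always_eventually continuous_on_sum\<close>)
    moreover have "bounded (range (\<lambda>x. \<Sum>n. w n s x))"
      unfolding bounded_iff using sb by (intro exI[of _ "2 * K"]) auto
    moreover have "bounded (range (\<lambda>x. \<Sum>n. partial i (w n s) x))" for i
      unfolding bounded_iff using spb by (intro exI[of _ "2 * (D * weight \<gamma> \<rho> t s)"]) auto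
    ultimately show "Cb1 (\<lambda>x. \<Sum>n. w n s x)"
      unfolding Cb1_def p(2) using p(1) by blast
    fix x i
    show "\<bar>partial i (\<lambda>x. \<Sum>n. w n s x) x\<bar> \<le> 2 * D * weight \<gamma> \<rho> t s"
      unfolding p(2) using spb[of i x] by simp
  qed
qed

section \<open>Duhamel operators and mild solutions\<close>

text \<open>The smoothing bound requires \<open>s < r\<close>, so the single time
  \<open>r = s\<close> is removed as a null set.\<close>

lemma set_Ico_eq_Ioo:
  fixes f :: "real \<Rightarrow> real"
  shows "(LINT r:{s..<t}|lborel. f r) = (LINT r:{s<..<t}|lborel. f r)"
    "set_integrable lborel {s..<t} f \<longleftrightarrow> set_integrable lborel {s<..<t} f"
proof -
  show "(LINT r:{s..<t}|lborel. f r) = (LINT r:{s<..<t}|lborel. f r)"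
    unfolding set_lebesgue_integral_def
    by (rule integral_discrete_difference[of "{s}"]) (auto simp: indicator_def)
  show "set_integrable lborel {s..<t} f \<longleftrightarrow> set_integrable lborel {s<..<t} f"
    unfolding set_integrable_def
    by (rule integrable_discrete_difference[of "{s}"]) (auto simp: indicator_def)
qed

text \<open>Everything the fixed-point argument takes from the transition operators, stripped of
  probability. Times are strictly ordered since no smoothing occurs at \<open>r = s\<close>;
  \<open>R_meas\<close> allows the function acted upon to vary with \<open>r\<close>.\<close>

locale smoothing_evolution =
  fixes R :: "real \<Rightarrow> real \<Rightarrow> (real^'n::finite \<Rightarrow> real) \<Rightarrow> real^'n \<Rightarrow> real" and T C \<gamma> :: real
  assumes gamma: "0 < \<gamma>" "\<gamma> < 1" and C: "0 \<le> C"
    and R_Cb1: "\<And>s r \<phi>. \<lbrakk>0 \<le> s; s < r; r \<le> T; bounded_borel \<phi>\<rbrakk> \<Longrightarrow> Cb1 (R s r \<phi>)"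
    and R_bound: "\<And>s r \<phi> c x. \<lbrakk>0 \<le> s; s < r; r \<le> T; bounded_borel \<phi>; \<And>y. \<bar>\<phi> y\<bar> \<le> c\<rbrakk> \<Longrightarrow> \<bar>R s r \<phi> x\<bar> \<le> c"
    and R_partial: "\<And>s r \<phi> c i x. \<lbrakk>0 \<le> s; s < r; r \<le> T; bounded_borel \<phi>; \<And>y. \<bar>\<phi> y\<bar> \<le> c\<rbrakk> \<Longrightarrow>
      \<bar>partial i (R s r \<phi>) x\<bar> \<le> C * (r - s) powr (- \<gamma>) * c"
    and R_diff: "\<And>s r \<phi> \<psi> x. \<lbrakk>0 \<le> s; s < r; r \<le> T; bounded_borel \<phi>; bounded_borel \<psi>\<rbrakk> \<Longrightarrow>
      R s r (\<lambda>y. \<phi> y - \<psi> y) x = R s r \<phi> x - R s r \<psi> x"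
    and R_cont: "\<And>r \<phi> x. \<lbrakk>0 < r; r \<le> T; bounded_borel \<phi>\<rbrakk> \<Longrightarrow> continuous_on {0..<r} (\<lambda>s. R s r \<phi> x)"
    and R_meas: "\<And>s t k x. \<lbrakk>0 \<le> s; s < t; t \<le> T; (\<lambda>(r, y). k r y) \<in> borel_measurable borel;
      \<And>r. s < r \<Longrightarrow> r < t \<Longrightarrow> bounded_borel (k r)\<rbrakk> \<Longrightarrow>
      (\<lambda>r. indicator {s<..<t} r * R s r (k r) x) \<in> borel_measurable borel"
begin

text \<open>Right-hand sides for the Duhamel integral, with the same singular profile in time as an
  admissible gradient.\<close>

definition source :: "real \<Rightarrow> real \<Rightarrow> real \<Rightarrow> (real \<Rightarrow> real^'n \<Rightarrow> real) \<Rightarrow> bool" where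
  "source \<rho> t D k \<longleftrightarrow>
     (\<lambda>(r, y). if 0 \<le> r \<and> r < t then k r y else 0) \<in> borel_measurable borel \<and>
     (\<forall>r y. 0 \<le> r \<and> r < t \<longrightarrow> \<bar>k r y\<bar> \<le> D * weight \<gamma> \<rho> t r)"

definition duhamel :: "real \<Rightarrow> (real \<Rightarrow> real^'n \<Rightarrow> real) \<Rightarrow> real \<Rightarrow> real^'n \<Rightarrow> real" where
  "duhamel t k s x = (LINT r:{s..<t}|lborel. R s r (k r) x)"

lemma source_bounded_borel:
  assumes "source \<rho> t D k" "0 \<le> r" "r < t"
  shows "bounded_borel (k r)"
proof -
  have "(\<lambda>y. (r, y)) \<in> borel_measurable borel"
    by (intro borel_measurable_continuous_onI continuous_intros)
  moreover have "(\<lambda>(r, y). if 0 \<le> r \<and> r < t then k r y else 0) \<in> borel_measurable borel"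
    using assms by (simp add: source_def)
  ultimately have "(\<lambda>y. case (r, y) of (r, y) \<Rightarrow> if 0 \<le> r \<and> r < t then k r y else 0) \<in> borel_measurable borel"
    by (rule measurable_compose)
  then have "k r \<in> borel_measurable borel" using assms by simp
  moreover have "bounded (range (k r))"
    unfolding bounded_iff using assms by (intro exI[of _ "D * weight \<gamma> \<rho> t r"]) (auto simp: source_def)
  ultimately show ?thesis by (simp add: bounded_borel_def)
qed

context
  fixes \<rho> t D k
  assumes k: "source \<rho> t D k" and t: "t \<le> T" and \<rho>: "0 \<le> \<rho>"
begin

lemma source_bound: "0 \<le> r \<Longrightarrow> r < t \<Longrightarrow> \<bar>k r y\<bar> \<le> D * weight \<gamma> \<rho> t r"
  using k by (simp add: source_def)

lemma duhamel_integrand_measurable: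
  assumes s: "0 \<le> s" "s < t"
  shows "(\<lambda>r. indicator {s<..<t} r * R s r (k r) x) \<in> borel_measurable borel"
proof -
  let ?k = "\<lambda>r y. if 0 \<le> r \<and> r < t then k r y else 0"
  have "(\<lambda>r. indicator {s<..<t} r * R s r (?k r) x) \<in> borel_measurable borel"
  proof (rule R_meas[OF s t])
    show "(\<lambda>(r, y). ?k r y) \<in> borel_measurable borel" using k by (simp add: source_def)
    show "bounded_borel (?k r)" if "s < r" "r < t" for r
      using source_bounded_borel[OF k, of r] that s by simp
  qed
  also have "(\<lambda>r. indicator {s<..<t} r * R s r (?k r) x) = (\<lambda>r. indicator {s<..<t} r * R s r (k r) x)"
    using s by (auto simp: indicator_def fun_eq_iff)
  finally show ?thesis .
qed

lemma duhamel_integrand_bound: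
  assumes s: "0 \<le> s"
  shows "norm (indicator {s<..<t} r * R s r (k r) x) \<le> D * (indicator {s<..<t} r * weight \<gamma> \<rho> t r)"
proof (cases "s < r \<and> r < t")
  case True
  then have "\<bar>R s r (k r) x\<bar> \<le> D * weight \<gamma> \<rho> t r"
    by (intro R_bound source_bounded_borel[OF k] source_bound) (use s t in auto)
  with True show ?thesis by simp
qed auto

lemma duhamel_partial_bound:
  assumes s: "0 \<le> s"
  shows "norm (indicator {s<..<t} r * partial i (R s r (k r)) x) \<le>
    C * D * (indicator {s<..<t} r * ((r - s) powr (- \<gamma>) * weight \<gamma> \<rho> t r))"
proof (cases "s < r \<and> r < t")
  case True
  then have "\<bar>partial i (R s r (k r)) x\<bar> \<le> C * (r - s) powr (- \<gamma>) * (D * weight \<gamma> \<rho> t r)"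
    by (intro R_partial source_bounded_borel[OF k] source_bound) (use s t in auto)
  with True show ?thesis by (simp add: mult_ac)
qed auto

lemma integrable_weight:
  assumes s: "0 \<le> s" "s < t"
  shows "integrable lborel (\<lambda>r. D * (indicator {s<..<t} r * weight \<gamma> \<rho> t r))"
    "integrable lborel (\<lambda>r. C * D * (indicator {s<..<t} r * ((r - s) powr (- \<gamma>) * weight \<gamma> \<rho> t r)))"
  using weight_integral(1,3)[OF gamma \<rho> s t] by (auto simp: set_integrable_def)

lemma duhamel_integrable:
  assumes s: "0 \<le> s" "s < t"
  shows "integrable lborel (\<lambda>r. indicator {s<..<t} r * R s r (k r) x)"
  by (rule Bochner_Integration.integrable_bound[OF integrable_weight(1)[OF s]])
    (use duhamel_integrand_measurable[OF s] order_trans[OF duhamel_integrand_bound[OF s(1)] abs_ge_self] in auto)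

lemma duhamel_set_integrable:
  assumes s: "0 \<le> s" "s < t"
  shows "set_integrable lborel {s..<t} (\<lambda>r. R s r (k r) x)"
  unfolding set_Ico_eq_Ioo using duhamel_integrable[OF s] by (simp add: set_integrable_def)

lemma duhamel_eq: "duhamel t k s x = (LINT r|lborel. indicator {s<..<t} r * R s r (k r) x)"
  unfolding duhamel_def set_Ico_eq_Ioo by (simp add: set_lebesgue_integral_def)

lemma duhamel_bound:
  assumes s: "0 \<le> s" "s < t" and D: "0 \<le> D"
  shows "\<bar>duhamel t k s x\<bar> \<le> D * (exp (\<rho> * T) * Beta 1 (1 - \<gamma>) * T powr (1 - \<gamma>))"
proof -
  have "\<bar>duhamel t k s x\<bar> \<le> (LINT r|lborel. norm (indicator {s<..<t} r * R s r (k r) x))"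
    unfolding duhamel_eq real_norm_def[symmetric] by (rule integral_norm_bound)
  also have "\<dots> \<le> (LINT r|lborel. D * (indicator {s<..<t} r * weight \<gamma> \<rho> t r))"
    by (rule integral_mono[OF integrable_norm[OF duhamel_integrable[OF s]] integrable_weight(1)[OF s]
        duhamel_integrand_bound[OF s(1)]])
  also have "\<dots> = D * (LINT r:{s<..<t}|lborel. weight \<gamma> \<rho> t r)"
    by (simp add: set_lebesgue_integral_def)
  also have "\<dots> \<le> D * (exp (\<rho> * T) * Beta 1 (1 - \<gamma>) * T powr (1 - \<gamma>))"
    by (intro mult_left_mono D weight_integral(2)[OF gamma \<rho> s t])
  finally show ?thesis .
qed

text \<open>Differentiation under the integral, with a majorant singular at both
  \<open>r = s\<close> and \<open>r = t\<close>, integrable because \<gamma> < 1. Measurability of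
  the derivative in \<open>r\<close> comes from difference quotients.\<close>

lemma duhamel_partial:
  assumes s: "0 \<le> s" "s < t"
  shows "has_partial i (duhamel t k s) x"
    "partial i (duhamel t k s) x = (LINT r|lborel. indicator {s<..<t} r * partial i (R s r (k r)) x)"
    "(\<lambda>r. indicator {s<..<t} r * partial i (R s r (k r)) x) \<in> borel_measurable borel"
proof -
  let ?F = "\<lambda>h r. indicator {s<..<t} r * R s r (k r) (x + h *\<^sub>R axis i 1)"
  let ?D = "\<lambda>h r. indicator {s<..<t} r * partial i (R s r (k r)) (x + h *\<^sub>R axis i 1)"
  have hp: "has_partial i (R s r (k r)) y" if "s < r" "r < t" for r y
    by (intro Cb1D(3) R_Cb1 source_bounded_borel[OF k]) (use that s t in auto)
  have "(\<lambda>r. indicator {s<..<t} r * partial i (R s r (k r)) x) \<in> borel_measurable borel"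
  proof (rule borel_measurable_LIMSEQ_real)
    fix r
    show "(\<lambda>n. (?F (1 / real (Suc n)) r - indicator {s<..<t} r * R s r (k r) x) * real (Suc n)) \<longlonglongrightarrow>
      indicator {s<..<t} r * partial i (R s r (k r)) x"
      by (cases "s < r \<and> r < t") (auto intro: partial_LIMSEQ[OF hp, simplified])
  qed (intro borel_measurable_times borel_measurable_diff borel_measurable_const duhamel_integrand_measurable[OF s])
  then show m: "(\<lambda>r. indicator {s<..<t} r * partial i (R s r (k r)) x) \<in> borel_measurable borel" .
  have "((\<lambda>h. LINT r|lborel. ?F h r) has_real_derivative (LINT r|lborel. ?D 0 r)) (at 0)"
  proof (rule has_real_derivative_integral[OF _ _ integrable_weight(2)[OF s]])
    show "integrable lborel (?F h)" for h by (rule duhamel_integrable[OF s])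
    show "?D 0 \<in> borel_measurable lborel" using m by simp
    show "AE r in lborel. \<forall>h. \<bar>h\<bar> < 1 \<longrightarrow> ((\<lambda>h. ?F h r) has_real_derivative ?D h r) (at h) \<and>
      \<bar>?D h r\<bar> \<le> C * D * (indicator {s<..<t} r * ((r - s) powr (- \<gamma>) * weight \<gamma> \<rho> t r))"
    proof (intro always_eventually allI impI conjI)
      fix r h
      show "((\<lambda>h. ?F h r) has_real_derivative ?D h r) (at h)"
        by (cases "s < r \<and> r < t")
          (auto intro!: DERIV_cmult has_derivative_partial_line hp simp: indicator_def)
      show "\<bar>?D h r\<bar> \<le> C * D * (indicator {s<..<t} r * ((r - s) powr (- \<gamma>) * weight \<gamma> \<rho> t r))"
        using duhamel_partial_bound[OF s(1)] by (simp only: real_norm_def)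
    qed
  qed
  then have der: "((\<lambda>h. duhamel t k s (x + h *\<^sub>R axis i 1)) has_real_derivative
      (LINT r|lborel. indicator {s<..<t} r * partial i (R s r (k r)) x)) (at 0)"
    by (simp add: duhamel_eq)
  show "has_partial i (duhamel t k s) x"
    "partial i (duhamel t k s) x = (LINT r|lborel. indicator {s<..<t} r * partial i (R s r (k r)) x)"
    using has_partialI[OF der] by auto
qed

lemma duhamel_partial_le:
  assumes s: "0 \<le> s" "s < t"
  shows "\<bar>partial i (duhamel t k s) x\<bar> \<le> C * D * (LINT r:{s<..<t}|lborel. (r - s) powr (- \<gamma>) * weight \<gamma> \<rho> t r)"
proof -
  let ?f = "\<lambda>r. indicator {s<..<t} r * partial i (R s r (k r)) x"
  have int: "integrable lborel ?f"
    by (rule Bochner_Integration.integrable_bound[OF integrable_weight(2)[OF s]])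
      (use duhamel_partial(3)[OF s] order_trans[OF duhamel_partial_bound[OF s(1)] abs_ge_self] in auto)
  have "\<bar>partial i (duhamel t k s) x\<bar> \<le> (LINT r|lborel. norm (?f r))"
    unfolding duhamel_partial(2)[OF s] real_norm_def[symmetric] by (rule integral_norm_bound)
  also have "\<dots> \<le> (LINT r|lborel. C * D * (indicator {s<..<t} r * ((r - s) powr (- \<gamma>) * weight \<gamma> \<rho> t r)))"
    by (rule integral_mono[OF integrable_norm[OF int] integrable_weight(2)[OF s] duhamel_partial_bound[OF s(1)]])
  also have "\<dots> = C * D * (LINT r:{s<..<t}|lborel. (r - s) powr (- \<gamma>) * weight \<gamma> \<rho> t r)"
    by (simp add: set_lebesgue_integral_def)
  finally show ?thesis .
qed

lemma duhamel_Cb1: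
  assumes s: "0 \<le> s" "s < t" and D: "0 \<le> D"
  shows "Cb1 (duhamel t k s)"
proof -
  have Cb: "Cb1 (R s r (k r))" if "s < r" "r < t" for r
    by (intro R_Cb1 source_bounded_borel[OF k]) (use that s t in auto)
  have c1: "continuous_on UNIV (duhamel t k s)"
    unfolding continuous_on_sequentially
  proof (intro allI ballI impI, elim conjE)
    fix x and X :: "nat \<Rightarrow> real^'n" assume X: "X \<longlonglongrightarrow> x"
    have "(\<lambda>n. duhamel t k s (X n)) \<longlonglongrightarrow> duhamel t k s x"
      unfolding duhamel_eq
    proof (rule integral_dominated_convergence[OF _ _ integrable_weight(1)[OF s]])
      show "AE r in lborel. (\<lambda>n. indicator {s<..<t} r * R s r (k r) (X n)) \<longlonglongrightarrow> indicator {s<..<t} r * R s r (k r) x"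
      proof (intro always_eventually allI)
        fix r
        show "(\<lambda>n. indicator {s<..<t} r * R s r (k r) (X n)) \<longlonglongrightarrow> indicator {s<..<t} r * R s r (k r) x"
          using continuous_on_tendsto_compose[OF Cb1D(1)[OF Cb] X]
          by (cases "s < r \<and> r < t") auto
      qed
    qed (use duhamel_integrand_measurable[OF s] duhamel_integrand_bound[OF s(1)] in auto)
    then show "(duhamel t k s \<circ> X) \<longlonglongrightarrow> duhamel t k s x" by (simp add: o_def)
  qed
  have c2: "continuous_on UNIV (partial i (duhamel t k s))" for i
    unfolding continuous_on_sequentially
  proof (intro allI ballI impI, elim conjE)
    fix x and X :: "nat \<Rightarrow> real^'n" assume X: "X \<longlonglongrightarrow> x"
    have "(\<lambda>n. partial i (duhamel t k s) (X n)) \<longlonglongrightarrow> partial i (duhamel t k s) x"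
      unfolding duhamel_partial(2)[OF s]
    proof (rule integral_dominated_convergence[OF _ _ integrable_weight(2)[OF s]])
      show "AE r in lborel. (\<lambda>n. indicator {s<..<t} r * partial i (R s r (k r)) (X n)) \<longlonglongrightarrow>
          indicator {s<..<t} r * partial i (R s r (k r)) x"
      proof (intro always_eventually allI)
        fix r
        show "(\<lambda>n. indicator {s<..<t} r * partial i (R s r (k r)) (X n)) \<longlonglongrightarrow>
            indicator {s<..<t} r * partial i (R s r (k r)) x"
          using continuous_on_tendsto_compose[OF Cb1D(4)[OF Cb] X]
          by (cases "s < r \<and> r < t") auto
      qed
    qed (use duhamel_partial(3)[OF s] duhamel_partial_bound[OF s(1)] in auto)
    then show "(partial i (duhamel t k s) \<circ> X) \<longlonglongrightarrow> partial i (duhamel t k s) x" by (simp add: o_def)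
  qed
  have b1: "bounded (range (duhamel t k s))"
    unfolding bounded_iff using duhamel_bound[OF s D] by auto
  have b2: "bounded (range (partial i (duhamel t k s)))" for i
    unfolding bounded_iff using duhamel_partial_le[OF s, of i] by auto
  show ?thesis
    unfolding Cb1_def using c1 c2 b1 b2 duhamel_partial(1)[OF s] by blast
qed

text \<open>The domain of integration moves with \<open>s\<close>, so a majorant on all of
  \<open>(0, t)\<close> is used; convergence of the integrand is claimed off the single point
  \<open>r = s\<close>.\<close>

lemma duhamel_continuous:
  "continuous_on {0..<t} (\<lambda>s. duhamel t k s x)"
  unfolding continuous_on_sequentially
proof (intro allI ballI impI, elim conjE)
  fix s and S :: "nat \<Rightarrow> real" assume s: "s \<in> {0..<t}" and Sn: "\<forall>n. S n \<in> {0..<t}" and S: "S \<longlonglongrightarrow> s"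
  then have t0: "0 < t" by auto
  have "(\<lambda>n. LINT r|lborel. indicator {S n<..<t} r * R (S n) r (k r) x) \<longlonglongrightarrow>
      (LINT r|lborel. indicator {s<..<t} r * R s r (k r) x)"
  proof (rule integral_dominated_convergence[OF _ _ integrable_weight(1)[OF order_refl t0]])
    have "AE r in lborel. r \<noteq> s" by (rule AE_lborel_singleton)
    then show "AE r in lborel. (\<lambda>n. indicator {S n<..<t} r * R (S n) r (k r) x) \<longlonglongrightarrow> indicator {s<..<t} r * R s r (k r) x"
    proof eventually_elim
      case (elim r)
      show ?case
      proof (cases "s < r \<and> r < t")
        case True
        then have "continuous_on {0..<r} (\<lambda>s. R s r (k r) x)"
          by (intro R_cont source_bounded_borel[OF k]) (use s t in auto)
        moreover have ev: "eventually (\<lambda>n. S n < r) sequentially"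
          using order_tendstoD(2)[OF S] True by simp
        then have "eventually (\<lambda>n. S n \<in> {0..<r}) sequentially"
          by eventually_elim (use Sn in auto)
        ultimately have "(\<lambda>n. R (S n) r (k r) x) \<longlonglongrightarrow> R s r (k r) x"
          by (intro continuous_on_tendsto_compose[OF _ S]) (use True s in auto)
        moreover have "eventually (\<lambda>n. R (S n) r (k r) x = indicator {S n<..<t} r * R (S n) r (k r) x) sequentially"
          using ev by eventually_elim (use True in auto)
        ultimately have "(\<lambda>n. indicator {S n<..<t} r * R (S n) r (k r) x) \<longlonglongrightarrow> R s r (k r) x"
          by (rule Lim_transform_eventually)
        then show ?thesis using True by simp
      next
        case False
        with elim consider "r < s" | "t \<le> r" by linarith
        then show ?thesis
        proof cases
          case 1
          have "eventually (\<lambda>n. indicator {S n<..<t} r * R (S n) r (k r) x = 0) sequentially"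
            using order_tendstoD(1)[OF S 1] by eventually_elim auto
          from tendsto_eventually[OF this] 1 show ?thesis by simp
        next
          case 2
          then show ?thesis by simp
        qed
      qed
    qed
    show "AE r in lborel. norm (indicator {S n<..<t} r * R (S n) r (k r) x) \<le> D * (indicator {0<..<t} r * weight \<gamma> \<rho> t r)" for n
    proof (intro always_eventually allI)
      fix r
      have S0: "0 \<le> S n" using Sn by auto
      note duhamel_integrand_bound[OF S0, of r x]
      also have "D * (indicator {S n<..<t} r * weight \<gamma> \<rho> t r) \<le> D * (indicator {0<..<t} r * weight \<gamma> \<rho> t r)"
      proof (cases "S n < r \<and> r < t")
        case False
        \<comment> \<open>Nonnegativity is read off from the source bound, which dominates an
          absolute value.\<close>
        have "0 \<le> D * (indicator {0<..<t} r * weight \<gamma> \<rho> t r)"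
        proof (cases "0 < r \<and> r < t")
          case True
          then have "0 \<le> D * weight \<gamma> \<rho> t r" using order_trans[OF abs_ge_zero source_bound, of r] by simp
          then show ?thesis using True by simp
        qed auto
        then show ?thesis using False by auto
      qed (use S0 in auto)
      finally show "norm (indicator {S n<..<t} r * R (S n) r (k r) x) \<le> D * (indicator {0<..<t} r * weight \<gamma> \<rho> t r)" .
    qed
  qed (use duhamel_integrand_measurable s Sn in auto)
  then show "((\<lambda>s. duhamel t k s x) \<circ> S) \<longlonglongrightarrow> duhamel t k s x"
    by (simp add: duhamel_eq o_def)
qed

end

end

section \<open>The fixed-point problem\<close>

locale mild_problem = smoothing_evolution R T C \<gamma>
  for R :: "real \<Rightarrow> real \<Rightarrow> (real^'n::finite \<Rightarrow> real) \<Rightarrow> real^'n \<Rightarrow> real" and T C \<gamma> :: real +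
  fixes B :: "real \<Rightarrow> real^'n \<Rightarrow> real^'n" and b t :: real and u0 :: "real^'n \<Rightarrow> real"
  assumes t: "0 < t" "t \<le> T" and b: "0 \<le> b"
    and B_bound: "\<And>r y i. 0 \<le> r \<Longrightarrow> r < t \<Longrightarrow> \<bar>B r y $ i\<bar> \<le> b"
    and B_meas: "\<And>i. (\<lambda>(r, y). if 0 \<le> r \<and> r < t then B r y $ i else 0) \<in> borel_measurable borel"
    and u0: "bounded_borel u0"
begin

definition drift :: "(real \<Rightarrow> real^'n \<Rightarrow> real) \<Rightarrow> real \<Rightarrow> real^'n \<Rightarrow> real" where
  "drift v r y = B r y \<bullet> gradient (v r) y"

definition \<Phi> :: "(real \<Rightarrow> real^'n \<Rightarrow> real) \<Rightarrow> real \<Rightarrow> real^'n \<Rightarrow> real" where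
  "\<Phi> v = duhamel t (drift v)"

lemma drift_eq: "drift v r y = (\<Sum>i\<in>UNIV. B r y $ i * partial i (v r) y)"
  by (simp add: drift_def inner_vec_def gradient_def)

text \<open>The inner product is a sum over coordinates, each at most \<open>b\<close> times a
  partial derivative; this yields the factor \<open>CARD('n) * b\<close>.\<close>

lemma drift_source:
  assumes v: "admissible \<gamma> \<rho> t D v"
  shows "source \<rho> t (real CARD('n) * b * D) (drift v)"
  unfolding source_def
proof (intro conjI allI impI)
  have "(\<lambda>p. \<Sum>i\<in>UNIV. (case p of (r, y) \<Rightarrow> if 0 \<le> r \<and> r < t then B r y $ i else 0) *
      (case p of (r, y) \<Rightarrow> if 0 \<le> r \<and> r < t then partial i (v r) y else 0)) \<in> borel_measurable borel"
    by (intro borel_measurable_sum borel_measurable_times B_meas admissible_partial_measurable[OF v])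
  also have "(\<lambda>p. \<Sum>i\<in>UNIV. (case p of (r, y) \<Rightarrow> if 0 \<le> r \<and> r < t then B r y $ i else 0) *
      (case p of (r, y) \<Rightarrow> if 0 \<le> r \<and> r < t then partial i (v r) y else 0)) =
      (\<lambda>(r, y). if 0 \<le> r \<and> r < t then drift v r y else 0)"
    by (auto simp: fun_eq_iff drift_eq)
  finally show "(\<lambda>(r, y). if 0 \<le> r \<and> r < t then drift v r y else 0) \<in> borel_measurable borel" .
  fix r y assume r: "0 \<le> r \<and> r < t"
  have "\<bar>drift v r y\<bar> \<le> (\<Sum>i\<in>UNIV. \<bar>B r y $ i\<bar> * \<bar>partial i (v r) y\<bar>)"
    unfolding drift_eq abs_mult[symmetric] by (rule sum_abs)
  also have "\<dots> \<le> (\<Sum>i\<in>(UNIV :: 'n set). b * (D * weight \<gamma> \<rho> t r))"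
    using r v B_bound b by (intro sum_mono mult_mono) (auto simp: admissible_def)
  finally show "\<bar>drift v r y\<bar> \<le> real CARD('n) * b * D * weight \<gamma> \<rho> t r" by (simp add: mult.assoc)
qed

lemma drift_diff:
  assumes v: "admissible \<gamma> \<rho> t D v" and w: "admissible \<gamma> \<rho> t E w" and r: "0 \<le> r" "r < t"
  shows "drift (\<lambda>s x. v s x - w s x) r = (\<lambda>y. drift v r y - drift w r y)"
proof
  fix y
  have "has_partial i (v r) y" "has_partial i (w r) y" for i
    using v w r by (auto simp: admissible_def Cb1_def)
  then show "drift (\<lambda>s x. v s x - w s x) r y = drift v r y - drift w r y"
    unfolding drift_eq by (simp add: has_partial_diff(2) right_diff_distrib sum_subtractf)
qed

lemma \<Phi>_cong:
  assumes "\<And>r. 0 \<le> r \<Longrightarrow> r < t \<Longrightarrow> v r = w r" "0 \<le> s"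
  shows "\<Phi> v s x = \<Phi> w s x"
proof -
  have "drift v r = drift w r" if "0 \<le> r" "r < t" for r
    using assms(1)[OF that] by (auto simp: drift_def)
  then show ?thesis
    unfolding \<Phi>_def duhamel_def using assms(2) by (intro set_lebesgue_integral_cong) auto
qed

lemma v_iter_Suc_eq: "v_iter R B u0 t (Suc n) = \<Phi> (v_iter R B u0 t n)"
  by (simp add: \<Phi>_def duhamel_def[abs_def] drift_def[abs_def])

lemma mild_solution_iff:
  "mild_solution R B u0 t u \<longleftrightarrow> (\<forall>s\<in>{0..t}. \<forall>x.
     set_integrable lborel {s..<t} (\<lambda>r. R s r (drift u r) x) \<and> u s x = R s t u0 x + \<Phi> u s x)"
  unfolding mild_solution_def \<Phi>_def duhamel_def drift_def[abs_def] ..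

lemma \<Phi>_terminal: "\<Phi> v t x = 0"
  by (simp add: \<Phi>_def duhamel_def set_lebesgue_integral_def)

context
  fixes \<rho> :: real assumes \<rho>: "0 \<le> \<rho>"
begin

lemma \<Phi>_diff:
  assumes v: "admissible \<gamma> \<rho> t D v" and w: "admissible \<gamma> \<rho> t E w" and s: "0 \<le> s" "s < t"
  shows "\<Phi> (\<lambda>s x. v s x - w s x) s x = \<Phi> v s x - \<Phi> w s x"
proof -
  note sv = drift_source[OF v] and sw = drift_source[OF w]
  note iv = duhamel_set_integrable[OF sv t(2) \<rho> s, unfolded set_Ico_eq_Ioo]
    and iw = duhamel_set_integrable[OF sw t(2) \<rho> s, unfolded set_Ico_eq_Ioo]
  have "R s r (drift (\<lambda>s x. v s x - w s x) r) x = R s r (drift v r) x - R s r (drift w r) x" if "r \<in> {s<..<t}" for r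
  proof -
    have r: "0 \<le> r" "r < t" "s < r" "r \<le> T" using that s t by auto
    show ?thesis
      unfolding drift_diff[OF v w r(1,2)]
      by (rule R_diff[OF s(1) r(3,4)]) (rule source_bounded_borel[OF sv r(1,2)], rule source_bounded_borel[OF sw r(1,2)])
  qed
  then have "\<Phi> (\<lambda>s x. v s x - w s x) s x = (LINT r:{s<..<t}|lborel. R s r (drift v r) x - R s r (drift w r) x)"
    unfolding \<Phi>_def duhamel_def set_Ico_eq_Ioo by (intro set_lebesgue_integral_cong) auto
  also have "\<dots> = \<Phi> v s x - \<Phi> w s x"
    unfolding \<Phi>_def duhamel_def set_Ico_eq_Ioo by (rule set_integral_diff(2)[OF iv iw])
  finally show ?thesis .
qed

text \<open>Bounds values in terms of the gradient constant: the weight is integrable in time, so no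
  singularity at \<open>t\<close> remains.\<close>

definition sup_const :: real where
  "sup_const = real CARD('n) * b * (exp (\<rho> * T) * Beta 1 (1 - \<gamma>) * T powr (1 - \<gamma>))"

lemma \<Phi>_bound:
  assumes v: "admissible \<gamma> \<rho> t D v" and D: "0 \<le> D" and s: "0 \<le> s" "s < t"
  shows "\<bar>\<Phi> v s x\<bar> \<le> sup_const * D"
proof -
  have "0 \<le> real CARD('n) * b * D" using b D by simp
  from duhamel_bound[OF drift_source[OF v] t(2) \<rho> s this, of x] show ?thesis
    unfolding \<Phi>_def sup_const_def by (simp only: mult_ac)
qed

text \<open>One application of \<open>\<Phi>\<close> is to halve the gradient constant: the left
  side is the bound of \<open>duhamel_partial_le\<close> for a unit gradient constant.\<close>

context
  assumes contraction: "\<And>s. 0 \<le> s \<Longrightarrow> s < t \<Longrightarrow>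
    C * (real CARD('n) * b) * (LINT r:{s<..<t}|lborel. (r - s) powr (- \<gamma>) * weight \<gamma> \<rho> t r) \<le> 1/2 * weight \<gamma> \<rho> t s"
begin

lemma \<Phi>_admissible:
  assumes v: "admissible \<gamma> \<rho> t D v" and D: "0 \<le> D"
  shows "admissible \<gamma> \<rho> t (D * (1/2)) (\<Phi> v)"
  unfolding admissible_def
proof (intro conjI allI impI)
  note src = drift_source[OF v]
  have D': "0 \<le> real CARD('n) * b * D" using b D by simp
  show "continuous_on {0..<t} (\<lambda>s. \<Phi> v s x)" for x
    unfolding \<Phi>_def by (rule duhamel_continuous[OF src t(2) \<rho>])
  fix s assume s: "0 \<le> s \<and> s < t"
  then show "Cb1 (\<Phi> v s)"
    unfolding \<Phi>_def by (intro duhamel_Cb1[OF src t(2) \<rho> _ _ D']) auto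
  fix x i
  have "\<bar>partial i (\<Phi> v s) x\<bar> \<le> C * (real CARD('n) * b * D) * (LINT r:{s<..<t}|lborel. (r - s) powr (- \<gamma>) * weight \<gamma> \<rho> t r)"
    unfolding \<Phi>_def by (rule duhamel_partial_le[OF src t(2) \<rho>]) (use s in auto)
  also have "\<dots> = D * (C * (real CARD('n) * b) * (LINT r:{s<..<t}|lborel. (r - s) powr (- \<gamma>) * weight \<gamma> \<rho> t r))"
    by (simp only: mult_ac)
  also have "\<dots> \<le> D * (1/2 * weight \<gamma> \<rho> t s)"
    by (intro mult_left_mono contraction D) (use s in auto)
  finally show "\<bar>partial i (\<Phi> v s) x\<bar> \<le> D * (1/2) * weight \<gamma> \<rho> t s" by simp
qed

lemma weight_ge: "0 \<le> s \<Longrightarrow> s < t \<Longrightarrow> (t - s) powr (- \<gamma>) \<le> weight \<gamma> \<rho> t s"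
  unfolding weight_def using \<rho> by (simp add: mult_le_cancel_right1)

text \<open>A fixed point inherits the halved constant from its own image, so
  \<open>D * (1/2) ^ n\<close> is a gradient constant for every \<open>n\<close>; the sup bound then
  forces 0.\<close>

theorem fixed_point_unique:
  assumes d: "admissible \<gamma> \<rho> t D d" and D: "0 \<le> D"
    and fp: "\<And>s x. 0 \<le> s \<Longrightarrow> s < t \<Longrightarrow> d s x = \<Phi> d s x" and s: "0 \<le> s" "s < t"
  shows "d s x = 0"
proof -
  have adm: "admissible \<gamma> \<rho> t (D * (1/2) ^ n) d" for n
  proof (induction n)
    case (Suc n)
    have "admissible \<gamma> \<rho> t (D * (1/2) ^ n * (1/2)) (\<Phi> d)"
      by (rule \<Phi>_admissible[OF Suc]) (use D in simp)
    then have "admissible \<gamma> \<rho> t (D * (1/2) ^ n * (1/2)) d"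
      by (rule admissible_cong) (use fp in \<open>auto simp: fun_eq_iff\<close>)
    then show ?case by (simp add: mult_ac)
  qed (use d in simp)
  have "\<bar>d s x\<bar> \<le> sup_const * (D * (1/2) ^ n)" for n
    using \<Phi>_bound[OF adm _ s, of n x] D fp[OF s, of x] by simp
  moreover have "(\<lambda>n. sup_const * (D * (1/2) ^ n)) \<longlonglongrightarrow> sup_const * (D * 0)"
    by (intro tendsto_intros LIMSEQ_realpow_zero) auto
  ultimately have "\<bar>d s x\<bar> \<le> sup_const * (D * 0)"
    by (intro LIMSEQ_le_const) auto
  then show ?thesis by simp
qed

text \<open>Embeds the uniqueness class, after time reversal, into the class on which
  \<open>\<Phi>\<close> contracts; the exponential factor only enlarges the weight, so the pure
  power bound suffices.\<close>

lemma Lambda1_admissible: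
  assumes "(\<lambda>s. w (t - s)) \<in> Lambda1 \<gamma> t"
  obtains D where "0 \<le> D" "admissible \<gamma> \<rho> t D w"
proof -
  have cont: "continuous_on {0<..t} (\<lambda>s. w (t - s) x)" and cb: "s \<in> {0<..t} \<Longrightarrow> Cb1 (w (t - s))"
    and bdd: "bdd_above ((\<lambda>s. s powr \<gamma> * ((SUP x. \<bar>w (t - s) x\<bar>) + (SUP i. SUP x. \<bar>partial i (w (t - s)) x\<bar>))) ` {0<..t})"
    for x s
    using assms by (auto simp: Lambda1_def)
  obtain D where "\<forall>y\<in>(\<lambda>s. s powr \<gamma> * ((SUP x. \<bar>w (t - s) x\<bar>) + (SUP i. SUP x. \<bar>partial i (w (t - s)) x\<bar>))) ` {0<..t}. y \<le> D"
    using bdd unfolding bdd_above_def by blast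
  then have D: "s powr \<gamma> * ((SUP x. \<bar>w (t - s) x\<bar>) + (SUP i. SUP x. \<bar>partial i (w (t - s)) x\<bar>)) \<le> D"
    if "s \<in> {0<..t}" for s
    using that by blast
  \<comment> \<open>The bound taken from \<open>bdd_above\<close> comes without a sign, hence
    \<open>max 0 D\<close>.\<close>
  have le: "\<bar>partial i (w s) x\<bar> \<le> max 0 D * weight \<gamma> \<rho> t s" if s: "0 \<le> s" "s < t" for s i x
  proof -
    let ?s = "t - s"
    have s': "?s \<in> {0<..t}" "0 < ?s" "t - ?s = s" using s by auto
    have cbs: "Cb1 (w s)" using cb[OF s'(1)] by simp
    have bd: "bdd_above (range (\<lambda>x. \<bar>w s x\<bar>))" "bdd_above (range (\<lambda>x. \<bar>partial i (w s) x\<bar>))" for i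
      using Cb1D(2,5)[OF cbs] by (auto simp: bounded_iff bdd_above_def)
    have "0 \<le> \<bar>w s undefined\<bar>" by simp
    also have "\<dots> \<le> (SUP x. \<bar>w s x\<bar>)" by (rule cSUP_upper[OF UNIV_I bd(1)])
    finally have 1: "0 \<le> (SUP x. \<bar>w s x\<bar>)" .
    have "\<bar>partial i (w s) x\<bar> \<le> (SUP x. \<bar>partial i (w s) x\<bar>)" by (rule cSUP_upper[OF UNIV_I bd(2)])
    also have "\<dots> \<le> (SUP i. SUP x. \<bar>partial i (w s) x\<bar>)"
      by (rule cSUP_upper[OF UNIV_I]) (simp add: bdd_above_finite)
    finally have "?s powr \<gamma> * \<bar>partial i (w s) x\<bar> \<le> ?s powr \<gamma> * ((SUP x. \<bar>w s x\<bar>) + (SUP i. SUP x. \<bar>partial i (w s) x\<bar>))"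
      using 1 by (intro mult_left_mono) auto
    also have "\<dots> \<le> max 0 D" using D[OF s'(1)] s'(3) by simp
    finally have "\<bar>partial i (w s) x\<bar> \<le> max 0 D * ?s powr (- \<gamma>)"
      using s'(2) by (simp add: powr_minus_divide pos_le_divide_eq mult.commute)
    also have "\<dots> \<le> max 0 D * weight \<gamma> \<rho> t s"
      by (intro mult_left_mono weight_ge s) auto
    finally show ?thesis .
  qed
  have "continuous_on {0..<t} (\<lambda>s. w s x)" for x
  proof -
    have "continuous_on {0..<t} (\<lambda>s. w (t - (t - s)) x)"
      by (rule continuous_on_compose2[OF cont]) (auto intro!: continuous_intros)
    then show ?thesis by simp
  qed
  moreover have "Cb1 (w s)" if "0 \<le> s" "s < t" for s
    using cb[of "t - s"] that by simp
  ultimately show thesis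
    using le by (intro that[of "max 0 D"]) (auto simp: admissible_def)
qed

text \<open>\<open>s powr \<gamma>\<close> cancels the singular power of the weight, leaving
  \<open>exp (\<rho> * s)\<close>; the values contribute \<open>t powr \<gamma> * K\<close>.\<close>

lemma admissible_Lambda1:
  assumes u: "admissible \<gamma> \<rho> t D u" and K: "\<And>s x. 0 \<le> s \<Longrightarrow> s < t \<Longrightarrow> \<bar>u s x\<bar> \<le> K" and D: "0 \<le> D"
  shows "(\<lambda>s. u (t - s)) \<in> Lambda1 \<gamma> t"
proof -
  have "continuous_on ({0<..t} \<times> UNIV) (\<lambda>p. (\<lambda>(s, x). u s x) (t - fst p, snd p))"
    by (rule continuous_on_compose2[OF admissible_continuous[OF u]]) (auto intro!: continuous_intros)
  then have "continuous_on ({0<..t} \<times> UNIV) (\<lambda>(s, x). u (t - s) x)"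
    by (simp add: case_prod_unfold)
  then have 1: "(\<lambda>(s, x). u (t - s) x) \<in> borel_measurable (restrict_space borel ({0<..t} \<times> UNIV))"
    by (rule borel_measurable_continuous_on_restrict)
  have 2: "continuous_on {0<..t} (\<lambda>s. u (t - s) x)" for x
    by (rule continuous_on_compose2[of "{0..<t}" "\<lambda>s. u s x"])
      (use u in \<open>auto simp: admissible_def intro!: continuous_intros\<close>)
  have 3: "Cb1 (u (t - s))" if "s \<in> {0<..t}" for s
    using u that by (auto simp: admissible_def)
  have K0: "0 \<le> K" using order_trans[OF abs_ge_zero K[of 0]] t by simp
  have "s powr \<gamma> * ((SUP x. \<bar>u (t - s) x\<bar>) + (SUP i. SUP x. \<bar>partial i (u (t - s)) x\<bar>)) \<le>
      t powr \<gamma> * K + D * exp (\<rho> * t)" if s: "s \<in> {0<..t}" for s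
  proof -
    have s': "0 \<le> t - s" "t - s < t" "0 < s" "s \<le> t" using s by auto
    have a: "(SUP x. \<bar>u (t - s) x\<bar>) \<le> K"
      by (rule cSUP_least) (use K[OF s'(1,2)] in auto)
    have b: "(SUP i. SUP x. \<bar>partial i (u (t - s)) x\<bar>) \<le> D * weight \<gamma> \<rho> t (t - s)"
      by (intro cSUP_least) (use u s' in \<open>auto simp: admissible_def\<close>)
    have "s powr \<gamma> * ((SUP x. \<bar>u (t - s) x\<bar>) + (SUP i. SUP x. \<bar>partial i (u (t - s)) x\<bar>)) \<le>
        s powr \<gamma> * (K + D * weight \<gamma> \<rho> t (t - s))"
      by (intro mult_left_mono add_mono a b) auto
    also have "\<dots> = s powr \<gamma> * K + D * exp (\<rho> * s)"
      using s' by (simp add: weight_def distrib_left powr_minus_divide)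
    also have "\<dots> \<le> t powr \<gamma> * K + D * exp (\<rho> * t)"
      using s' gamma K0 D \<rho> by (intro add_mono mult_right_mono mult_left_mono powr_mono2) (auto intro!: mult_left_mono)
    finally show ?thesis .
  qed
  then have "bdd_above ((\<lambda>s. s powr \<gamma> * ((SUP x. \<bar>u (t - s) x\<bar>) + (SUP i. SUP x. \<bar>partial i (u (t - s)) x\<bar>))) ` {0<..t})"
    by (intro bdd_aboveI2)
  with 1 2 3 show ?thesis by (simp add: Lambda1_def)
qed

theorem series_solution:
  fixes v :: "nat \<Rightarrow> real \<Rightarrow> real^'n \<Rightarrow> real"
  defines "v \<equiv> v_iter R B u0 t"
  shows "uniformly_convergent_on ({0..t} \<times> UNIV) (\<lambda>m (s, x). \<Sum>n<m. v n s x)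
    \<and> (\<forall>t0\<in>{0<..<t}.
          uniformly_convergent_on ({0..t0} \<times> UNIV) (\<lambda>m (s, x). \<Sum>n<m. gradient (v n s) x))
    \<and> (\<exists>u. mild_solution R B u0 t u \<and> (\<lambda>s. u (t - s)) \<in> Lambda1 \<gamma> t
          \<and> (\<forall>w. mild_solution R B u0 t w \<and> (\<lambda>s. w (t - s)) \<in> Lambda1 \<gamma> t
                \<longrightarrow> (\<forall>s\<in>{0..t}. \<forall>x. w s x = u s x))
          \<and> (\<forall>s\<in>{0..t}. \<forall>x. (\<lambda>n. v n s x) sums u s x))"
proof (intro conjI)
  obtain c where c0: "0 \<le> c" and c: "\<And>x. \<bar>u0 x\<bar> \<le> c"
    using u0 by (rule bounded_borelE) blast
  define D where "D = C * c"
  have D0: "0 \<le> D" using C c0 by (simp add: D_def)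
  have v0: "v 0 s x = R s t u0 x" for s x by (simp add: v_def)
  have vSuc: "v (Suc n) = \<Phi> (v n)" for n unfolding v_def by (rule v_iter_Suc_eq)
  have adm: "admissible \<gamma> \<rho> t (D * (1/2) ^ n) (v n)" for n
  proof (induction n)
    case 0
    have "\<bar>partial i (R s t u0) x\<bar> \<le> D * weight \<gamma> \<rho> t s" if s: "0 \<le> s" "s < t" for s x i
    proof -
      have "\<bar>partial i (R s t u0) x\<bar> \<le> D * (t - s) powr (- \<gamma>)"
        using R_partial[OF s t(2) u0 c, of i x] by (simp add: D_def mult_ac)
      also have "\<dots> \<le> D * weight \<gamma> \<rho> t s" by (intro mult_left_mono weight_ge s D0)
      finally show ?thesis .
    qed
    then show ?case
      unfolding admissible_def v0 using R_Cb1[OF _ _ t(2) u0] R_cont[OF t u0]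
      by (auto simp: v_def)
  next
    case (Suc n)
    have "admissible \<gamma> \<rho> t (D * (1/2) ^ n * (1/2)) (\<Phi> (v n))"
      by (rule \<Phi>_admissible[OF Suc]) (use D0 in simp)
    then show ?case by (simp add: vSuc mult_ac)
  qed
  define S where "S = sup_const"
  have S0: "0 \<le> S"
  proof -
    have "0 < Beta 1 (1 - \<gamma>)" using gamma by (simp add: Beta_def Gamma_real_pos)
    then show ?thesis unfolding S_def sup_const_def using b by (intro mult_nonneg_nonneg) auto
  qed
  \<comment> \<open>Includes \<open>s = t\<close>, where \<open>\<Phi>\<close> is an integral over
    the empty set; this makes the convergence uniform up to the closed end point.\<close>
  have vb: "\<bar>v (Suc n) s x\<bar> \<le> S * D * (1/2) ^ n" if "0 \<le> s" "s \<le> t" for n s x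
  proof (cases "s = t")
    case True
    then show ?thesis using S0 D0 by (simp add: vSuc \<Phi>_terminal)
  next
    case False
    then show ?thesis
      using \<Phi>_bound[OF adm _ that(1), of n x] that D0 by (simp add: vSuc S_def mult_ac)
  qed
  \<comment> \<open>One constant for all \<open>n\<close>: \<open>c\<close> serves the zeroth term,
    and \<open>2 * S * D\<close> compensates the index shift in \<open>vb\<close>.\<close>
  define K where "K = c + 2 * S * D"
  have vK: "\<bar>v n s x\<bar> \<le> K * (1/2) ^ n" if s: "0 \<le> s" "s < t" for n s x
  proof (cases n)
    case 0
    then show ?thesis
      using R_bound[OF s t(2) u0 c, of x] mult_nonneg_nonneg[OF S0 D0] by (simp add: v0 K_def)
  next
    case (Suc j)
    have "\<bar>v (Suc j) s x\<bar> \<le> S * D * (1/2) ^ j"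
      by (rule vb) (use s in auto)
    also have "\<dots> \<le> K * (1/2) ^ Suc j"
      using c0 by (simp add: K_def distrib_right)
    finally show ?thesis unfolding Suc .
  qed
  have geo: "summable (\<lambda>n. a * (1/2) ^ n :: real)" for a :: real
    by (auto intro!: summable_mult summable_geometric)
  show "uniformly_convergent_on ({0..t} \<times> UNIV) (\<lambda>m (s, x). \<Sum>n<m. v n s x)"
  proof -
    have "uniformly_convergent_on ({0..t} \<times> UNIV) (\<lambda>m p. \<Sum>n<m. case p of (s, x) \<Rightarrow> v n s x)"
    \<comment> \<open>The comparison starts at \<open>n = 1\<close>: at \<open>s = t\<close> the
      zeroth term involves \<open>R t t\<close>, outside the range of the locale
      assumptions.\<close>
    proof (rule Weierstrass_m_test'_ev[OF _ geo[of "2 * S * D"]])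
      show "eventually (\<lambda>n. \<forall>p\<in>{0..t} \<times> UNIV. norm (case p of (s, x) \<Rightarrow> v n s x) \<le> 2 * S * D * (1/2) ^ n) sequentially"
      proof (rule eventually_sequentiallyI[of 1], clarify)
        fix n :: nat and s x assume "1 \<le> n" "s \<in> {0..t}"
        then show "norm (v n s x) \<le> 2 * S * D * (1/2) ^ n"
          using vb[of s "n - 1" x] by (cases n) auto
      qed
    qed
    then show ?thesis by (simp add: case_prod_unfold)
  qed
  show "\<forall>t0\<in>{0<..<t}. uniformly_convergent_on ({0..t0} \<times> UNIV) (\<lambda>m (s, x). \<Sum>n<m. gradient (v n s) x)"
  proof
    fix t0 assume t0: "t0 \<in> {0<..<t}"
    \<comment> \<open>On \<open>[0, t0]\<close> the two factors of the weight are maximal at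
      opposite ends, the exponential at \<open>s = 0\<close> and the power at
      \<open>s = t0\<close>.\<close>
    let ?M = "real CARD('n) * (D * (exp (\<rho> * t) * (t - t0) powr (- \<gamma>)))"
    have "uniformly_convergent_on ({0..t0} \<times> UNIV) (\<lambda>m p. \<Sum>n<m. case p of (s, x) \<Rightarrow> gradient (v n s) x)"
    proof (rule Weierstrass_m_test'[OF _ geo[of ?M]])
      fix n and p :: "real \<times> (real^'n)" assume p: "p \<in> {0..t0} \<times> UNIV"
      obtain s x where sx: "p = (s, x)" "0 \<le> s" "s \<le> t0" using p by auto
      have st: "s < t" using sx t0 by auto
      have "weight \<gamma> \<rho> t s \<le> exp (\<rho> * t) * (t - t0) powr (- \<gamma>)"
        unfolding weight_def
      proof (rule mult_mono)
        show "exp (\<rho> * (t - s)) \<le> exp (\<rho> * t)" using sx \<rho> by (simp add: mult_left_mono)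
        show "(t - s) powr (- \<gamma>) \<le> (t - t0) powr (- \<gamma>)" using sx t0 gamma by (intro powr_mono2') auto
      qed auto
      then have w: "D * (1/2) ^ n * weight \<gamma> \<rho> t s \<le> D * (1/2) ^ n * (exp (\<rho> * t) * (t - t0) powr (- \<gamma>))"
        using D0 by (intro mult_left_mono) auto
      have "norm (gradient (v n s) x) \<le> (\<Sum>i\<in>UNIV. \<bar>gradient (v n s) x $ i\<bar>)"
        by (rule norm_le_l1_cart)
      also have "\<dots> \<le> (\<Sum>i\<in>(UNIV :: 'n set). D * (1/2) ^ n * (exp (\<rho> * t) * (t - t0) powr (- \<gamma>)))"
        using adm[of n] sx st by (intro sum_mono) (auto simp: gradient_def admissible_def intro: order_trans[OF _ w])
      also have "\<dots> = ?M * (1/2) ^ n" by simp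
      finally show "norm (case p of (s, x) \<Rightarrow> gradient (v n s) x) \<le> ?M * (1/2) ^ n" by (simp add: sx)
    qed
    then show "uniformly_convergent_on ({0..t0} \<times> UNIV) (\<lambda>m (s, x). \<Sum>n<m. gradient (v n s) x)"
      by (simp add: case_prod_unfold)
  qed
  define u where "u s x = (\<Sum>n. v n s x)" for s x
  have summ: "summable (\<lambda>n. v n s x)" if "0 \<le> s" "s \<le> t" for s x
  proof -
    have "summable (\<lambda>n. v (Suc n) s x)"
      by (rule summable_comparison_test'[OF geo[of "S * D"], of 0]) (use vb that in auto)
    then show ?thesis by (subst (asm) summable_Suc_iff)
  qed
  \<comment> \<open>\<open>\<Phi>_diff\<close> handles finitely many terms only. The tails are
    admissible with constants tending to 0, so peeling off finitely many terms and then passing to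
    the limit replaces an interchange of \<open>\<Phi>\<close> with the series.\<close>
  have tail: "admissible \<gamma> \<rho> t (2 * (D * (1/2) ^ m)) (\<lambda>s x. \<Sum>n. v (n + m) s x)" for m
  proof (rule admissible_suminf[where K="K * (1/2) ^ m"])
    show "admissible \<gamma> \<rho> t (D * (1/2) ^ m * (1/2) ^ n) (v (n + m))" for n
      using adm[of "n + m"] by (simp add: power_add mult_ac)
    show "\<bar>v (n + m) s x\<bar> \<le> K * (1/2) ^ m * (1/2) ^ n" if "0 \<le> s" "s < t" for n s x
      using vK[OF that, of "n + m" x] by (simp add: power_add mult_ac)
  qed
  have adm_u: "admissible \<gamma> \<rho> t (2 * D) u"
    using tail[of 0] by (simp add: u_def[abs_def])
  have step: "\<Phi> (\<lambda>s x. \<Sum>n. v (n + m) s x) s x = v (Suc m) s x + \<Phi> (\<lambda>s x. \<Sum>n. v (n + Suc m) s x) s x"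
    if s: "0 \<le> s" "s < t" for m s x
  proof -
    have "\<Phi> (\<lambda>s x. \<Sum>n. v (n + Suc m) s x) s x = \<Phi> (\<lambda>s x. (\<Sum>n. v (n + m) s x) - v m s x) s x"
    proof (rule \<Phi>_cong[OF _ s(1)])
      fix r assume r: "0 \<le> r" "r < t"
      have "(\<Sum>n. v (n + m) r y) = v m r y + (\<Sum>n. v (n + Suc m) r y)" for y
        using suminf_split_head[of "\<lambda>n. v (n + m) r y"] summable_ignore_initial_segment[OF summ[of r y], of m] r by simp
      then show "(\<lambda>y. \<Sum>n. v (n + Suc m) r y) = (\<lambda>y. (\<Sum>n. v (n + m) r y) - v m r y)"
        by (simp add: fun_eq_iff)
    qed
    also have "\<dots> = \<Phi> (\<lambda>s x. \<Sum>n. v (n + m) s x) s x - v (Suc m) s x"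
      unfolding vSuc by (rule \<Phi>_diff[OF tail adm s])
    finally show ?thesis by simp
  qed
  have partial_sums: "\<Phi> u s x = (\<Sum>n<m. v (Suc n) s x) + \<Phi> (\<lambda>s x. \<Sum>n. v (n + m) s x) s x"
    if s: "0 \<le> s" "s < t" for m s x
  proof (induction m)
    case 0 show ?case by (simp add: u_def[abs_def])
  next
    case (Suc m) then show ?case using step[OF s, of m x] by simp
  qed
  have u_eq: "u s x = v 0 s x + \<Phi> u s x" if s: "0 \<le> s" "s \<le> t" for s x
  proof -
    have "(\<lambda>n. v (Suc n) s x) sums \<Phi> u s x"
    proof (cases "s = t")
      case True
      then show ?thesis by (simp add: vSuc \<Phi>_terminal)
    next
      case False
      then have st: "s < t" using s by simp
      have "(\<lambda>m. \<Phi> (\<lambda>s x. \<Sum>n. v (n + m) s x) s x) \<longlonglongrightarrow> 0"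
      proof (rule Lim_null_comparison)
        show "eventually (\<lambda>m. norm (\<Phi> (\<lambda>s x. \<Sum>n. v (n + m) s x) s x) \<le> S * (2 * (D * (1/2) ^ m))) sequentially"
          using \<Phi>_bound[OF tail _ s(1) st] D0 by (intro always_eventually allI) (simp add: S_def)
        have "(\<lambda>m. S * (2 * (D * (1/2) ^ m))) \<longlonglongrightarrow> S * (2 * (D * 0))"
          by (intro tendsto_intros LIMSEQ_realpow_zero) auto
        then show "(\<lambda>m. S * (2 * (D * (1/2) ^ m))) \<longlonglongrightarrow> 0" by simp
      qed
      then have "(\<lambda>m. \<Phi> u s x - \<Phi> (\<lambda>s x. \<Sum>n. v (n + m) s x) s x) \<longlonglongrightarrow> \<Phi> u s x - 0"
        by (intro tendsto_intros)
      moreover have "\<Phi> u s x - \<Phi> (\<lambda>s x. \<Sum>n. v (n + m) s x) s x = (\<Sum>n<m. v (Suc n) s x)" for m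
        using partial_sums[OF s(1) st, of x m] by simp
      ultimately show ?thesis by (simp add: sums_def)
    qed
    from sums_unique[OF this] show ?thesis
      unfolding u_def using suminf_split_head[OF summ[OF s, of x]] by simp
  qed
  have Dint: "set_integrable lborel {s..<t} (\<lambda>r. R s r (drift u r) x)" if "0 \<le> s" "s \<le> t" for s x
  proof (cases "s = t")
    case False
    then show ?thesis
      by (intro duhamel_set_integrable[OF drift_source[OF adm_u] t(2) \<rho>]) (use that in auto)
  qed (simp add: set_integrable_def)
  have mild: "mild_solution R B u0 t u"
    unfolding mild_solution_iff using Dint u_eq by (auto simp: v0)
  have uK: "\<bar>u s x\<bar> \<le> 2 * K" if s: "0 \<le> s" "s < t" for s x
  proof -
    have "norm (\<Sum>n. v n s x) \<le> (\<Sum>n. K * (1/2) ^ n)"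
      by (rule norm_suminf_le[OF _ geo]) (use vK[OF s] in auto)
    also have "\<dots> = 2 * K" by (simp add: suminf_mult suminf_geometric summable_geometric)
    finally show ?thesis by (simp add: u_def)
  qed
  have lam: "(\<lambda>s. u (t - s)) \<in> Lambda1 \<gamma> t"
    by (rule admissible_Lambda1[OF adm_u uK]) (use D0 in auto)
  show "\<exists>u. mild_solution R B u0 t u \<and> (\<lambda>s. u (t - s)) \<in> Lambda1 \<gamma> t
          \<and> (\<forall>w. mild_solution R B u0 t w \<and> (\<lambda>s. w (t - s)) \<in> Lambda1 \<gamma> t
                \<longrightarrow> (\<forall>s\<in>{0..t}. \<forall>x. w s x = u s x))
          \<and> (\<forall>s\<in>{0..t}. \<forall>x. (\<lambda>n. v n s x) sums u s x)"
  proof (intro exI[of _ u] conjI mild lam allI impI ballI)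
    show "(\<lambda>n. v n s x) sums u s x" if "s \<in> {0..t}" for s x
      unfolding u_def using summ that by (intro summable_sums) auto
    fix w s x assume w: "mild_solution R B u0 t w \<and> (\<lambda>s. w (t - s)) \<in> Lambda1 \<gamma> t" and s: "s \<in> {0..t}"
    from w obtain E where E: "0 \<le> E" "admissible \<gamma> \<rho> t E w" by (auto elim: Lambda1_admissible)
    have w_eq: "w s x = R s t u0 x + \<Phi> w s x" if "0 \<le> s" "s \<le> t" for s x
      using w that by (auto simp: mild_solution_iff)
    show "w s x = u s x"
    proof (cases "s = t")
      case True
      then show ?thesis using w_eq[of t x] u_eq[of t x] t by (simp add: \<Phi>_terminal v0)
    next
      case False
      have "w s x - u s x = 0"
      \<comment> \<open>The terms with \<open>u0\<close> cancel in the difference, leaving the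
        homogeneous equation.\<close>
      proof (rule fixed_point_unique[OF admissible_diff[OF E(2) adm_u]])
        fix s x assume s: "0 \<le> s" "s < t"
        show "w s x - u s x = \<Phi> (\<lambda>s x. w s x - u s x) s x"
          using w_eq[of s x] u_eq[of s x] s \<Phi>_diff[OF E(2) adm_u s, of x] by (simp add: v0)
      qed (use E D0 s False in auto)
      then show ?thesis by simp
    qed
  qed
qed

end

end

end

section \<open>The transition operators\<close>

lemma exp_conv_self [simp]: "exp_conv l s s p = 0"
  by (simp add: exp_conv_def set_lebesgue_integral_def)

text \<open>Time is discretised by \<open>U n r\<close>, strictly to the right of \<open>r\<close>
  with countably many values, and right-continuity of \<open>Lr\<close> gives the limit;
  \<open>max s r\<close> keeps the interval of integration well oriented.\<close>

lemma (in subordinated_noise) measurable_exp_conv_Lr_joint: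
  assumes s: "0 \<le> s"
  shows "(\<lambda>(r, \<omega>). exp_conv l s (max s r) (\<lambda>q. Lr q \<omega>)) \<in> borel_measurable (borel \<Otimes>\<^sub>M M)"
proof -
  define U where "U n r = (of_int \<lfloor>r * real (Suc n)\<rfloor> + 1) / real (Suc n)" for n and r :: real
  have U: "r < U n r" "U n r \<le> r + 1 / real (Suc n)" for n r
  proof -
    have "r * real (Suc n) < of_int \<lfloor>r * real (Suc n)\<rfloor> + 1" by linarith
    then show "r < U n r" unfolding U_def by (simp only: pos_less_divide_eq of_nat_0_less_iff zero_less_Suc)
    have "(of_int \<lfloor>r * real (Suc n)\<rfloor> + 1) / real (Suc n) \<le> (r * real (Suc n) + 1) / real (Suc n)"
      by (intro divide_right_mono) auto
    then show "U n r \<le> r + 1 / real (Suc n)" unfolding U_def by (simp add: add_divide_distrib del: of_nat_Suc)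
  qed
  have Ulim: "(\<lambda>n. U n r) \<longlonglongrightarrow> r" for r
  proof (rule tendsto_sandwich[OF _ _ tendsto_const])
    show "(\<lambda>n. r + 1 / real (Suc n)) \<longlonglongrightarrow> r"
      using tendsto_add[OF tendsto_const LIMSEQ_Suc[OF lim_1_over_n], of r] by simp
  qed (use U in \<open>auto intro!: always_eventually less_imp_le\<close>)
  let ?f = "\<lambda>n p. exp_conv l s (max s (U n (fst p))) (\<lambda>q. Lr q (snd p))"
  have one: "(\<lambda>\<omega>. exp_conv l s (max s r) (\<lambda>q. Lr q \<omega>)) \<in> borel_measurable M" for r
    by (cases "s < r") (use measurable_exp_conv_Lr[OF s, of r l] in \<open>auto simp: max_def\<close>)
  have fm: "?f n \<in> borel_measurable (borel \<Otimes>\<^sub>M M)" for n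
  proof -
    have 1: "(\<lambda>p. exp_conv l s (max s ((of_int j + 1) / real (Suc n))) (\<lambda>q. Lr q (snd p))) \<in> borel_measurable (borel \<Otimes>\<^sub>M M)" for j :: int
      by (rule measurable_compose[OF measurable_snd one])
    have 2: "(\<lambda>p. \<lfloor>fst p * real (Suc n)\<rfloor>) \<in> borel \<Otimes>\<^sub>M M \<rightarrow>\<^sub>M count_space UNIV"
      by measurable
    from measurable_compose_countable[OF 1 2] show ?thesis unfolding U_def .
  qed
  show ?thesis
  proof (rule borel_measurable_LIMSEQ_real[OF _ fm])
    fix p :: "real \<times> 'w"
    obtain r \<omega> where p: "p = (r, \<omega>)" by (cases p)
    have mU: "(\<lambda>n. max s (U n r)) \<longlonglongrightarrow> max s r" by (intro tendsto_intros Ulim)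
    have "(\<lambda>n. exp_conv l s (max s (U n r)) (\<lambda>q. Lr q \<omega>)) \<longlonglongrightarrow> exp_conv l s (max s r) (\<lambda>q. Lr q \<omega>)"
    proof (rule exp_conv_tendsto[OF set_integrable_mono[OF mono_Lr], where a=s and b="max s r + 1"])
      have le1: "1 / real (Suc n) \<le> 1" for n by simp
      show "max s (U n r) \<le> max s r + 1" for n using U(2)[of n r] le1[of n] by linarith
      have "continuous (at (max s r) within {max s r..}) (\<lambda>q. Lr q \<omega>)"
        using Lr_right_continuous[of "max s r" \<omega>] s by (simp add: continuous_within at_within_Ici_at_right)
      then show "(\<lambda>n. Lr (max s (U n r)) \<omega>) \<longlonglongrightarrow> Lr (max s r) \<omega>"
        by (rule continuous_within_tendsto_compose'[OF _ _ mU]) (simp_all only: atLeast_iff, intro max.mono order_refl less_imp_le U)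
    qed (use mU in auto)
    then show "(\<lambda>n. ?f n p) \<longlonglongrightarrow> (case p of (r, \<omega>) \<Rightarrow> exp_conv l s (max s r) (\<lambda>q. Lr q \<omega>))"
      by (simp add: p)
  qed
qed

lemma sigma_finite_coord_lborel: "sigma_finite_measure (coord_lborel :: ('n::finite \<Rightarrow> real) measure)"
  by (rule coord_lborel.sigma_finite) simp

lemma measurable_gauss_op:
  fixes m :: "'a \<Rightarrow> real^'n::finite"
  assumes k: "(\<lambda>p. k (fst p) (snd p)) \<in> borel_measurable (N \<Otimes>\<^sub>M borel)"
    and s: "\<And>i. (\<lambda>a. s a i) \<in> borel_measurable N" and m: "m \<in> borel_measurable N"
  shows "(\<lambda>a. gauss_op (k a) (s a) (m a)) \<in> borel_measurable N"
    "(\<lambda>a. gauss_op_deriv i (k a) (s a) (m a)) \<in> borel_measurable N"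
proof -
  have c: "(\<lambda>p. snd p j) \<in> borel_measurable (N \<Otimes>\<^sub>M (coord_lborel :: ('n \<Rightarrow> real) measure))" for j
    by measurable
  have s': "(\<lambda>p. s (fst p) j) \<in> borel_measurable (N \<Otimes>\<^sub>M (coord_lborel :: ('n \<Rightarrow> real) measure))" for j
    by (rule measurable_compose[OF measurable_fst s])
  have m': "(\<lambda>p. m (fst p)) \<in> borel_measurable (N \<Otimes>\<^sub>M (coord_lborel :: ('n \<Rightarrow> real) measure))"
    by (rule measurable_compose[OF measurable_fst m])
  have "(\<lambda>p. (fst p, vec_lambda (snd p))) \<in> N \<Otimes>\<^sub>M (coord_lborel :: ('n \<Rightarrow> real) measure) \<rightarrow>\<^sub>M N \<Otimes>\<^sub>M borel"
    by (intro measurable_Pair measurable_fst measurable_compose[OF measurable_snd measurable_vec_lambda_coord])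
  from measurable_compose[OF this k]
  have k': "(\<lambda>p. k (fst p) (vec_lambda (snd p))) \<in> borel_measurable (N \<Otimes>\<^sub>M (coord_lborel :: ('n \<Rightarrow> real) measure))"
    by simp
  have g: "(\<lambda>p. gauss_density (s (fst p)) (m (fst p)) (snd p)) \<in> borel_measurable (N \<Otimes>\<^sub>M (coord_lborel :: ('n \<Rightarrow> real) measure))"
    by (rule measurable_gauss_density[OF s' m' c])
  have m'': "(\<lambda>p. m (fst p) $ i) \<in> borel_measurable (N \<Otimes>\<^sub>M (coord_lborel :: ('n \<Rightarrow> real) measure))"
    by (rule measurable_compose[OF m' measurable_vec_nth])
  have g': "(\<lambda>p. gauss_density_deriv i (s (fst p)) (m (fst p)) (snd p)) \<in> borel_measurable (N \<Otimes>\<^sub>M (coord_lborel :: ('n \<Rightarrow> real) measure))"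
    unfolding gauss_density_deriv_def
    by (intro borel_measurable_times borel_measurable_divide borel_measurable_diff borel_measurable_power g c s' m'')
  show "(\<lambda>a. gauss_op (k a) (s a) (m a)) \<in> borel_measurable N"
    unfolding gauss_op_def
    by (rule sigma_finite_measure.borel_measurable_lebesgue_integral[OF sigma_finite_coord_lborel])
      (use borel_measurable_times[OF k' g] in \<open>simp add: case_prod_unfold\<close>)
  show "(\<lambda>a. gauss_op_deriv i (k a) (s a) (m a)) \<in> borel_measurable N"
    unfolding gauss_op_deriv_def
    by (rule sigma_finite_measure.borel_measurable_lebesgue_integral[OF sigma_finite_coord_lborel])
      (use borel_measurable_times[OF k' g'] in \<open>simp add: case_prod_unfold\<close>)
qed

section \<open>Gaussian mixture form of the transition operators\<close>

locale ou_setting = stable_noise M W L \<alpha> \<gamma>bar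
  for M :: "'w measure" and W :: "real \<Rightarrow> 'w \<Rightarrow> real^'n::finite" and L :: "real \<Rightarrow> 'w \<Rightarrow> real" and \<alpha> \<gamma>bar :: real +
  fixes lam sig :: "'n \<Rightarrow> real" and f :: "real \<Rightarrow> real^'n" and T :: real
    and Z :: "real \<Rightarrow> real^'n \<Rightarrow> real \<Rightarrow> 'w \<Rightarrow> real^'n"
  assumes lam: "\<And>i. 0 < lam i" and sig: "\<And>i. 0 < sig i"
    and f: "continuous_on {0..T} f"
    and Z: "\<And>s x. s \<in> {0..T} \<Longrightarrow>
        linear_SDE_solution M (- diag_matrix lam) f (diag_matrix sig) (subordinated W L) T s x (Z s x)"
begin

abbreviation R :: "real \<Rightarrow> real \<Rightarrow> (real^'n \<Rightarrow> real) \<Rightarrow> real^'n \<Rightarrow> real" where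
  "R \<equiv> transition_op M Z"

text \<open>Conditional variance of the \<open>i\<close>-th noise integral given the clock, up to
  the factor \<open>(sig i)\<^sup>2\<close>; the rate is doubled because the kernel is
  squared.\<close>

definition var :: "real \<Rightarrow> real \<Rightarrow> 'w \<Rightarrow> 'n \<Rightarrow> real" where
  "var s t \<omega> i = exp_conv (2 * lam i) s t (\<lambda>r. Lr r \<omega>)"

definition sd :: "real \<Rightarrow> real \<Rightarrow> 'w \<Rightarrow> 'n \<Rightarrow> real" where
  "sd s t \<omega> i = sig i * sqrt (var s t \<omega> i)"

definition mean :: "real \<Rightarrow> real \<Rightarrow> real^'n \<Rightarrow> real^'n" where
  "mean s t x = (\<chi> i. exp (- lam i * (t - s)) * x $ i + exp_conv (lam i) s t (primitive f i))"

lemma measurable_Z: "0 \<le> s \<Longrightarrow> s \<le> t \<Longrightarrow> t \<le> T \<Longrightarrow> Z s x t \<in> borel_measurable M"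
  using Z[of s x] by (auto simp: linear_SDE_solution_def)

lemma measurable_sd: "0 \<le> s \<Longrightarrow> s < t \<Longrightarrow> (\<lambda>\<omega>. sd s t \<omega> i) \<in> borel_measurable M"
  unfolding sd_def var_def using measurable_exp_conv_Lr[of s t "2 * lam i"] by measurable

lemma var_lower_bound:
  assumes "s \<le> t"
  shows "exp (- (2 * lam i) * (t - s)) * (Lr t \<omega> - Lr s \<omega>) \<le> var s t \<omega> i"
  unfolding var_def by (rule exp_conv_mono_lower_bound[OF mono_Lr assms]) (use lam[of i] in simp)

lemma AE_sd_pos:
  assumes st: "0 \<le> s" "s < t"
  shows "AE \<omega> in M. \<forall>i. 0 < sd s t \<omega> i"
  using AE_Lr_increment_pos[OF st]
proof eventually_elim
  case (elim \<omega>)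
  show ?case
  proof
    fix i
    have "0 < exp (- (2 * lam i) * (t - s)) * (Lr t \<omega> - Lr s \<omega>)" using elim by simp
    also have "\<dots> \<le> var s t \<omega> i" by (rule var_lower_bound) (use st in simp)
    finally show "0 < sd s t \<omega> i" using sig[of i] by (simp add: sd_def)
  qed
qed

text \<open>Where all deviations are positive the standard Gaussian form equals the density form;
  this holds almost surely since increments of the clock are positive.\<close>

lemma R_eq_gauss:
  assumes st: "0 \<le> s" "s < t" "t \<le> T" and \<phi>: "bounded_borel \<phi>"
  shows "R s t \<phi> x = (LINT \<omega>|M. gauss_op \<phi> (sd s t \<omega>) (mean s t x))"
proof -
  have \<phi>m: "\<phi> \<in> borel_measurable borel" using \<phi> by (simp add: bounded_borel_def)
  have "AE \<omega> in M. \<forall>t\<in>{s..T}. \<forall>i. Z s x t \<omega> $ i = exp (- lam i * (t - s)) * x $ i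
      + exp_conv (lam i) s t (primitive f i) + sig i * exp_conv (lam i) s t (\<lambda>r. subordinated W L r \<omega> $ i)"
    by (rule linear_SDE_solution_component[OF Z f]) (use st lam sig in \<open>auto simp: less_imp_neq[symmetric]\<close>)
  then have eq: "AE \<omega> in M. \<forall>i. Z s x t \<omega> $ i = mean s t x $ i + sig i * exp_conv (lam i) s t (\<lambda>r. W (L r \<omega>) \<omega> $ i)"
    by eventually_elim (use st in \<open>simp add: mean_def subordinated_def\<close>)
  have "R s t \<phi> x = (LINT \<omega>|M. LINT g|std_gauss. \<phi> (\<chi> i. mean s t x $ i + sig i * (sqrt (var s t \<omega> i) * g i)))"
    unfolding transition_op_def var_def
    by (rule noise_law[OF \<phi> st(1,2) measurable_Z eq]) (use st in auto)
  also have "\<dots> = (LINT \<omega>|M. gauss_op \<phi> (sd s t \<omega>) (mean s t x))"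
  proof (rule integral_cong_AE)
    show "(\<lambda>\<omega>. LINT g|std_gauss. \<phi> (\<chi> i. mean s t x $ i + sig i * (sqrt (var s t \<omega> i) * g i))) \<in> borel_measurable M"
      by (rule sigma_finite_measure.borel_measurable_lebesgue_integral[OF prob_space_imp_sigma_finite[OF prob_space_std_gauss]],
          rule measurable_gauss_mixture[OF _ \<phi>m]) (use measurable_exp_conv_Lr[OF st(1,2)] in \<open>simp add: var_def\<close>)
    show "(\<lambda>\<omega>. gauss_op \<phi> (sd s t \<omega>) (mean s t x)) \<in> borel_measurable M"
      by (intro measurable_gauss_op(1) measurable_compose[OF measurable_snd \<phi>m] measurable_sd st borel_measurable_const)
    show "AE \<omega> in M. (LINT g|std_gauss. \<phi> (\<chi> i. mean s t x $ i + sig i * (sqrt (var s t \<omega> i) * g i))) =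
        gauss_op \<phi> (sd s t \<omega>) (mean s t x)"
      using AE_sd_pos[OF st(1,2)]
      by eventually_elim (simp add: gauss_op_eq_std_gauss[OF _ \<phi>m] sd_def mult.assoc)
  qed
  finally show ?thesis .
qed

lemma measurable_gauss_op_sd:
  assumes st: "0 \<le> s" "s < t" and \<phi>: "bounded_borel \<phi>"
  shows "(\<lambda>\<omega>. gauss_op \<phi> (sd s t \<omega>) m) \<in> borel_measurable M"
    "(\<lambda>\<omega>. gauss_op_deriv i \<phi> (sd s t \<omega>) m) \<in> borel_measurable M"
proof -
  have \<phi>m: "\<phi> \<in> borel_measurable borel" using \<phi> by (simp add: bounded_borel_def)
  show "(\<lambda>\<omega>. gauss_op \<phi> (sd s t \<omega>) m) \<in> borel_measurable M"
    "(\<lambda>\<omega>. gauss_op_deriv i \<phi> (sd s t \<omega>) m) \<in> borel_measurable M"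
    by (intro measurable_gauss_op measurable_compose[OF measurable_snd \<phi>m] measurable_sd st borel_measurable_const)+
qed

text \<open>The chain rule factor \<open>exp (- lam i * (t - s))\<close> cancels exactly the square
  root of the lower bound on the variance, so the constant depends on neither time nor
  \<open>lam\<close>.\<close>

lemma scaled_deriv_bound:
  assumes st: "0 \<le> s" "s < t" and \<phi>: "bounded_borel \<phi>" "\<And>y. \<bar>\<phi> y\<bar> \<le> c"
    and \<omega>: "0 < Lr t \<omega> - Lr s \<omega>" "\<forall>i. 0 < sd s t \<omega> i"
  shows "\<bar>exp (- lam i * (t - s)) * gauss_op_deriv i \<phi> (sd s t \<omega>) m\<bar> \<le>
    c * (sqrt (2 / pi) / sig i) * (1 / sqrt (Lr t \<omega> - Lr s \<omega>))"
proof -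
  let ?a = "exp (- lam i * (t - s))" and ?d = "Lr t \<omega> - Lr s \<omega>"
  have c0: "0 \<le> c" using order_trans[OF abs_ge_zero \<phi>(2)] .
  have "?a * sqrt ?d = sqrt (exp (- (2 * lam i) * (t - s)) * ?d)"
  proof -
    have "exp (- (2 * lam i) * (t - s)) = ?a\<^sup>2" by (simp add: power2_eq_square exp_add[symmetric] algebra_simps)
    then show ?thesis by (simp add: real_sqrt_mult)
  qed
  also have "\<dots> \<le> sqrt (var s t \<omega> i)"
    using var_lower_bound[of s t i \<omega>] st by simp
  finally have "sig i * (?a * sqrt ?d) \<le> sd s t \<omega> i"
    unfolding sd_def by (intro mult_left_mono) (use sig[of i] in auto)
  then have le: "?a / sd s t \<omega> i \<le> 1 / (sig i * sqrt ?d)"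
    using sig[of i] \<omega> by (simp add: divide_simps mult_ac)
  have "\<bar>gauss_op_deriv i \<phi> (sd s t \<omega>) m\<bar> \<le> c * (sqrt (2 / pi) / sd s t \<omega> i)"
    by (rule gauss_op_deriv_bound) (use \<omega> \<phi> in \<open>auto simp: bounded_borel_def\<close>)
  then have "?a * \<bar>gauss_op_deriv i \<phi> (sd s t \<omega>) m\<bar> \<le> ?a * (c * (sqrt (2 / pi) / sd s t \<omega> i))"
    by (intro mult_left_mono) auto
  also have "\<dots> = c * sqrt (2 / pi) * (?a / sd s t \<omega> i)" by simp
  also have "\<dots> \<le> c * sqrt (2 / pi) * (1 / (sig i * sqrt ?d))"
    by (intro mult_left_mono le) (use c0 in auto)
  also have "\<dots> = c * (sqrt (2 / pi) / sig i) * (1 / sqrt ?d)" by simp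
  finally show ?thesis by (simp add: abs_mult)
qed

lemma gauss_op_sd_bound:
  assumes "bounded_borel \<phi>" "\<And>y. \<bar>\<phi> y\<bar> \<le> c" "\<forall>i. 0 < sd s t \<omega> i"
  shows "norm (gauss_op \<phi> (sd s t \<omega>) m) \<le> c"
  unfolding real_norm_def by (rule gauss_op_bound) (use assms in \<open>auto simp: bounded_borel_def\<close>)

text \<open>\<open>x\<close> enters only through the mean, affinely, with slope
  \<open>exp (- lam i * (t - s))\<close>. The majorant is random, and integrable by the inverse
  square root moment of the increment.\<close>

lemma R_partial_eq:
  assumes st: "0 \<le> s" "s < t" "t \<le> T" and \<phi>: "bounded_borel \<phi>"
  shows "has_partial i (R s t \<phi>) x"
    "partial i (R s t \<phi>) x = (LINT \<omega>|M. exp (- lam i * (t - s)) * gauss_op_deriv i \<phi> (sd s t \<omega>) (mean s t x))"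
proof -
  obtain c where c: "\<And>y. \<bar>\<phi> y\<bar> \<le> c" using \<phi> by (rule bounded_borelE) blast
  let ?a = "exp (- lam i * (t - s))"
  have mean_shift: "mean s t (x + h *\<^sub>R axis i 1) = mean s t x + (?a * h) *\<^sub>R axis i 1" for h
    by (simp add: mean_def vec_eq_iff axis_def algebra_simps)
  let ?F = "\<lambda>h \<omega>. gauss_op \<phi> (sd s t \<omega>) (mean s t x + (?a * h) *\<^sub>R axis i 1)"
  let ?D = "\<lambda>h \<omega>. ?a * gauss_op_deriv i \<phi> (sd s t \<omega>) (mean s t x + (?a * h) *\<^sub>R axis i 1)"
  let ?g = "\<lambda>\<omega>. c * (sqrt (2 / pi) / sig i) * (1 / sqrt (Lr t \<omega> - Lr s \<omega>))"
  have "((\<lambda>h. LINT \<omega>|M. ?F h \<omega>) has_real_derivative (LINT \<omega>|M. ?D 0 \<omega>)) (at 0)"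
  proof (rule has_real_derivative_integral[where g="?g"])
    show "integrable M (?F h)" for h
      by (rule integrable_const_bound[where B=c, OF _ measurable_gauss_op_sd(1)[OF st(1,2) \<phi>]])
        (use AE_sd_pos[OF st(1,2)] in eventually_elim, rule gauss_op_sd_bound[OF \<phi> c])
    show "?D 0 \<in> borel_measurable M"
      by (intro borel_measurable_times borel_measurable_const measurable_gauss_op_sd(2) st \<phi>)
    show "integrable M ?g"
      by (intro integrable_mult_right inv_sqrt_Lr_increment(1) st)
    show "AE \<omega> in M. \<forall>h. \<bar>h\<bar> < 1 \<longrightarrow> ((\<lambda>h. ?F h \<omega>) has_real_derivative ?D h \<omega>) (at h) \<and> \<bar>?D h \<omega>\<bar> \<le> ?g \<omega>"
      using AE_sd_pos[OF st(1,2)] AE_Lr_increment_pos[OF st(1,2)]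
    proof eventually_elim
      case (elim \<omega>)
      show ?case
      proof (intro allI impI conjI)
        fix h :: real
        show "\<bar>?D h \<omega>\<bar> \<le> ?g \<omega>" by (rule scaled_deriv_bound[OF st(1,2) \<phi> c elim(2,1)])
        have "((\<lambda>k. gauss_op \<phi> (sd s t \<omega>) (mean s t x + (?a * h) *\<^sub>R axis i 1 + k *\<^sub>R axis i 1)) has_real_derivative
          gauss_op_deriv i \<phi> (sd s t \<omega>) (mean s t x + (?a * h) *\<^sub>R axis i 1)) (at (?a * (h - h)))"
          using gauss_op_has_derivative[of "sd s t \<omega>" \<phi> "mean s t x + (?a * h) *\<^sub>R axis i 1" i] elim(1) \<phi> by simp
        moreover have "((\<lambda>h'. ?a * (h' - h)) has_real_derivative ?a) (at h)"
          by (auto intro!: derivative_eq_intros)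
        ultimately have "((\<lambda>h'. gauss_op \<phi> (sd s t \<omega>) (mean s t x + (?a * h) *\<^sub>R axis i 1 + (?a * (h' - h)) *\<^sub>R axis i 1)) has_real_derivative
          gauss_op_deriv i \<phi> (sd s t \<omega>) (mean s t x + (?a * h) *\<^sub>R axis i 1) * ?a) (at h)"
          by (rule DERIV_chain2)
        note der = this
        have shift: "mean s t x + (?a * h) *\<^sub>R axis i 1 + (?a * (h' - h)) *\<^sub>R axis i 1 = mean s t x + (?a * h') *\<^sub>R axis i 1" for h'
          by (simp only: add.assoc scaleR_left_distrib[symmetric]) (simp add: right_diff_distrib)
        from der[unfolded shift] show "((\<lambda>h. ?F h \<omega>) has_real_derivative ?D h \<omega>) (at h)"
          by (simp only: mult.commute)
      qed
    qed
  qed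
  then have der: "((\<lambda>h. R s t \<phi> (x + h *\<^sub>R axis i 1)) has_real_derivative
      (LINT \<omega>|M. ?a * gauss_op_deriv i \<phi> (sd s t \<omega>) (mean s t x))) (at 0)"
    unfolding R_eq_gauss[OF st \<phi>] mean_shift by simp
  show "has_partial i (R s t \<phi>) x"
    "partial i (R s t \<phi>) x = (LINT \<omega>|M. ?a * gauss_op_deriv i \<phi> (sd s t \<omega>) (mean s t x))"
    using has_partialI[OF der] by auto
qed

text \<open>Summing over coordinates instead of taking a maximum gives one constant valid for every
  partial derivative.\<close>

definition gradient_const :: real where
  "gradient_const = (\<Sum>i\<in>UNIV. sqrt (2 / pi) / sig i) * inv_sqrt_moment"

lemma inv_sqrt_moment_nonneg: "0 \<le> inv_sqrt_moment"
  by (simp add: inv_sqrt_moment_def)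

lemma R_partial_le:
  assumes st: "0 \<le> s" "s < t" "t \<le> T" and \<phi>: "bounded_borel \<phi>" "\<And>y. \<bar>\<phi> y\<bar> \<le> c"
  shows "\<bar>partial i (R s t \<phi>) x\<bar> \<le> gradient_const * (t - s) powr (- (1 / (2 * \<alpha>))) * c"
proof -
  let ?f = "\<lambda>\<omega>. exp (- lam i * (t - s)) * gauss_op_deriv i \<phi> (sd s t \<omega>) (mean s t x)"
  let ?g = "\<lambda>\<omega>. c * (sqrt (2 / pi) / sig i) * (1 / sqrt (Lr t \<omega> - Lr s \<omega>))"
  have c0: "0 \<le> c" using order_trans[OF abs_ge_zero \<phi>(2)] .
  have le: "AE \<omega> in M. norm (?f \<omega>) \<le> ?g \<omega>"
    using AE_sd_pos[OF st(1,2)] AE_Lr_increment_pos[OF st(1,2)]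
  proof eventually_elim
    case (elim \<omega>)
    show ?case unfolding real_norm_def by (rule scaled_deriv_bound[OF st(1,2) \<phi> elim(2,1)])
  qed
  have g: "integrable M ?g" by (intro integrable_mult_right inv_sqrt_Lr_increment(1) st)
  have f: "integrable M ?f"
    by (rule Bochner_Integration.integrable_bound[OF g])
      (intro borel_measurable_times borel_measurable_const measurable_gauss_op_sd(2) st \<phi>(1),
       use le in eventually_elim, use abs_ge_self order_trans in \<open>fastforce simp only: real_norm_def\<close>)
  have "\<bar>partial i (R s t \<phi>) x\<bar> \<le> (LINT \<omega>|M. norm (?f \<omega>))"
    unfolding R_partial_eq(2)[OF st \<phi>(1)] real_norm_def[symmetric] by (rule integral_norm_bound)
  also have "\<dots> \<le> (LINT \<omega>|M. ?g \<omega>)"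
    by (rule integral_mono_AE[OF integrable_norm[OF f] g le])
  also have "\<dots> = c * (sqrt (2 / pi) / sig i) * (inv_sqrt_moment * (t - s) powr (- (1 / (2 * \<alpha>))))"
    by (simp only: integral_mult_right_zero inv_sqrt_Lr_increment(2)[OF st(1,2)])
  also have "\<dots> = (sqrt (2 / pi) / sig i) * (c * inv_sqrt_moment * (t - s) powr (- (1 / (2 * \<alpha>))))"
    by (simp only: mult_ac)
  also have "\<dots> \<le> (\<Sum>i\<in>UNIV. sqrt (2 / pi) / sig i) * (c * inv_sqrt_moment * (t - s) powr (- (1 / (2 * \<alpha>))))"
    by (intro mult_right_mono member_le_sum)
      (use sig c0 inv_sqrt_moment_nonneg in \<open>auto simp: less_imp_le\<close>)
  finally show ?thesis by (simp only: gradient_const_def mult_ac)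
qed

lemma tendsto_mean: "X \<longlonglongrightarrow> x \<Longrightarrow> (\<lambda>n. mean s t (X n)) \<longlonglongrightarrow> mean s t x"
  unfolding mean_def by (intro vec_tendstoI) (auto intro!: tendsto_intros)

lemma R_bounded:
  assumes st: "0 \<le> s" "s < t" "t \<le> T" and \<phi>: "bounded_borel \<phi>" "\<And>y. \<bar>\<phi> y\<bar> \<le> c"
  shows "\<bar>R s t \<phi> x\<bar> \<le> c"
proof -
  have "(\<lambda>\<omega>. \<phi> (Z s x t \<omega>)) \<in> borel_measurable M"
    by (rule measurable_compose[OF measurable_Z]) (use \<phi>(1) st in \<open>auto simp: bounded_borel_def\<close>)
  then have "integrable M (\<lambda>\<omega>. \<phi> (Z s x t \<omega>))"
    by (intro integrable_const_bound[where B=c]) (use \<phi>(2) in auto)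
  then have "(LINT \<omega>|M. \<bar>\<phi> (Z s x t \<omega>)\<bar>) \<le> (LINT \<omega>|M. c)"
    by (intro integral_mono) (use \<phi>(2) in auto)
  also have "(LINT \<omega>|M. c) = c" by (simp add: prob_space)
  finally show ?thesis
    unfolding transition_op_def by (rule order_trans[OF integral_abs_bound])
qed

lemma R_is_Cb1:
  assumes st: "0 \<le> s" "s < t" "t \<le> T" and \<phi>: "bounded_borel \<phi>"
  shows "Cb1 (R s t \<phi>)"
proof -
  obtain c where c: "\<And>y. \<bar>\<phi> y\<bar> \<le> c" using \<phi> by (rule bounded_borelE) blast
  have c1: "continuous_on UNIV (R s t \<phi>)"
    unfolding continuous_on_sequentially
  proof (intro allI ballI impI, elim conjE)
    fix x and X :: "nat \<Rightarrow> real^'n" assume X: "X \<longlonglongrightarrow> x"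
    have "(\<lambda>n. LINT \<omega>|M. gauss_op \<phi> (sd s t \<omega>) (mean s t (X n))) \<longlonglongrightarrow> (LINT \<omega>|M. gauss_op \<phi> (sd s t \<omega>) (mean s t x))"
    proof (rule integral_dominated_convergence[where w="\<lambda>_. c"])
      show "AE \<omega> in M. (\<lambda>n. gauss_op \<phi> (sd s t \<omega>) (mean s t (X n))) \<longlonglongrightarrow> gauss_op \<phi> (sd s t \<omega>) (mean s t x)"
        using AE_sd_pos[OF st(1,2)]
        by eventually_elim (intro tendsto_gauss_op(1) tendsto_const tendsto_mean X \<phi>, auto)
      show "AE \<omega> in M. norm (gauss_op \<phi> (sd s t \<omega>) (mean s t (X n))) \<le> c" for n
        using AE_sd_pos[OF st(1,2)]
        by eventually_elim (rule gauss_op_sd_bound[OF \<phi> c])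
    qed (use measurable_gauss_op_sd(1)[OF st(1,2) \<phi>] in auto)
    then show "(R s t \<phi> \<circ> X) \<longlonglongrightarrow> R s t \<phi> x" by (simp add: o_def R_eq_gauss[OF st \<phi>])
  qed
  have c2: "continuous_on UNIV (partial i (R s t \<phi>))" for i
    unfolding continuous_on_sequentially
  proof (intro allI ballI impI, elim conjE)
    fix x and X :: "nat \<Rightarrow> real^'n" assume X: "X \<longlonglongrightarrow> x"
    let ?a = "exp (- lam i * (t - s))"
    let ?g = "\<lambda>\<omega>. c * (sqrt (2 / pi) / sig i) * (1 / sqrt (Lr t \<omega> - Lr s \<omega>))"
    have "(\<lambda>n. LINT \<omega>|M. ?a * gauss_op_deriv i \<phi> (sd s t \<omega>) (mean s t (X n))) \<longlonglongrightarrow>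
        (LINT \<omega>|M. ?a * gauss_op_deriv i \<phi> (sd s t \<omega>) (mean s t x))"
    proof (rule integral_dominated_convergence[where w="?g"])
      show "AE \<omega> in M. (\<lambda>n. ?a * gauss_op_deriv i \<phi> (sd s t \<omega>) (mean s t (X n))) \<longlonglongrightarrow> ?a * gauss_op_deriv i \<phi> (sd s t \<omega>) (mean s t x)"
        using AE_sd_pos[OF st(1,2)]
        by eventually_elim (intro tendsto_mult tendsto_gauss_op(2) tendsto_const tendsto_mean X \<phi>, auto)
      show "AE \<omega> in M. norm (?a * gauss_op_deriv i \<phi> (sd s t \<omega>) (mean s t (X n))) \<le> ?g \<omega>" for n
        using AE_sd_pos[OF st(1,2)] AE_Lr_increment_pos[OF st(1,2)]
      proof eventually_elim
        case (elim \<omega>)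
        show ?case unfolding real_norm_def by (rule scaled_deriv_bound[OF st(1,2) \<phi> c elim(2,1)])
      qed
      show "integrable M ?g" by (intro integrable_mult_right inv_sqrt_Lr_increment(1) st)
    qed (use measurable_gauss_op_sd(2)[OF st(1,2) \<phi>] in auto)
    then show "(partial i (R s t \<phi>) \<circ> X) \<longlonglongrightarrow> partial i (R s t \<phi>) x"
      by (simp add: o_def R_partial_eq(2)[OF st \<phi>])
  qed
  have "bounded (range (R s t \<phi>))"
    unfolding bounded_iff using R_bounded[OF st \<phi> c] by auto
  moreover have "bounded (range (partial i (R s t \<phi>)))" for i
    unfolding bounded_iff using R_partial_le[OF st \<phi> c, of i] by auto
  ultimately show ?thesis
    unfolding Cb1_def using c1 c2 R_partial_eq(1)[OF st \<phi>] by blast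
qed

lemma set_integrable_primitive: "set_integrable lborel {0..T} (primitive f i)"
  by (rule borel_integrable_atLeastAtMost') (rule primitive_facts(1)[OF f])

lemma tendsto_mean_time:
  assumes "\<And>n. 0 \<le> S n" "\<And>n. S n \<le> U n" "\<And>n. U n \<le> T" "S \<longlonglongrightarrow> s" "U \<longlonglongrightarrow> t"
  shows "(\<lambda>n. mean (S n) (U n) x) \<longlonglongrightarrow> mean s t x"
proof -
  have st: "0 \<le> s" "s \<le> t" "t \<le> T"
    using assms by (auto intro: LIMSEQ_le_const LIMSEQ_le_const2 LIMSEQ_le)
  have p: "(\<lambda>n. primitive f i (S n)) \<longlonglongrightarrow> primitive f i s" "(\<lambda>n. primitive f i (U n)) \<longlonglongrightarrow> primitive f i t" for i
  proof -
    have mem: "S n \<in> {0..T}" "U n \<in> {0..T}" for n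
      using assms(1)[of n] assms(2)[of n] assms(3)[of n] by auto
    show "(\<lambda>n. primitive f i (S n)) \<longlonglongrightarrow> primitive f i s"
      by (rule continuous_on_tendsto_compose[OF primitive_facts(1)[OF f] assms(4)]) (use mem st in auto)
    show "(\<lambda>n. primitive f i (U n)) \<longlonglongrightarrow> primitive f i t"
      by (rule continuous_on_tendsto_compose[OF primitive_facts(1)[OF f] assms(5)]) (use mem st in auto)
  qed
  have "(\<lambda>n. exp_conv (lam i) (S n) (U n) (primitive f i)) \<longlonglongrightarrow> exp_conv (lam i) s t (primitive f i)" for i
    by (rule exp_conv_tendsto[OF set_integrable_primitive]) (use assms st p in auto)
  then show ?thesis
    unfolding mean_def by (intro vec_tendstoI) (auto intro!: tendsto_intros assms)
qed

text \<open>Paths of the clock are only right-continuous, but a fixed time is almost surely no jump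
  time, so the variances converge along any sequence \<open>S n\<close>; as the sequence is
  countable, positivity holds for all \<open>n\<close> off one null set.\<close>

lemma R_continuous_time:
  assumes t: "0 < t" "t \<le> T" and \<phi>: "bounded_borel \<phi>"
  shows "continuous_on {0..<t} (\<lambda>s. R s t \<phi> x)"
  unfolding continuous_on_sequentially
proof (intro allI ballI impI, elim conjE)
  fix s and S :: "nat \<Rightarrow> real" assume s: "s \<in> {0..<t}" and Sn: "\<forall>n. S n \<in> {0..<t}" and S: "S \<longlonglongrightarrow> s"
  obtain c where c: "\<And>y. \<bar>\<phi> y\<bar> \<le> c" using \<phi> by (rule bounded_borelE) blast
  have Sn': "0 \<le> S n" "S n < t" for n using Sn by auto
  have s': "0 \<le> s" "s < t" using s by auto
  have "(\<lambda>n. LINT \<omega>|M. gauss_op \<phi> (sd (S n) t \<omega>) (mean (S n) t x)) \<longlonglongrightarrow> (LINT \<omega>|M. gauss_op \<phi> (sd s t \<omega>) (mean s t x))"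
  proof (rule integral_dominated_convergence[where w="\<lambda>_. c"])
    have posn: "AE \<omega> in M. \<forall>n. \<forall>i. 0 < sd (S n) t \<omega> i"
      by (rule AE_all_countable[THEN iffD2], intro allI, rule AE_sd_pos[OF Sn'])
    show "AE \<omega> in M. (\<lambda>n. gauss_op \<phi> (sd (S n) t \<omega>) (mean (S n) t x)) \<longlonglongrightarrow> gauss_op \<phi> (sd s t \<omega>) (mean s t x)"
      using posn AE_sd_pos[OF s'] AE_isCont_Lr[OF s'(1)]
    proof eventually_elim
      case (elim \<omega>)
      have "(\<lambda>n. Lr (S n) \<omega>) \<longlonglongrightarrow> Lr s \<omega>" by (rule isCont_tendsto_compose[OF elim(3) S])
      then have "(\<lambda>n. var (S n) t \<omega> i) \<longlonglongrightarrow> var s t \<omega> i" for i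
        unfolding var_def
        by (intro exp_conv_tendsto[OF set_integrable_mono[OF mono_Lr], where a=0 and b=t])
          (use Sn' s' S in \<open>auto simp: less_imp_le\<close>)
      then have "(\<lambda>n. sd (S n) t \<omega> i) \<longlonglongrightarrow> sd s t \<omega> i" for i
        unfolding sd_def by (intro tendsto_intros)
      moreover have "(\<lambda>n. mean (S n) t x) \<longlonglongrightarrow> mean s t x"
        by (rule tendsto_mean_time) (use Sn' t S in \<open>auto simp: less_imp_le\<close>)
      ultimately show ?case
        by (intro tendsto_gauss_op(1) \<phi>) (use elim in auto)
    qed
    show "AE \<omega> in M. norm (gauss_op \<phi> (sd (S n) t \<omega>) (mean (S n) t x)) \<le> c" for n
      using posn by eventually_elim (intro gauss_op_sd_bound[OF \<phi> c] allI, blast)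
  qed (use measurable_gauss_op_sd(1)[OF _ _ \<phi>] s' Sn' in auto)
  then show "((\<lambda>s. R s t \<phi> x) \<circ> S) \<longlonglongrightarrow> R s t \<phi> x"
    by (simp add: o_def R_eq_gauss[OF s' t(2) \<phi>] R_eq_gauss[OF Sn' t(2) \<phi>])
qed

text \<open>The Gaussian mixture is jointly measurable in time and \<omega>, including the time
  dependence of \<open>k\<close>; integrating over \<omega> leaves a Borel function of time.\<close>

lemma R_measurable_time:
  assumes s: "0 \<le> s" "s < t" "t \<le> T" and k: "(\<lambda>(r, y). k r y) \<in> borel_measurable borel"
    and kb: "\<And>r. s < r \<Longrightarrow> r < t \<Longrightarrow> bounded_borel (k r)"
  shows "(\<lambda>r. indicator {s<..<t} r * R s r (k r) x) \<in> borel_measurable borel"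
proof -
  \<comment> \<open>Clamping times to \<open>[s, t]\<close> extends the mean and the deviations
    measurably to the whole line; the indicator discards the clamped part afterwards.\<close>
  define cl where "cl r = max s (min t r)" for r
  have clm: "(\<lambda>r. min t r) \<in> borel_measurable borel" by measurable
  have k1: "(\<lambda>p. k (fst p) (snd p)) \<in> borel_measurable (borel \<Otimes>\<^sub>M borel)"
    using k by (simp add: borel_prod case_prod_unfold)
  have k2: "(\<lambda>q. k (fst (fst q)) (snd q)) \<in> borel_measurable ((borel \<Otimes>\<^sub>M M) \<Otimes>\<^sub>M borel)"
  proof -
    have 1: "(\<lambda>q. fst (fst q)) \<in> (borel \<Otimes>\<^sub>M M) \<Otimes>\<^sub>M (borel :: (real^'n) measure) \<rightarrow>\<^sub>M borel"
      by (rule measurable_compose[OF measurable_fst measurable_fst])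
    have 2: "snd \<in> (borel \<Otimes>\<^sub>M M) \<Otimes>\<^sub>M (borel :: (real^'n) measure) \<rightarrow>\<^sub>M borel"
      by (rule measurable_snd)
    from measurable_compose[OF measurable_Pair[OF 1 2] k1] show ?thesis by simp
  qed
  have sdm: "(\<lambda>p. sd s (cl (fst p)) (snd p) i) \<in> borel_measurable (borel \<Otimes>\<^sub>M M)" for i
  proof -
    have "(\<lambda>p. (min t (fst p), snd p)) \<in> borel \<Otimes>\<^sub>M M \<rightarrow>\<^sub>M borel \<Otimes>\<^sub>M M"
      by (intro measurable_Pair measurable_compose[OF measurable_fst clm] measurable_snd)
    from measurable_compose[OF this measurable_exp_conv_Lr_joint[OF s(1), of "2 * lam i"]]
    have [measurable]: "(\<lambda>p. var s (cl (fst p)) (snd p) i) \<in> borel_measurable (borel \<Otimes>\<^sub>M M)"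
      by (simp add: var_def cl_def)
    show ?thesis unfolding sd_def by measurable
  qed
  have "continuous_on UNIV (\<lambda>r. mean s (cl r) x)"
    unfolding continuous_on_sequentially
  proof (intro allI ballI impI, elim conjE)
    fix r and Q :: "nat \<Rightarrow> real" assume Q: "Q \<longlonglongrightarrow> r"
    have "(\<lambda>n. mean s (cl (Q n)) x) \<longlonglongrightarrow> mean s (cl r) x"
    proof (rule tendsto_mean_time)
      show "(\<lambda>n. cl (Q n)) \<longlonglongrightarrow> cl r" unfolding cl_def by (intro tendsto_intros Q)
    qed (use s in \<open>auto simp: cl_def\<close>)
    then show "((\<lambda>r. mean s (cl r) x) \<circ> Q) \<longlonglongrightarrow> mean s (cl r) x" by (simp add: o_def)
  qed
  then have "(\<lambda>r. mean s (cl r) x) \<in> borel_measurable borel" by (rule borel_measurable_continuous_onI)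
  then have meanm: "(\<lambda>p. mean s (cl (fst p)) x) \<in> borel_measurable (borel \<Otimes>\<^sub>M M)"
    by (rule measurable_compose[OF measurable_fst])
  have "(\<lambda>p. gauss_op (k (fst p)) (sd s (cl (fst p)) (snd p)) (mean s (cl (fst p)) x)) \<in> borel_measurable (borel \<Otimes>\<^sub>M M)"
    by (rule measurable_gauss_op(1)[OF k2 sdm meanm])
  then have "(\<lambda>r. LINT \<omega>|M. gauss_op (k r) (sd s (cl r) \<omega>) (mean s (cl r) x)) \<in> borel_measurable borel"
    by (intro borel_measurable_lebesgue_integral) (simp add: case_prod_unfold)
  then have "(\<lambda>r. indicator {s<..<t} r * (LINT \<omega>|M. gauss_op (k r) (sd s (cl r) \<omega>) (mean s (cl r) x))) \<in> borel_measurable borel"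
    by measurable
  also have "(\<lambda>r. indicator {s<..<t} r * (LINT \<omega>|M. gauss_op (k r) (sd s (cl r) \<omega>) (mean s (cl r) x))) =
      (\<lambda>r. indicator {s<..<t} r * R s r (k r) x)"
  proof
    fix r
    show "indicator {s<..<t} r * (LINT \<omega>|M. gauss_op (k r) (sd s (cl r) \<omega>) (mean s (cl r) x)) = indicator {s<..<t} r * R s r (k r) x"
    proof (cases "s < r \<and> r < t")
      case True
      then have "cl r = r" by (simp add: cl_def)
      with True R_eq_gauss[of s r "k r" x] kb[of r] s show ?thesis by simp
    qed auto
  qed
  finally show ?thesis .
qed

lemma R_difference:
  assumes st: "0 \<le> s" "s < t" "t \<le> T" and \<phi>: "bounded_borel \<phi>" and \<psi>: "bounded_borel \<psi>"
  shows "R s t (\<lambda>y. \<phi> y - \<psi> y) x = R s t \<phi> x - R s t \<psi> x"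
proof -
  have "integrable M (\<lambda>\<omega>. \<eta> (Z s x t \<omega>))" if \<eta>: "bounded_borel \<eta>" for \<eta> :: "real^'n \<Rightarrow> real"
  proof -
    obtain c where c: "\<And>y. \<bar>\<eta> y\<bar> \<le> c" "\<eta> \<in> borel_measurable borel" using \<eta> by (rule bounded_borelE) blast
    have "(\<lambda>\<omega>. \<eta> (Z s x t \<omega>)) \<in> borel_measurable M"
      by (rule measurable_compose[OF measurable_Z c(2)]) (use st in auto)
    then show ?thesis by (intro integrable_const_bound[where B=c]) (use c in auto)
  qed
  from this[OF \<phi>] this[OF \<psi>] show ?thesis by (simp add: transition_op_def)
qed

sublocale smoothing_evolution R T gradient_const "1 / (2 * \<alpha>)"
proof
  \<comment> \<open>\<alpha> > 1/2 enters here as \<gamma> < 1.\<close>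
  show "0 < 1 / (2 * \<alpha>)" "1 / (2 * \<alpha>) < 1" using alpha by (auto simp: field_simps)
  show "0 \<le> gradient_const"
    unfolding gradient_const_def using sig inv_sqrt_moment_nonneg
    by (intro mult_nonneg_nonneg sum_nonneg) (auto simp: less_imp_le)
qed (fact R_is_Cb1 R_bounded R_partial_le R_difference R_continuous_time R_measurable_time)+

end

section \<open>Checking the hypotheses of the fixed-point argument\<close>

lemma Cb0n_continuous_bounded:
  assumes "Cb0n T n G"
  shows "continuous_on ({0..T} \<times> UNIV) (\<lambda>(t, x). G t x)" "bounded ((\<lambda>(t, x). G t x) ` ({0..T} \<times> UNIV))"
  using assms by (cases n; simp)+

theorem theorem12:
  fixes M :: "'w measure"
    and W :: "real \<Rightarrow> 'w \<Rightarrow> (real, 'n::{finite,linorder}) vec"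
    and L :: "real \<Rightarrow> 'w \<Rightarrow> real"
    and lam sig :: "'n \<Rightarrow> real"
    and Z :: "real \<Rightarrow> (real, 'n) vec \<Rightarrow> real \<Rightarrow> 'w \<Rightarrow> (real, 'n) vec"
    and B0 B :: "real \<Rightarrow> (real, 'n) vec \<Rightarrow> (real, 'n) vec"
    and f :: "real \<Rightarrow> (real, 'n) vec"
    and u0 :: "(real, 'n) vec \<Rightarrow> real"
    and T t \<alpha> \<gamma>bar :: real
    and R :: "real \<Rightarrow> real \<Rightarrow> ((real, 'n) vec \<Rightarrow> real) \<Rightarrow> (real, 'n) vec \<Rightarrow> real"
    and v :: "nat \<Rightarrow> real \<Rightarrow> (real, 'n) vec \<Rightarrow> real"
  assumes T: "0 < T"
    and M: "prob_space M" "complete_measure M"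
    and alpha: "1/2 < \<alpha>" "\<alpha> < 1"
    and W: "standard_brownian_motion M W"
    and gbar: "0 < \<gamma>bar"
    and L: "stable_subordinator M \<alpha> \<gamma>bar L"
    and indep: "independent_processes M L W"
    and lam: "\<And>i. 0 < lam i" "mono lam"
    and sig: "\<And>i. 0 < (sig i)\<^sup>2"
    and f: "continuous_on {0..T} f"
    and Z: "\<And>s x. s \<in> {0..T} \<Longrightarrow>
        linear_SDE_solution M (- diag_matrix lam) f (diag_matrix (\<lambda>i. sqrt ((sig i)\<^sup>2)))
          (subordinated W L) T s x (Z s x)"
    and R_def: "R = transition_op M Z"
    and u0: "bounded_borel u0"
    and B0: "Cb0n T 3 B0"
    and B_def: "B = (\<lambda>r x. B0 r x - f r)"
    and t: "0 < t" "t \<le> T"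
    and v_def: "v = v_iter R B u0 t"
  shows "uniformly_convergent_on ({0..t} \<times> UNIV) (\<lambda>m (s, x). \<Sum>n<m. v n s x)
    \<and> (\<forall>t0\<in>{0<..<t}.
          uniformly_convergent_on ({0..t0} \<times> UNIV) (\<lambda>m (s, x). \<Sum>n<m. gradient (v n s) x))
    \<and> (\<exists>u. mild_solution R B u0 t u \<and> (\<lambda>s. u (t - s)) \<in> Lambda1 (1 / (2 * \<alpha>)) t
          \<and> (\<forall>w. mild_solution R B u0 t w \<and> (\<lambda>s. w (t - s)) \<in> Lambda1 (1 / (2 * \<alpha>)) t
                \<longrightarrow> (\<forall>s\<in>{0..t}. \<forall>x. w s x = u s x))
          \<and> (\<forall>s\<in>{0..t}. \<forall>x. (\<lambda>n. v n s x) sums u s x))"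
proof -
  interpret prob_space M by (rule M)
  \<comment> \<open>The square root of a diagonal entry of \<open>Q\<close> is positive, whichever
    sign \<open>sig i\<close> has.\<close>
  have sig': "0 < sqrt ((sig i)\<^sup>2)" for i using sig[of i] by simp
  interpret ou: ou_setting M W L \<alpha> \<gamma>bar lam "\<lambda>i. sqrt ((sig i)\<^sup>2)" f T Z
    using W L indep alpha gbar lam(1) sig' f Z by unfold_locales (auto simp: stable_subordinator_def)
  have contB: "continuous_on ({0..T} \<times> UNIV) (\<lambda>(r, x). B r x)"
  proof -
    have "continuous_on ({0..T} \<times> (UNIV :: ((real, 'n) vec) set)) (\<lambda>p. f (fst p))"
      by (rule continuous_on_compose2[OF f]) (auto intro!: continuous_intros)
    with Cb0n_continuous_bounded(1)[OF B0] show ?thesis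
      unfolding B_def case_prod_unfold by (rule continuous_on_diff)
  qed
  \<comment> \<open>\<open>B0\<close> is bounded by hypothesis and \<open>f\<close> by compactness
    of \<open>[0, T]\<close>; the two bounds add up.\<close>
  obtain b where b0: "0 \<le> b" and b: "\<And>r y i. 0 \<le> r \<Longrightarrow> r < t \<Longrightarrow> \<bar>B r y $ i\<bar> \<le> b"
  proof -
    obtain b1 where "\<forall>z\<in>(\<lambda>(t, x). B0 t x) ` ({0..T} \<times> UNIV). norm z \<le> b1"
      using Cb0n_continuous_bounded(2)[OF B0] unfolding bounded_iff by blast
    then have b1: "norm (B0 r y) \<le> b1" if "0 \<le> r" "r \<le> T" for r y using that by force
    obtain b2 where "\<forall>z\<in>f ` {0..T}. norm z \<le> b2"
      using compact_imp_bounded[OF compact_continuous_image[OF f]] unfolding bounded_iff by auto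
    then have b2: "norm (f r) \<le> b2" if "0 \<le> r" "r \<le> T" for r using that by force
    have "\<bar>B r y $ i\<bar> \<le> b1 + b2" if "0 \<le> r" "r < t" for r y i
    proof -
      have "\<bar>B r y $ i\<bar> \<le> norm (B r y)" by (rule component_le_norm_cart)
      also have "\<dots> \<le> norm (B0 r y) + norm (f r)" unfolding B_def by (rule norm_triangle_ineq4)
      finally show ?thesis using b1[of r y] b2[of r] that t by simp
    qed
    moreover have "0 \<le> b1 + b2"
      using order_trans[OF norm_ge_zero b1[of 0 undefined]] order_trans[OF norm_ge_zero b2[of 0]] T by simp
    ultimately show thesis using that by blast
  qed
  interpret mp: mild_problem "transition_op M Z" T ou.gradient_const "1 / (2 * \<alpha>)" B b t u0
  proof
    show "(\<lambda>(r, y). if 0 \<le> r \<and> r < t then B r y $ i else 0) \<in> borel_measurable borel" for i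
    proof -
      have "continuous_on ({0..<t} \<times> UNIV) (\<lambda>p. (case p of (r, y) \<Rightarrow> B r y) $ i)"
        by (intro continuous_on_component continuous_on_subset[OF contB]) (use t in auto)
      then have "(\<lambda>p. indicator ({0..<t} \<times> UNIV) p *\<^sub>R ((case p of (r, y) \<Rightarrow> B r y) $ i)) \<in> borel_measurable borel"
        by (rule borel_measurable_continuous_on_indicator[OF sets_borel_strip])
      also have "(\<lambda>p. indicator ({0..<t} \<times> UNIV) p *\<^sub>R ((case p of (r, y) \<Rightarrow> B r y) $ i)) =
          (\<lambda>(r, y). if 0 \<le> r \<and> r < t then B r y $ i else 0)"
        by (auto simp: fun_eq_iff indicator_def)
      finally show ?thesis .
    qed
  qed (use t u0 b0 b in auto)
  let ?c = "ou.gradient_const * (real CARD('n) * b)"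
  have c: "0 \<le> ?c" using ou.C b0 by simp
  \<comment> \<open>The summand 1 in the contraction factor avoids a division by 0 if
    \<open>?c\<close> vanishes; since \<open>x / (2 * (x + 1))\<close> is at most 1/2 for
    \<open>x \<ge> 0\<close>, the required halving follows.\<close>
  obtain \<rho> where \<rho>: "0 \<le> \<rho>" and contr: "\<And>s t. 0 \<le> s \<Longrightarrow> s < t \<Longrightarrow> t \<le> T \<Longrightarrow>
      (LINT r:{s<..<t}|lborel. (r - s) powr (- (1 / (2 * \<alpha>))) * weight (1 / (2 * \<alpha>)) \<rho> t r) \<le>
      1 / (2 * (?c + 1)) * weight (1 / (2 * \<alpha>)) \<rho> t s"
    by (rule weight_contraction[OF ou.gamma _ T, of "1 / (2 * (?c + 1))"]) (use c in auto)
  have "?c * (LINT r:{s<..<t}|lborel. (r - s) powr (- (1 / (2 * \<alpha>))) * weight (1 / (2 * \<alpha>)) \<rho> t r) \<le>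
      1 / 2 * weight (1 / (2 * \<alpha>)) \<rho> t s" if s: "0 \<le> s" "s < t" for s
  proof -
    have "?c * (LINT r:{s<..<t}|lborel. (r - s) powr (- (1 / (2 * \<alpha>))) * weight (1 / (2 * \<alpha>)) \<rho> t r) \<le>
        ?c * (1 / (2 * (?c + 1)) * weight (1 / (2 * \<alpha>)) \<rho> t s)"
      by (intro mult_left_mono contr s t c)
    also have "\<dots> = ?c / (2 * (?c + 1)) * weight (1 / (2 * \<alpha>)) \<rho> t s" by simp
    also have "\<dots> \<le> 1 / 2 * weight (1 / (2 * \<alpha>)) \<rho> t s"
    proof (rule mult_right_mono)
      have "x / (2 * (x + 1)) \<le> 1 / 2" if "0 \<le> x" for x :: real using that by (simp add: divide_simps)
      from this[OF c] show "?c / (2 * (?c + 1)) \<le> 1 / 2" .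
    qed simp
    finally show ?thesis .
  qed
  from mp.series_solution[OF \<rho> this] show ?thesis
    unfolding v_def R_def .
qed

end
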